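(* Let $\gamma$ be a simple closed, smooth curve in the hyperbolic plane $\mathbf{H}^2$ (constant curvature $-1$) with length $P$, enclosed area $A$, and geodesic curvature $k(x)$ satisfying $k_{\min}=\min_x k(x)>1$ (convexity with respect to horocycles). For the billiard inside $\gamma$, let $\delta$ be the proportion of the phase space not occupied by $m$-orbits. Then $$\delta \geq \frac{\pi}{2\,\mathrm{arctanh}(\frac{1}{k_{\min}})}\cdot \frac{P^2-A^2-4\pi A}{P\left(2\pi+\sqrt{(2\pi+A)^2-P^2}\right)}.$$
   Context: Billiard setup on the surface: $x$ is an arclength parameter on $\gamma$ ($x\in\mathbf{R}/P\mathbf{Z}$); the billiard trajectories inside $\gamma$ are geodesic segments of the surface. The phase space is $\Omega=\{(x,\varphi): x\in\mathbf{R}/P\mathbf{Z},\ \varphi\in(0,\pi)\}$, $\varphi$ the angle between the tangent to $\gamma$ at $\gamma(x)$ and a geodesic chord leaving $\gamma(x)$ into the region bounded by $\gamma$. The billiard map $T(x,\varphi)=(y,\psi)$ sends it to the next hit point and reflected angle (angle of reflection equals angle of incidence). $T$ preserves $d\mu=\sin\varphi\,dx\,d\varphi$ and $\mu(\Omega)=2P$. Let $L(x,y)$ be the (geodesic) distance between $\gamma(x)$ and $\gamma(y)$. A billiard configuration $\{x_n\}_{n\in\mathbf{Z}}$ (consecutive bounce points of a trajectory) is an $m$-configuration if for all $M<N$ the second variation of $\sum_{n=M}^{N-1}L(x_n,x_{n+1})$ with respect to $x_{M+1},\dots,x_{N-1}$ (endpoints fixed) is negative definite; the corresponding orbits of $T$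 are $m$-orbits. $\mathcal{M}\subseteq\Omega$ is the set of points on $m$-orbits, $\Delta=\Omega\setminus\mathcal{M}$, $\delta=\mu(\Delta)/\mu(\Omega)$. *)

theory Defs
  imports "HOL-Analysis.Analysis"
begin

text \<open>Model: the Poincare disk model of the hyperbolic plane, D = {z :: complex. cmod z < 1},
  with metric 2 |dz| / (1 - |z|^2) (constant curvature -1).\<close>

definition hdist :: "complex \<Rightarrow> complex \<Rightarrow> real" where
  "hdist z w = arcosh (1 + 2 * (cmod (z - w))^2 / ((1 - (cmod z)^2) * (1 - (cmod w)^2)))"

fun vderivs :: "(real \<Rightarrow> complex) \<Rightarrow> nat \<Rightarrow> real \<Rightarrow> complex" where
  "vderivs g 0 = g"
| "vderivs g (Suc n) = (\<lambda>t. vector_derivative (vderivs g n) (at t))"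

definition smooth_curve :: "(real \<Rightarrow> complex) \<Rightarrow> bool" where
  "smooth_curve g \<longleftrightarrow> (\<forall>n t. vderivs g n differentiable (at t))"

definition hyp_arclength_curve :: "(real \<Rightarrow> complex) \<Rightarrow> real \<Rightarrow> bool" where
  "hyp_arclength_curve g P \<longleftrightarrow>
     P > 0 \<and> smooth_curve g \<and> (\<forall>t. cmod (g t) < 1) \<and> (\<forall>t. g (t + P) = g t)
     \<and> inj_on g {0..<P}
     \<and> (\<forall>t. 2 * cmod (vderivs g 1 t) / (1 - (cmod (g t))^2) = 1)"

text \<open>Geodesic curvature (w.r.t. the left normal) in the Poincare disk:
  k = (1-|z|^2)/2 * kappa_euclid + Im(conj z * z') / |z'|.\<close>
definition geod_curv :: "(real \<Rightarrow> complex) \<Rightarrow> real \<Rightarrow> real" where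
  "geod_curv g t =
     (let z = g t; z1 = vderivs g 1 t; z2 = vderivs g 2 t in
       (1 - (cmod z)^2) / 2 * (Im (z2 * cnj z1) / (cmod z1)^3) + Im (cnj z * z1) / cmod z1)"

definition region :: "(real \<Rightarrow> complex) \<Rightarrow> complex set" where
  "region g = inside (range g)"

definition hyp_area :: "complex set \<Rightarrow> real" where
  "hyp_area S = integral S (\<lambda>z. 4 / (1 - (cmod z)^2)^2)"

text \<open>Moebius map of the disk sending p to 0 and its inverse. The geodesic from p to q is
  s \<mapsto> mob_inv p (s * mob p q), s in [0,1]; its initial direction at p is that of mob p q.\<close>
definition mob :: "complex \<Rightarrow> complex \<Rightarrow> complex" where
  "mob p z = (z - p) / (1 - cnj p * z)"

definition mob_inv :: "complex \<Rightarrow> complex \<Rightarrow> complex" where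
  "mob_inv p w = (w + p) / (1 + cnj p * w)"

definition geod_pt :: "complex \<Rightarrow> complex \<Rightarrow> real \<Rightarrow> complex" where
  "geod_pt p q s = mob_inv p (of_real s * mob p q)"

definition Lgen :: "(real \<Rightarrow> complex) \<Rightarrow> real \<Rightarrow> real \<Rightarrow> real" where
  "Lgen g x y = hdist (g x) (g y)"

definition chord_angle :: "(real \<Rightarrow> complex) \<Rightarrow> real \<Rightarrow> real \<Rightarrow> real" where
  "chord_angle g x y = Arg (mob (g x) (g y) / vderivs g 1 x)"

text \<open>Billiard configuration: consecutive bounce points (arclength parameters, taken in R,
  the curve being P-periodic) of a billiard trajectory inside gamma: consecutive points are
  distinct points of the curve, the open geodesic chord between them lies in the region bounded
  by gamma, and at each bounce the angle of reflection equals the angle of incidence.\<close>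
definition billiard_conf :: "(real \<Rightarrow> complex) \<Rightarrow> real \<Rightarrow> (int \<Rightarrow> real) \<Rightarrow> bool" where
  "billiard_conf g P xs \<longleftrightarrow>
     (\<forall>n. g (xs (n + 1)) \<noteq> g (xs n)
          \<and> (\<forall>s\<in>{0<..<1}. geod_pt (g (xs n)) (g (xs (n + 1))) s \<in> region g)
          \<and> chord_angle g (xs n) (xs (n + 1)) = pi - chord_angle g (xs n) (xs (n - 1)))"

definition action :: "(real \<Rightarrow> complex) \<Rightarrow> (int \<Rightarrow> real) \<Rightarrow> int \<Rightarrow> int \<Rightarrow> real" where
  "action g xs M N = (\<Sum>n\<in>{M..<N}. Lgen g (xs n) (xs (n + 1)))"

text \<open>m-configuration: for all M < N, the second variation of the action w.r.t.
  x_{M+1},...,x_{N-1} (endpoints fixed) is negative definite, i.e. for every nonzero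
  variation v supported on {M+1..N-1}, d^2/dt^2 of the action of xs + t v at t = 0 is negative.\<close>
definition m_conf :: "(real \<Rightarrow> complex) \<Rightarrow> real \<Rightarrow> (int \<Rightarrow> real) \<Rightarrow> bool" where
  "m_conf g P xs \<longleftrightarrow> billiard_conf g P xs \<and>
     (\<forall>M N. M < N \<longrightarrow>
        (\<forall>v :: int \<Rightarrow> real. (\<forall>n. n \<notin> {M+1..N-1} \<longrightarrow> v n = 0) \<and> (\<exists>n. v n \<noteq> 0) \<longrightarrow>
           deriv (deriv (\<lambda>t. action g (\<lambda>n. xs n + t * v n) M N)) 0 < 0))"

definition phase_space :: "real \<Rightarrow> (real \<times> real) set" where
  "phase_space P = {0..<P} \<times> {0<..<pi}"

definition bmeasure :: "(real \<times> real) measure" where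
  "bmeasure = density lborel (\<lambda>(x, \<phi>). ennreal (sin \<phi>))"

definition m_set :: "(real \<Rightarrow> complex) \<Rightarrow> real \<Rightarrow> (real \<times> real) set" where
  "m_set g P = {(x, \<phi>) \<in> phase_space P.
      \<exists>xs. m_conf g P xs \<and> xs 0 = x \<and> chord_angle g (xs 0) (xs 1) = \<phi>}"

definition delta_prop :: "(real \<Rightarrow> complex) \<Rightarrow> real \<Rightarrow> real" where
  "delta_prop g P = enn2real (outer_measure_of bmeasure (phase_space P - m_set g P))
                     / enn2real (emeasure bmeasure (phase_space P))"

end

theory Submission
  imports Defs "HOL-Complex_Analysis.Complex_Analysis"
begin

text \<open>Along an m-orbit the Jacobi field vanishing at one bounce has no further zero, which by the mirror
  equation \<open>coth a + coth b = 2 k / sin \<phi>\<close> (\<open>b\<close>, \<open>a\<close> the distances to the focal points of the incoming and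
  outgoing beam, which lie on the chords) and the convexity of \<open>coth\<close> gives \<open>a + b \<ge> 2 artanh (sin \<phi> / k)\<close> at every bounce.
  Adding up, the Birkhoff sums of \<open>2 artanh (sin \<phi> / k) - L\<close> along m-orbits are bounded, so by invariance of the
  measure \<open>2 artanh (sin \<phi> / k)\<close> has at most the mean of \<open>L\<close> over an invariant set containing the m-orbits. Santalo's formula
  bounds the integral of \<open>L\<close> by \<open>2 pi A\<close>; the integral of \<open>2 artanh (sin \<phi> / k)\<close> over \<open>\<phi>\<close> is \<open>2 pi (k - sqrt (k^2 - 1))\<close>,
  a convex function of \<open>k\<close>, which Gauss--Bonnet and Jensen's inequality bound from below after integration.
  The difference is what the complement of the m-orbits has to make up for, at a rate of at most \<open>2 artanh (1 / kmin)\<close>.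

  Working with the bounded Birkhoff sums instead of the m-orbits themselves makes the measurability of the
  set of m-orbits irrelevant. Convexity of the region comes from Hopf's argument on the rotation of secants.
  Area and Santalo's formula are computed in polar coordinates at a boundary point.\<close>

text \<open>The geometry is carried by one complex function, \<open>polar_dir g p t\<close>.
  Together with \<open>cosh_dist p (g t)\<close> it gives the hyperboloid coordinates of
  \<open>p\<close> in the moving frame of the curve, so both obey linear differential equations
  whose only variable coefficient is the curvature. First variation, chord angles, winding numbers
  and polar Jacobians are read off from it. The curvature bound has two uses: positivity of \<kappa>
  gives convexity, and \<kappa> > 1 keeps \<open>sin \<phi> / \<kappa>\<close> at most
  \<open>1 / kmin < 1\<close>, so that the focal estimate at a bounce is finite and uniformly
  bounded. Gauss--Bonnet and Santalo's formula serve as upper bounds: the total curvature is at most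
  2 pi + A, the integral of L at most 2 pi A. With R = sqrt ((2 pi + A)^2 - P^2), Jensen's bound 2
  pi (2 pi + A - R) minus 2 pi A leaves 2 pi (2 pi - R). The fraction in the statement comes from (2
  pi - R) (2 pi + R) = P^2 - A^2 - 4 pi A, and its factor P from the total measure 2 P of the phase
  space.\<close>

lemma has_vector_derivative_quotient:
  fixes f h :: "real \<Rightarrow> complex"
  assumes "(f has_vector_derivative f') (at x within S)" "(h has_vector_derivative h') (at x within S)" "h x \<noteq> 0"
  shows "((\<lambda>x. f x / h x) has_vector_derivative ((f' * h x - f x * h') / (h x * h x))) (at x within S)"
  using has_derivative_divide'[OF assms(1,2)[unfolded has_vector_derivative_def] assms(3)]
  unfolding has_vector_derivative_def by (simp add: algebra_simps scaleR_conv_of_real divide_simps)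

lemma has_vector_derivative_Re:
  "(f has_vector_derivative f') F \<Longrightarrow> ((\<lambda>x. Re (f x)) has_vector_derivative Re f') F"
  by (simp add: has_vector_derivative_complex_iff has_real_derivative_iff_has_vector_derivative)

lemma has_vector_derivative_Im:
  "(f has_vector_derivative f') F \<Longrightarrow> ((\<lambda>x. Im (f x)) has_vector_derivative Im f') F"
  by (simp add: has_vector_derivative_complex_iff has_real_derivative_iff_has_vector_derivative)

lemma of_real_one_minus_cmod2: "complex_of_real (1 - (cmod z)^2) = 1 - z * cnj z"
  by (simp add: complex_norm_square[symmetric])

section \<open>The moving frame of an arclength curve in the disk\<close>

definition utan :: "(real \<Rightarrow> complex) \<Rightarrow> real \<Rightarrow> complex" where
  "utan g t = 2 * vderivs g 1 t / (1 - g t * cnj (g t))"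

text \<open>With \<open>r\<close> the hyperbolic distance from \<open>g t\<close> to \<open>p\<close> and \<open>a\<close> the angle from the tangent vector
  at \<open>g t\<close> to the geodesic towards \<open>p\<close>, \<open>polar_dir g p t\<close> is \<open>sinh r * exp (\<i> * a)\<close> and
  \<open>cosh_dist p (g t)\<close> is \<open>cosh r\<close>.\<close>

definition cosh_dist :: "complex \<Rightarrow> complex \<Rightarrow> real" where
  "cosh_dist p q = 1 + 2 * (cmod (p - q))^2 / ((1 - (cmod p)^2) * (1 - (cmod q)^2))"

definition polar_dir :: "(real \<Rightarrow> complex) \<Rightarrow> complex \<Rightarrow> real \<Rightarrow> complex" where
  "polar_dir g p t = 2 * (p - g t) * (1 - g t * cnj p) * cnj (utan g t)
     / ((1 - p * cnj p) * (1 - g t * cnj (g t)))"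

lemma of_real_cosh_dist:
  "complex_of_real (cosh_dist p q) = 1 + 2 * ((p - q) * (cnj p - cnj q)) / ((1 - p * cnj p) * (1 - q * cnj q))"
  unfolding cosh_dist_def
  by (simp add: complex_norm_square[symmetric] flip: complex_cnj_diff)

lemma cosh_dist_commute: "cosh_dist p q = cosh_dist q p"
  by (simp add: cosh_dist_def norm_minus_commute mult.commute)

lemma cosh_dist_gt_1: "cmod p < 1 \<Longrightarrow> cmod q < 1 \<Longrightarrow> p \<noteq> q \<Longrightarrow> cosh_dist p q > 1"
  by (simp add: cosh_dist_def abs_square_less_1)

lemma one_minus_cnj_nz: "cmod p < 1 \<Longrightarrow> cmod q < 1 \<Longrightarrow> 1 - cnj p * q \<noteq> 0"
proof
  assume a: "cmod p < 1" "cmod q < 1" "1 - cnj p * q = 0"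
  then have "cmod (cnj p * q) = 1" by (metis eq_iff_diff_eq_0 norm_one)
  moreover have "cmod p * cmod q < 1" using a by (metis mult_strict_mono' mult_1 norm_ge_zero)
  ultimately show False by (simp add: norm_mult)
qed

lemma one_minus_cmod2_nz: "cmod p < 1 \<Longrightarrow> 1 - p * cnj p \<noteq> 0"
  using one_minus_cnj_nz[of p p] by (simp add: mult.commute)

locale hyp_arc =
  fixes g :: "real \<Rightarrow> complex" and P :: real
  assumes curve: "hyp_arclength_curve g P"
begin

lemma P_pos: "P > 0" and in_disc: "cmod (g t) < 1" and periodic: "g (t + P) = g t"
  and inj: "inj_on g {0..<P}"
  and speed: "2 * cmod (vderivs g 1 t) / (1 - (cmod (g t))^2) = 1"
  and smooth: "vderivs g n differentiable (at t)"
  using curve unfolding hyp_arclength_curve_def smooth_curve_def by blast+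

abbreviation "u \<equiv> utan g"
abbreviation "\<kappa> \<equiv> geod_curv g"

lemma vderivs_deriv: "(vderivs g n has_vector_derivative vderivs g (Suc n) t) (at t)"
  using smooth[of n t] by (simp add: vector_derivative_works)

lemma cmod2_lt: "(cmod (g t))^2 < 1"
  using in_disc by (simp add: abs_square_less_1)

lemma den_nz: "1 - g t * cnj (g t) \<noteq> 0"
  using in_disc one_minus_cmod2_nz by blast

lemma deriv_eq: "vderivs g 1 t = u t * (1 - g t * cnj (g t)) / 2"
  using den_nz by (simp add: utan_def)

lemma g_deriv: "(g has_vector_derivative (u t * (1 - g t * cnj (g t)) / 2)) (at t)"
  using vderivs_deriv[of 0 t] unfolding deriv_eq[of t, symmetric] by simp

lemma cmod_u: "cmod (u t) = 1"
proof -
  have "cmod (1 - g t * cnj (g t)) = 1 - (cmod (g t))^2"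
    by (metis abs_of_pos cmod2_lt diff_gt_0_iff_gt norm_of_real of_real_one_minus_cmod2)
  then show ?thesis using speed[of t] cmod2_lt[of t] by (auto simp add: utan_def norm_divide norm_mult field_simps)
qed

lemma u_cnj: "u t * cnj (u t) = 1"
  using cmod_u complex_norm_square[of "u t"] by simp

lemma u_deriv_ex: "\<exists>D. (u has_vector_derivative D) (at t)"
proof -
  note d = vderivs_deriv[of 0 t] vderivs_deriv[of 1 t]
  have "((\<lambda>s. 2 * vderivs g 1 s / (1 - g s * cnj (g s))) has_vector_derivative
     ((2 * vderivs g 2 t * (1 - g t * cnj (g t)) - 2 * vderivs g 1 t * (- (vderivs g 1 t * cnj (g t) + g t * cnj (vderivs g 1 t))))
      / ((1 - g t * cnj (g t)) * (1 - g t * cnj (g t))))) (at t)"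
    apply (rule has_vector_derivative_quotient[OF _ _ den_nz])
    using d by (auto intro!: derivative_eq_intros simp: numeral_2_eq_2)
  then show ?thesis unfolding utan_def by blast
qed

text \<open>Since \<open>u\<close> has modulus one, its derivative is \<open>\<i>\<close> times a
  real multiple of \<open>u\<close>; that factor is then solved from the formula defining
  \<open>geod_curv\<close>. The term \<open>Im (cnj (g t) * u t)\<close> is the turning due to the
  conformal factor of the metric.\<close>

lemma u_deriv: "(u has_vector_derivative (\<i> * (\<kappa> t - Im (cnj (g t) * u t)) * u t)) (at t)"
proof -
  define r where "r = 1 - (cmod (g t))^2"
  obtain D where D: "(u has_vector_derivative D) (at t)" using u_deriv_ex by blast
  have r: "r > 0" "complex_of_real r = 1 - g t * cnj (g t)"
    using cmod2_lt by (auto simp: r_def complex_norm_square[symmetric])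
  have "((\<lambda>s. u s * cnj (u s)) has_vector_derivative (u t * cnj D + D * cnj (u t))) (at t)"
    using D by (auto intro!: derivative_eq_intros)
  then have "((\<lambda>s. 1::complex) has_vector_derivative (u t * cnj D + D * cnj (u t))) (at t)"
    by (simp add: u_cnj)
  then have "u t * cnj D + D * cnj (u t) = 0"
    using vector_derivative_unique_at has_vector_derivative_const by blast
  then have re: "Re (D * cnj (u t)) = 0" by (simp add: complex_eq_iff algebra_simps)
  define d where "d = u t * r / 2"
  have gd: "(g has_vector_derivative d) (at t)" using g_deriv[of t] r(2) by (simp add: d_def)
  have 1: "((\<lambda>s. 1 - g s * cnj (g s)) has_vector_derivative (- (d * cnj (g t) + g t * cnj d))) (at t)"
    using gd by (auto intro!: derivative_eq_intros)
  have "((\<lambda>s. u s * (1 - g s * cnj (g s)) / 2) has_vector_derivative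
     (D * r / 2 + u t * (- (d * cnj (g t) + g t * cnj d)) / 2)) (at t)"
    using has_vector_derivative_divide[OF has_vector_derivative_mult[OF D 1], of 2] r(2)
    by (simp add: add_divide_distrib add.commute)
  moreover have "((\<lambda>s. u s * (1 - g s * cnj (g s)) / 2) has_vector_derivative vderivs g 2 t) (at t)"
  proof -
    have "vderivs g 1 = (\<lambda>s. u s * (1 - g s * cnj (g s)) / 2)" by (rule ext) (rule deriv_eq)
    moreover have "Suc 1 = 2" by simp
    ultimately show ?thesis using vderivs_deriv[of 1 t] by metis
  qed
  ultimately have z2: "vderivs g 2 t = D * r / 2 + u t * (- (d * cnj (g t) + g t * cnj d)) / 2"
    by (rule vector_derivative_unique_at[symmetric])
  have z1: "vderivs g 1 t = u t * r / 2" using deriv_eq r by simp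
  have cz1: "cmod (vderivs g 1 t) = r / 2" unfolding z1 using r(1) by (simp add: norm_mult norm_divide cmod_u)
  have cr: "cnj d = cnj (u t) * (r/2)" by (simp add: d_def)
  have alg: "(D * R / 2 + v * (- (v * R / 2 * z' + z * (v' * (R / 2)))) / 2) * (v' * (R / 2))
     = D * v' * (R^2/4) - (v * v') * ((R^2/8) * (v * z' + z * v'))" for D R v v' z z' :: complex
    by (simp add: field_simps power2_eq_square)
  have "vderivs g 2 t * cnj (vderivs g 1 t) = D * cnj (u t) * ((of_real r)^2/4)
      - (u t * cnj (u t)) * (((of_real r)^2/8) * (u t * cnj (g t) + g t * cnj (u t)))"
    using alg[of D "of_real r" "u t" "cnj (g t)" "g t" "cnj (u t)"] unfolding z1 z2 cr d_def by simp
  also have "u t * cnj (g t) + g t * cnj (u t) = complex_of_real (2 * Re (g t * cnj (u t)))"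
    by (simp add: complex_eq_iff)
  also have "D * cnj (u t) * ((of_real r)^2/4) - (u t * cnj (u t)) * (((of_real r)^2/8) * complex_of_real (2 * Re (g t * cnj (u t))))
     = D * cnj (u t) * complex_of_real (r^2/4) - complex_of_real (r^2/8 * (2 * Re (g t * cnj (u t))))"
    unfolding u_cnj by simp
  finally have "Im (vderivs g 2 t * cnj (vderivs g 1 t)) = Im (D * cnj (u t)) * (r^2/4)" by simp
  then have "\<kappa> t = r / 2 * (Im (D * cnj (u t)) * (r^2/4) / (r/2)^3) + Im (cnj (g t) * vderivs g 1 t) / (r / 2)"
    unfolding geod_curv_def Let_def cz1 r_def[symmetric] by (simp only:)
  also have "Im (cnj (g t) * vderivs g 1 t) = Im (cnj (g t) * u t) * (r / 2)"
    unfolding z1 by (simp add: field_simps)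
  finally have 2: "\<kappa> t = r / 2 * (Im (D * cnj (u t)) * (r^2/4) / (r/2)^3) + Im (cnj (g t) * u t) * (r / 2) / (r / 2)" .
  have "r / 2 * (x * (r^2/4) / (r/2)^3) = x" "x * (r / 2) / (r / 2) = x" for x
    using r(1) by (simp_all add: field_simps power2_eq_square power3_eq_cube)
  note this(1)[of "Im (D * cnj (u t))"] this(2)[of "Im (cnj (g t) * u t)"]
  with 2 have "Im (D * cnj (u t)) = \<kappa> t - Im (cnj (g t) * u t)"
    by linarith
  with re have "D * cnj (u t) = \<i> * (\<kappa> t - Im (cnj (g t) * u t))"
    by (simp add: complex_eq_iff)
  then have "D * (u t * cnj (u t)) = \<i> * (\<kappa> t - Im (cnj (g t) * u t)) * u t"
    by (metis mult.assoc mult.commute)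
  then show ?thesis using D by (simp add: u_cnj)
qed

lemma Im_of: "complex_of_real (Im z) = (z - cnj z) / (2 * \<i>)"
  by (simp add: complex_eq_iff Re_divide Im_divide power2_eq_square)

text \<open>Writing the imaginary part through conjugates makes the right side polynomial in
  \<open>u\<close>, \<open>g\<close> and \<open>cnj (g t)\<close>, so that later derivatives reduce
  to polynomial identities.\<close>

lemma u_deriv': "(u has_vector_derivative (\<i> * \<kappa> t * u t - cnj (g t) * (u t)^2 / 2 + g t / 2)) (at t)"
proof -
  have "\<i> * (\<kappa> t - Im (cnj (g t) * u t)) * u t = \<i> * \<kappa> t * u t - cnj (g t) * (u t)^2 / 2 + g t * (u t * cnj (u t)) / 2"
    unfolding of_real_diff Im_of by (simp add: field_simps power2_eq_square)
  with u_deriv[of t] show ?thesis by (simp add: u_cnj)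
qed

text \<open>First variation of length: \<open>cosh r\<close> changes at the rate
  \<open>- sinh r * cos a\<close>. The values are embedded in the complex numbers so that the
  quotient rule applies to the conjugate form of \<open>cosh_dist\<close>.\<close>

lemma cosh_dist_deriv_complex:
  assumes p: "cmod p < 1"
  shows "((\<lambda>s. complex_of_real (cosh_dist p (g s))) has_vector_derivative of_real (- Re (polar_dir g p t))) (at t)"
proof -
  define E1 E2 p' z z' v v' where defs: "E1 = 1 - p * cnj p" "E2 = 1 - g t * cnj (g t)" "p' = cnj p"
    "z = g t" "z' = cnj (g t)" "v = u t" "v' = cnj (u t)"
  define d d' where d: "d = v * E2 / 2" "d' = v' * E2 / 2"
  have E: "E1 \<noteq> 0" "E2 \<noteq> 0" "E1 = 1 - p * p'" "E2 = 1 - z * z'"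
    using one_minus_cmod2_nz[OF p] den_nz[of t] by (auto simp: defs)
  have g1: "(g has_vector_derivative d) (at t)" using g_deriv[of t] by (simp add: defs d)
  then have g2: "((\<lambda>s. cnj (g s)) has_vector_derivative d') (at t)"
    using has_vector_derivative_cnj[OF g1] by (simp add: defs d mult.commute)
  have cd: "cnj d = d'" by (simp add: defs d mult.commute)
  let ?N = "2 * ((p - z) * (p' - z'))"
  define K where "K = - ((p - z) * (1 - z * p') * v' + (p' - z') * (1 - z' * p) * v)"
  have n: "((\<lambda>s. 2 * ((p - g s) * (p' - cnj (g s)))) has_vector_derivative
      (2 * ((p - z) * (- d') + (- d) * (p' - z')))) (at t)"
    using g1 g2 cd by (auto intro!: derivative_eq_intros simp: defs)
  have e: "((\<lambda>s. E1 * (1 - g s * cnj (g s))) has_vector_derivative (E1 * (- (z * d' + d * z')))) (at t)"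
    using g1 g2 cd by (auto intro!: derivative_eq_intros simp: defs)
  have "((\<lambda>s. 1 + 2 * ((p - g s) * (p' - cnj (g s))) / (E1 * (1 - g s * cnj (g s)))) has_vector_derivative
     0 + ((2 * ((p - z) * (- d') + (- d) * (p' - z'))) * (E1 * E2) - ?N * (E1 * (- (z * d' + d * z')))) / (E1 * E2 * (E1 * E2))) (at t)"
    apply (rule has_vector_derivative_add, simp)
    using has_vector_derivative_quotient[OF n e] E(1,2) cd by (simp add: defs)
  moreover have "(2 * ((p - z) * (- d') + (- d) * (p' - z'))) * (E1 * E2) - ?N * (E1 * (- (z * d' + d * z')))
      = K * (E1 * E2)"
  proof -
    have "(2 * ((p - z) * (- d') + (- d) * (p' - z'))) * (E1 * E2) - ?N * (E1 * (- (z * d' + d * z')))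
       = E1 * E2 * (- ((p - z) * v' + v * (p' - z')) * E2 + (p - z) * (p' - z') * (z * v' + v * z'))"
      unfolding d by (simp add: field_simps)
    also have "- ((p - z) * v' + v * (p' - z')) * E2 + (p - z) * (p' - z') * (z * v' + v * z') = K"
      unfolding K_def E(4) by (simp add: algebra_simps)
    finally show ?thesis by (simp add: mult.commute)
  qed
  moreover have "K / (E1 * E2) = - (polar_dir g p t + cnj (polar_dir g p t)) / 2"
  proof -
    have 1: "polar_dir g p t = 2 * ((p - z) * (1 - z * p') * v') / (E1 * E2)"
      by (simp add: polar_dir_def defs mult.assoc)
    then have 2: "cnj (polar_dir g p t) = 2 * ((p' - z') * (1 - z' * p) * v) / (E1 * E2)"
      by (simp add: defs mult.commute)
    show ?thesis unfolding 2 unfolding 1 K_def by (simp add: add_divide_distrib diff_divide_distrib)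
  qed
  moreover have "- (w + cnj w) / 2 = of_real (- Re w)" for w by (simp add: complex_eq_iff)
  ultimately have "((\<lambda>s. 1 + 2 * ((p - g s) * (p' - cnj (g s))) / (E1 * (1 - g s * cnj (g s)))) has_vector_derivative
     0 + (K * (E1 * E2)) / (E1 * E2 * (E1 * E2))) (at t)"
    and *: "K / (E1 * E2) = of_real (- Re (polar_dir g p t))" by (simp_all only:)
  moreover have "0 + (K * (E1 * E2)) / (E1 * E2 * (E1 * E2)) = of_real (- Re (polar_dir g p t))"
    unfolding *[symmetric] using E by simp
  ultimately show ?thesis unfolding of_real_cosh_dist by (simp only: defs)
qed

text \<open>These are the Frenet equations in the hyperboloid model. Seen from the moving frame, the
  fixed point \<open>p\<close> drifts backwards at the rate \<open>cosh r\<close> and rotates with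
  angular speed \<open>- \<kappa> t\<close>.\<close>

lemma polar_dir_deriv:
  assumes p: "cmod p < 1"
  shows "(polar_dir g p has_vector_derivative (- of_real (cosh_dist p (g t)) - \<i> * \<kappa> t * polar_dir g p t)) (at t)"
proof -
  define E1 E2 p' z z' v v' k where defs: "E1 = 1 - p * cnj p" "E2 = 1 - g t * cnj (g t)" "p' = cnj p"
    "z = g t" "z' = cnj (g t)" "v = u t" "v' = cnj (u t)" "k = complex_of_real (\<kappa> t)"
  define d d' w' where d: "d = v * E2 / 2" "d' = v' * E2 / 2" "w' = - \<i> * k * v' - z * v'^2/2 + z' / 2"
  have E: "E1 \<noteq> 0" "E2 \<noteq> 0" "E1 = 1 - p * p'" "E2 = 1 - z * z'" "v * v' = 1"
    using one_minus_cmod2_nz[OF p] den_nz[of t] u_cnj[of t] by (auto simp: defs)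
  have g1: "(g has_vector_derivative d) (at t)" using g_deriv[of t] by (simp add: defs d)
  then have g2: "((\<lambda>s. cnj (g s)) has_vector_derivative d') (at t)"
    using has_vector_derivative_cnj[OF g1] by (simp add: defs d mult.commute)
  have g3: "((\<lambda>s. cnj (u s)) has_vector_derivative w') (at t)"
    using has_vector_derivative_cnj[OF u_deriv'[of t]] by (simp add: defs d)
  have cd: "cnj d = d'" by (simp add: defs d mult.commute)
  have g4: "((\<lambda>s. 2 * (p - g s) * (1 - g s * p')) has_vector_derivative
      (2 * ((p - z) * (- (d * p')) + (- d) * (1 - z * p')))) (at t)"
  proof -
    have 1: "((\<lambda>s. 2 * (p - g s)) has_vector_derivative (2 * (- d))) (at t)"
      using g1 by (auto intro!: derivative_eq_intros)
    have 2: "((\<lambda>s. 1 - g s * p') has_vector_derivative (- (d * p'))) (at t)"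
      using g1 by (auto intro!: derivative_eq_intros)
    have "2 * (p - g t) * (- (d * p')) + 2 * (- d) * (1 - g t * p') = 2 * ((p - z) * (- (d * p')) + (- d) * (1 - z * p'))"
      by (simp only: defs distrib_left mult.assoc)
    then show ?thesis using has_vector_derivative_mult[OF 1 2] by (simp only:)
  qed
  let ?N = "2 * (p - z) * (1 - z * p') * v'"
  let ?N' = "2 * ((p - z) * (1 - z * p') * w' + ((p - z) * (- (d * p')) + (- d) * (1 - z * p')) * v')"
  define K where "K = (-(E1 * E2 + 2 * ((p - z) * (p' - z')))) - \<i> * k * ?N"
  have n: "((\<lambda>s. 2 * (p - g s) * (1 - g s * p') * cnj (u s)) has_vector_derivative ?N') (at t)"
  proof -
    have "2 * (p - g t) * (1 - g t * p') * w' + 2 * ((p - z) * (- (d * p')) + (- d) * (1 - z * p')) * cnj (u t) = ?N'"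
      by (simp only: defs distrib_left distrib_right mult.assoc)
    then show ?thesis using has_vector_derivative_mult[OF g4 g3] by (simp only:)
  qed
  have e: "((\<lambda>s. E1 * (1 - g s * cnj (g s))) has_vector_derivative (E1 * (- (z * d' + d * z')))) (at t)"
    using g1 g2 cd by (auto intro!: derivative_eq_intros simp: defs)
  have "(polar_dir g p has_vector_derivative
      ((?N' * (E1 * E2) - ?N * (E1 * (- (z * d' + d * z')))) / (E1 * E2 * (E1 * E2)))) (at t)"
    unfolding polar_dir_def[abs_def]
    using has_vector_derivative_quotient[OF n e] E(1,2) by (simp add: defs)
  moreover have "?N' * (E1 * E2) - ?N * (E1 * (- (z * d' + d * z'))) = K * (E1 * E2)"
  proof -
    have regroup: "A + C = B - X \<Longrightarrow> B - Y = Q \<Longrightarrow> A - Y + C = Q - X" for A B C X Y Q :: complex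
      by (simp add: algebra_simps)
    have dv: "d * v' = E2 / 2" "v' * (z * d' + d * z') = E2 / 2 * (z * v'^2 + z')"
      using E(5) unfolding d by (simp_all add: algebra_simps power2_eq_square)
    have "?N' * E2 + ?N * (z * d' + d * z') = 2 * E2 * ((p - z) * (1 - z * p') * w' - (d * v') * ((p - z) * p' + (1 - z * p')))
       + 2 * (p - z) * (1 - z * p') * (v' * (z * d' + d * z'))"
      by (simp add: algebra_simps)
    also have "\<dots> = E2 * (2 * (p - z) * (1 - z * p') * w' - E2 * ((p - z) * p' + (1 - z * p')) + (p - z) * (1 - z * p') * (z * v'^2 + z'))"
      unfolding dv by (simp add: field_simps)
    also have "\<dots> = E2 * K"
    proof -
      have "2 * (p - z) * (1 - z * p') * w' + (p - z) * (1 - z * p') * (z * v'^2 + z')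
        = 2 * (p - z) * (1 - z * p') * z' - \<i> * k * ?N"
        unfolding d by (simp add: field_simps)
      moreover have "2 * (p - z) * (1 - z * p') * z' - E2 * ((p - z) * p' + (1 - z * p'))
         = (-(E1 * E2 + 2 * ((p - z) * (p' - z'))))"
        unfolding E(3,4) by (simp add: algebra_simps)
      ultimately have "2 * (p - z) * (1 - z * p') * w' - E2 * ((p - z) * p' + (1 - z * p')) + (p - z) * (1 - z * p') * (z * v'^2 + z') = K"
        unfolding K_def by (rule regroup)
      then show ?thesis by simp
    qed
    finally have "?N' * E2 + ?N * (z * d' + d * z') - K * E2 = 0" by simp
    then have "E1 * (?N' * E2 + ?N * (z * d' + d * z') - K * E2) = 0" by simp
    moreover have "E1 * (a * E2 + b * c - K * E2) = a * (E1 * E2) - b * (E1 * (- c)) - K * (E1 * E2)" for a b c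
      by (simp add: algebra_simps)
    ultimately show ?thesis by (metis eq_iff_diff_eq_0)
  qed
  moreover have "K / (E1 * E2) = - of_real (cosh_dist p (g t)) - \<i> * \<kappa> t * polar_dir g p t"
    unfolding polar_dir_def of_real_cosh_dist K_def using E(1,2) by (simp add: defs add_divide_distrib diff_divide_distrib)
  ultimately show ?thesis using E(1,2) by simp
qed

end

text \<open>On the upper half plane \<open>Arg\<close> is the imaginary part of the holomorphic
  \<open>Ln\<close>, so its rate is the imaginary part of a logarithmic derivative.\<close>

lemma has_real_derivative_Arg:
  fixes f :: "real \<Rightarrow> complex"
  assumes f: "(f has_vector_derivative D) (at t)" and pos: "Im (f t) > 0"
  shows "((\<lambda>s. Arg (f s)) has_real_derivative Im (D / f t)) (at t)"
proof -
  have nz: "f t \<notin> \<real>\<^sub>\<le>\<^sub>0" using pos by (auto simp: complex_nonpos_Reals_iff)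
  have "((Ln \<circ> f) has_vector_derivative (D * inverse (f t))) (at t)"
    by (rule field_vector_diff_chain_at[OF f has_field_derivative_Ln[OF nz]])
  from has_vector_derivative_Im[OF this]
  have d: "((\<lambda>s. Im (Ln (f s))) has_real_derivative Im (D / f t)) (at t)"
    by (simp add: has_real_derivative_iff_has_vector_derivative divide_inverse)
  have "isCont f t" using f by (rule has_vector_derivative_continuous)
  then have "isCont (\<lambda>s. Im (f s)) t" by (rule continuous_Im)
  then have ev: "eventually (\<lambda>s. Im (f s) > 0) (nhds t)"
    unfolding isCont_def
    using iffD1[OF tendsto_at_iff_tendsto_nhds[of "\<lambda>s. Im (f s)" t]] order_tendstoD(1)[OF _ pos] by blast
  show ?thesis
    apply (rule iffD2[OF DERIV_cong_ev[OF refl _ refl] d])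
    by (rule eventually_mono[OF ev]) (metis Arg_eq_Im_Ln less_irrefl zero_complex.sel(2))
qed

lemma mob_altdef: "mob (z::complex) p * (1 - cnj z * p) * (1 - z * cnj p) = (p - z) * (1 - z * cnj p)"
   if "cmod z < 1" "cmod p < 1"
  using one_minus_cnj_nz[OF that] by (simp add: mob_def)

lemma mob_nz: "mob z p \<noteq> 0" if "cmod z < 1" "cmod p < 1" "p \<noteq> z"
  using one_minus_cnj_nz[OF that(1,2)] that by (simp add: mob_def)

section \<open>Polar coordinates of a point seen from the curve, and the curve seen from a
  point\<close>

context hyp_arc
begin

lemma vderivs_periodic: "vderivs g n (t + P) = vderivs g n t"
proof (induction n arbitrary: t)
  case 0 then show ?case by (simp add: periodic)
next
  case (Suc n)
  have d: "((\<lambda>s. s + P) has_vector_derivative 1) (at t)" by (auto intro!: derivative_eq_intros)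
  have "((vderivs g n \<circ> (\<lambda>s. s + P)) has_vector_derivative (1 *\<^sub>R vderivs g (Suc n) (t + P))) (at t)"
    by (rule vector_diff_chain_at[OF d vderivs_deriv])
  moreover have "vderivs g n \<circ> (\<lambda>s. s + P) = vderivs g n" using Suc by auto
  ultimately show ?case using vderivs_deriv[of n t] vector_derivative_unique_at by fastforce
qed

lemma u_periodic: "u (t + P) = u t"
  unfolding utan_def by (simp only: vderivs_periodic periodic)

lemma polar_dir_periodic: "polar_dir g p (t + P) = polar_dir g p t"
  unfolding polar_dir_def by (simp only: u_periodic periodic)

lemma g_cont: "continuous_on S g"
  using vderivs_deriv[of 0] has_vector_derivative_continuous by (metis continuous_at_imp_continuous_on vderivs.simps(1))

lemma vderivs_cont: "continuous_on S (vderivs g n)"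
  using vderivs_deriv has_vector_derivative_continuous by (metis continuous_at_imp_continuous_on)

lemma u_cont: "continuous_on S u"
  using u_deriv has_vector_derivative_continuous by (metis continuous_at_imp_continuous_on)

lemma speed_pos: "vderivs g 1 t \<noteq> 0"
  using speed[of t] by force

lemma curv_cont: "continuous_on S \<kappa>"
  unfolding geod_curv_def[abs_def] Let_def
  using speed_pos by (intro continuous_intros g_cont vderivs_cont) (auto simp del: One_nat_def)

text \<open>This is \<open>sinh^2 r = cosh^2 r - 1\<close>. The algebra rests on the identity |1 - z
  cnj p|^2 = (1 - |p|^2) (1 - |z|^2) + |p - z|^2.\<close>

lemma polar_dir_norm2:
  assumes p: "cmod p < 1"
  shows "(cmod (polar_dir g p t))^2 = (cosh_dist p (g t))^2 - 1"
proof -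
  define E1 E2 p' z z' v v' where defs: "E1 = 1 - p * cnj p" "E2 = 1 - g t * cnj (g t)" "p' = cnj p"
    "z = g t" "z' = cnj (g t)" "v = u t" "v' = cnj (u t)"
  have E: "E1 \<noteq> 0" "E2 \<noteq> 0" "E1 = 1 - p * p'" "E2 = 1 - z * z'" "v * v' = 1"
    using one_minus_cmod2_nz[OF p] den_nz[of t] u_cnj by (auto simp: defs)
  have 1: "polar_dir g p t = 2 * ((p - z) * (1 - z * p') * v') / (E1 * E2)"
    by (simp add: polar_dir_def defs mult.assoc)
  then have 2: "cnj (polar_dir g p t) = 2 * ((p' - z') * (1 - z' * p) * v) / (E1 * E2)"
    by (simp add: defs mult.commute)
  have 3: "of_real (cosh_dist p (g t)) = 1 + 2 * ((p - z) * (p' - z')) / (E1 * E2)"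
    unfolding of_real_cosh_dist defs by simp
  have 4: "(1 - z * p') * (1 - z' * p) = E1 * E2 + (p - z) * (p' - z')"
    unfolding E(3,4) by (simp add: algebra_simps)
  have "polar_dir g p t * cnj (polar_dir g p t) = 4 * ((p - z) * (p' - z')) * (v * v') * ((1 - z * p') * (1 - z' * p)) / (E1 * E2)^2"
    unfolding 2 unfolding 1 by (simp add: power2_eq_square)
  also have "\<dots> = (1 + 2 * ((p - z) * (p' - z')) / (E1 * E2))^2 - 1"
    unfolding 4 E(5) using E(1,2) by (simp add: field_simps power2_eq_square)
  finally have "complex_of_real ((cmod (polar_dir g p t))^2) = of_real ((cosh_dist p (g t))^2 - 1)"
    unfolding complex_norm_square using 3 by simp
  then show ?thesis by (simp only: of_real_eq_iff)
qed

lemma polar_dir_eq_0_iff: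
  assumes p: "cmod p < 1"
  shows "polar_dir g p t = 0 \<longleftrightarrow> p = g t"
proof
  assume "polar_dir g p t = 0"
  then have "(cosh_dist p (g t))^2 = 1" using polar_dir_norm2[OF p, of t] by simp
  then show "p = g t" using cosh_dist_gt_1[OF p in_disc, of t]
    by (metis one_less_power order_less_irrefl zero_less_numeral)
qed (simp add: polar_dir_def)

lemma polar_dir_mob_pos:
  assumes p: "cmod p < 1"
  obtains c where "c > 0" "polar_dir g p t = of_real c * (mob (g t) p * cnj (u t))"
proof
  define c where "c = 2 * (cmod (1 - cnj (g t) * p))^2 / ((1 - (cmod p)^2) * (1 - (cmod (g t))^2))"
  note nz = one_minus_cnj_nz[OF in_disc p, of t]
  show "c > 0" unfolding c_def using nz p cmod2_lt[of t] by (simp add: abs_square_less_1)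
  have "of_real c = 2 * ((1 - cnj (g t) * p) * (1 - g t * cnj p)) / ((1 - p * cnj p) * (1 - g t * cnj (g t)))"
    unfolding c_def by (simp only: of_real_divide of_real_mult of_real_one_minus_cmod2 complex_norm_square) simp
  then have "of_real c * (mob (g t) p * cnj (u t)) = 2 * (mob (g t) p * (1 - cnj (g t) * p) * (1 - g t * cnj p)) * cnj (u t) / ((1 - p * cnj p) * (1 - g t * cnj (g t)))"
    by simp
  also have "\<dots> = polar_dir g p t"
    unfolding mob_altdef[OF in_disc p] polar_dir_def by simp
  finally show "polar_dir g p t = of_real c * (mob (g t) p * cnj (u t))" ..
qed

text \<open>\<open>mob (g t)\<close> moves \<open>g t\<close> to the origin, where a point at
  hyperbolic distance \<open>r\<close> has modulus \<open>tanh (r / 2)\<close>; the formulas express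
  \<open>sinh r\<close> and \<open>cosh r\<close> through that half-argument tangent.\<close>

lemma polar_dir_mob:
  fixes t :: real
  assumes p: "cmod p < 1"
  defines "w \<equiv> mob (g t) p"
  shows "cmod w < 1" "polar_dir g p t = of_real (2 / (1 - (cmod w)^2)) * (w * cnj (u t))"
    "cosh_dist p (g t) = (1 + (cmod w)^2) / (1 - (cmod w)^2)"
proof -
  define X where "X = (1 - (cmod p)^2) * (1 - (cmod (g t))^2)"
  define n where "n = (cmod (1 - cnj (g t) * p))^2"
  define q where "q = (cmod (p - g t))^2"
  note nz = one_minus_cnj_nz[OF in_disc p, of t]
  have X: "X > 0" unfolding X_def using p cmod2_lt[of t] by (simp add: abs_square_less_1)
  have n: "n > 0" unfolding n_def using nz by simp
  have w: "(cmod w)^2 = q / n" unfolding w_def mob_def q_def n_def by (simp add: norm_divide power_divide)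
  have "complex_of_real n = of_real (X + q)"
    unfolding n_def X_def q_def by (simp only: of_real_add of_real_mult of_real_one_minus_cmod2 complex_norm_square) (simp add: algebra_simps)
  then have nq: "n = X + q" by (simp only: of_real_eq_iff)
  have 1: "1 - (cmod w)^2 = X / n" unfolding w using nq n by (simp add: field_simps)
  then have "(cmod w)^2 < 1" using X n by (smt (verit) divide_pos_pos)
  then show "cmod w < 1" by (simp add: abs_square_less_1)
  show "cosh_dist p (g t) = (1 + (cmod w)^2) / (1 - (cmod w)^2)"
  proof -
    have "(1 + q / n) / (X / n) = (n + q) / X" using n X by (simp add: field_simps)
    also have "\<dots> = 1 + 2 * q / X" unfolding nq using X by (simp add: add_divide_distrib)
    finally show ?thesis unfolding 1 unfolding w cosh_dist_def X_def[symmetric] q_def[symmetric] by simp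
  qed
  have c: "complex_of_real (2 / (1 - (cmod w)^2)) = 2 * ((1 - cnj (g t) * p) * (1 - g t * cnj p)) / ((1 - p * cnj p) * (1 - g t * cnj (g t)))"
    unfolding 1 n_def X_def by (simp only: of_real_divide of_real_mult of_real_one_minus_cmod2 complex_norm_square) simp
  have "of_real (2 / (1 - (cmod w)^2)) * (w * cnj (u t)) = 2 * (mob (g t) p * (1 - cnj (g t) * p) * (1 - g t * cnj p)) * cnj (u t) / ((1 - p * cnj p) * (1 - g t * cnj (g t)))"
    unfolding c unfolding w_def by simp
  also have "\<dots> = polar_dir g p t"
    unfolding mob_altdef[OF in_disc p] polar_dir_def by simp
  finally show "polar_dir g p t = of_real (2 / (1 - (cmod w)^2)) * (w * cnj (u t))" ..
qed

lemma chord_angle_eq: "chord_angle g x y = Arg (polar_dir g (g y) x)"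
proof -
  obtain c where c: "c > 0" "polar_dir g (g y) x = of_real c * (mob (g x) (g y) * cnj (u x))"
    using polar_dir_mob_pos[OF in_disc] by blast
  define r where "r = 1 - (cmod (g x))^2"
  have r: "r > 0" "complex_of_real r = 1 - g x * cnj (g x)"
    using cmod2_lt by (auto simp: r_def complex_norm_square[symmetric])
  have iu: "1 / u x = cnj (u x)" using u_cnj[of x] cmod_u[of x]
    by (metis norm_zero one_neq_zero nonzero_mult_div_cancel_left)
  have "mob (g x) (g y) / vderivs g 1 x = of_real (2 / r) * mob (g x) (g y) * (1 / u x)"
    unfolding deriv_eq using r by (simp add: mult.commute)
  also have "\<dots> = of_real (2 / r) * (mob (g x) (g y) * cnj (u x))" unfolding iu by simp
  finally have "Arg (mob (g x) (g y) / vderivs g 1 x) = Arg (mob (g x) (g y) * cnj (u x))"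
    using r(1) Arg_times_of_real[of "2 / r"] by simp
  moreover have "Arg (polar_dir g (g y) x) = Arg (mob (g x) (g y) * cnj (u x))"
    unfolding c(2) using c(1) Arg_times_of_real by blast
  ultimately show ?thesis by (simp add: chord_angle_def)
qed

text \<open>Seen from \<open>p\<close> the curve has logarithmic derivative
  \<open>- 1 / polar_dir g p t\<close>, whose imaginary part \<open>sin a / sinh r\<close> is its
  angular speed. Chord angles, winding numbers and the polar Jacobian all use this formula.\<close>

lemma mob_deriv:
  assumes p: "cmod p < 1" and ne: "p \<noteq> g t"
  shows "((\<lambda>s. mob p (g s)) has_vector_derivative (- mob p (g t) / polar_dir g p t)) (at t)"
proof -
  define E1 E2 p' z z' v v' where defs: "E1 = 1 - p * cnj p" "E2 = 1 - g t * cnj (g t)" "p' = cnj p"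
    "z = g t" "z' = cnj (g t)" "v = u t" "v' = cnj (u t)"
  have E: "E1 \<noteq> 0" "E2 \<noteq> 0" "E1 = 1 - p * p'" "E2 = 1 - z * z'" "v * v' = 1"
    using one_minus_cmod2_nz[OF p] den_nz[of t] u_cnj by (auto simp: defs)
  have nz: "1 - p' * z \<noteq> 0" using one_minus_cnj_nz[OF p in_disc, of t] by (simp add: defs)
  have nz2: "p - z \<noteq> 0" using ne by (simp add: defs)
  have v': "v' = 1 / v" "v \<noteq> 0" using E(5) by (auto simp: eq_divide_eq mult.commute)
  have "((\<lambda>s. (g s - p) / (1 - p' * g s)) has_vector_derivative
     (((v * E2 / 2) * (1 - p' * z) - (z - p) * (- (p' * (v * E2 / 2)))) / ((1 - p' * z) * (1 - p' * z)))) (at t)"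
    using nz g_deriv[of t] unfolding defs
    by (intro has_vector_derivative_quotient) (auto intro!: derivative_eq_intros)
  moreover have "((v * E2 / 2) * (1 - p' * z) - (z - p) * (- (p' * (v * E2 / 2)))) = v * E2 * E1 / 2"
    unfolding E(3) by (simp add: field_simps)
  moreover have "- mob p (g t) / polar_dir g p t = (v * E2 * E1 / 2) / ((1 - p' * z) * (1 - p' * z))"
  proof -
    have A: "polar_dir g p t = 2 * (p - z) * (1 - p' * z) / (v * (E1 * E2))"
      unfolding polar_dir_def using v' by (simp add: defs mult.commute)
    have B: "mob p (g t) = (z - p) / (1 - p' * z)" by (simp add: mob_def defs)
    have C: "- ((z - p) / a) / (2 * (p - z) * a / (v * b)) = (v * b / 2) / (a * a)" if "a \<noteq> 0" for a b
      using that nz2 by (simp add: divide_simps) (simp add: algebra_simps)?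
    show ?thesis unfolding A B C[OF nz] by (simp only: mult.assoc mult.commute[of E1 E2])
  qed
  moreover have "(\<lambda>s. mob p (g s)) = (\<lambda>s. (g s - p) / (1 - p' * g s))" by (simp add: mob_def defs)
  ultimately show ?thesis by (simp only:)
qed

lemma mob_mult_deriv:
  assumes p: "cmod p < 1" and ne: "p \<noteq> g t"
  shows "((\<lambda>s. mob p (g s) * w) has_vector_derivative (- (mob p (g t) * w) / polar_dir g p t)) (at t)"
  using has_vector_derivative_mult_left[OF mob_deriv[OF assms], of w] by simp

lemma cont_polar_dir:
  fixes f :: "'a::topological_space \<Rightarrow> complex"
  assumes "continuous_on S f" "continuous_on S h" "\<And>x. x \<in> S \<Longrightarrow> cmod (f x) < 1"
  shows "continuous_on S (\<lambda>x. polar_dir g (f x) (h x))"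
proof -
  have cg: "continuous_on S (\<lambda>x. g (h x))" and cu: "continuous_on S (\<lambda>x. u (h x))"
    using assms(2) by (auto intro: continuous_on_compose2[OF g_cont[of UNIV]] continuous_on_compose2[OF u_cont[of UNIV]])
  have "(1 - f x * cnj (f x)) * (1 - g (h x) * cnj (g (h x))) \<noteq> 0" if "x \<in> S" for x
    using den_nz one_minus_cmod2_nz[OF assms(3)[OF that]] by (simp only: mult_eq_0_iff) blast
  then show ?thesis unfolding polar_dir_def
    by (intro continuous_on_divide continuous_on_mult continuous_on_diff continuous_on_const continuous_on_cnj cg cu assms(1)) blast
qed

lemma cont_cosh_dist:
  fixes f :: "'a::topological_space \<Rightarrow> complex"
  assumes "continuous_on S f" "continuous_on S h" "\<And>x. x \<in> S \<Longrightarrow> cmod (f x) < 1" "\<And>x. x \<in> S \<Longrightarrow> cmod (h x) < 1"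
  shows "continuous_on S (\<lambda>x. cosh_dist (f x) (h x))"
proof -
  have "(1 - (cmod (f x))^2) * (1 - (cmod (h x))^2) \<noteq> 0" if "x \<in> S" for x
  proof -
    have "(cmod (f x))^2 < 1" "(cmod (h x))^2 < 1"
      using assms(3,4)[OF that] by (simp_all add: abs_square_less_1)
    then show ?thesis by simp
  qed
  then show ?thesis unfolding cosh_dist_def
    by (intro continuous_on_add continuous_on_divide continuous_on_mult continuous_on_diff continuous_on_const continuous_on_power continuous_on_norm assms(1,2)) blast
qed

lemma g_eq_iff: "g x = g y \<longleftrightarrow> (\<exists>n::int. x = y + of_int n * P)"
proof -
  have per: "g (x + of_int n * P) = g x" for x n
  proof (induction n rule: int_induct[where k=0])
    case (step1 i) then show ?case using periodic[of "x + of_int i * P"] by (simp add: algebra_simps)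
  next
    case (step2 i) then show ?case using periodic[of "x + (of_int i - 1) * P"] by (simp add: algebra_simps)
  qed simp
  define r where "r x = x - of_int \<lfloor>x / P\<rfloor> * P" for x
  have r: "r x \<in> {0..<P}" for x
    unfolding r_def using P_pos floor_divide_lower[OF P_pos, of x] floor_divide_upper[OF P_pos, of x] by (auto simp: algebra_simps)
  have gr: "g (r x) = g x" for x using per[of x "- \<lfloor>x / P\<rfloor>"] by (simp add: r_def)
  show ?thesis
  proof
    assume "g x = g y"
    then have "g (r x) = g (r y)" by (simp only: gr)
    then have "r x = r y" by (rule inj_onD[OF inj _ r r])
    then have "x = y + of_int (\<lfloor>x / P\<rfloor> - \<lfloor>y / P\<rfloor>) * P" by (simp add: r_def algebra_simps)
    then show "\<exists>n::int. x = y + of_int n * P" by blast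
  next
    assume "\<exists>n::int. x = y + of_int n * P"
    then show "g x = g y" using per[of y] by blast
  qed
qed

lemma g_neq: "0 < y - x \<Longrightarrow> y - x < P \<Longrightarrow> g x \<noteq> g y"
proof
  assume a: "0 < y - x" "y - x < P" "g x = g y"
  then obtain n :: int where n: "y = x + of_int n * P" using g_eq_iff[of y x] by metis
  then have "0 < of_int n * P" "of_int n * P < 1 * P" using a(1,2) by auto
  then have "0 < n" "n < 1" using P_pos by (auto simp: zero_less_mult_iff)
  then show False by simp
qed

lemma vderivs_shift: "vderivs g n (t + of_int m * P) = vderivs g n t"
proof (induction m rule: int_induct[where k=0])
  case (step1 i) then show ?case using vderivs_periodic[of n "t + of_int i * P"] by (simp add: algebra_simps)
next
  case (step2 i) then show ?case using vderivs_periodic[of n "t + (of_int i - 1) * P"] by (simp add: algebra_simps)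
qed simp

lemma g_shift: "g (x + of_int m * P) = g x" using vderivs_shift[of 0 x m] by simp

lemma curv_shift: "\<kappa> (t + of_int m * P) = \<kappa> t"
  unfolding geod_curv_def by (simp only: vderivs_shift g_shift)

lemma curv_ge_INF: "(INF x\<in>{0..P}. \<kappa> x) \<le> \<kappa> t"
proof -
  define r where "r = t + of_int (- \<lfloor>t / P\<rfloor>) * P"
  have "r \<in> {0..P}"
    unfolding r_def using P_pos floor_divide_lower[OF P_pos, of t] floor_divide_upper[OF P_pos, of t] by (auto simp: algebra_simps)
  moreover have "bdd_below (\<kappa> ` {0..P})"
    by (intro bounded_imp_bdd_below compact_imp_bounded compact_continuous_image curv_cont) simp
  ultimately have "(INF x\<in>{0..P}. \<kappa> x) \<le> \<kappa> r" by (intro cINF_lower)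
  then show ?thesis unfolding r_def curv_shift .
qed

end

section \<open>Convexity\<close>

text \<open>Where the angle vanishes, \<open>A\<close> is positive and \<open>N\<close> crosses zero
  upwards. So \<open>th\<close> becomes positive after \<open>s\<close>, and a first return to zero
  would need \<open>N < 0\<close> just before it, although \<open>th\<close> lies there between 0
  and \<open>pi\<close>. Since \<open>th\<close> is a continuous lift and not a principal value, it
  may exceed \<open>pi\<close>.\<close>

lemma angle_stays_positive:
  fixes th N A k \<rho> :: "real \<Rightarrow> real"
  assumes cont: "continuous_on {s..<e} th" and "th s = 0" and "N s = 0"
    and N: "\<And>t. t \<in> {s<..<e} \<Longrightarrow> N t = \<rho> t * sin (th t)"
    and A: "\<And>t. t \<in> {s<..<e} \<Longrightarrow> A t = \<rho> t * cos (th t)"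
    and \<rho>: "\<And>t. t \<in> {s<..<e} \<Longrightarrow> \<rho> t > 0"
    and der: "\<And>t. t \<in> {s..<e} \<Longrightarrow> (N has_real_derivative k t * A t) (at t)"
    and k: "\<And>t. k t > 0"
    and t: "t \<in> {s<..<e}"
  shows "th t > 0"
proof (rule ccontr)
  assume neg: "\<not> th t > 0"
  have se: "s < e" using t by auto
  have "continuous (at s within {s..<e}) th" using cont se by (simp add: continuous_on_eq_continuous_within)
  then obtain d where d: "d > 0" "\<And>x. x \<in> {s..<e} \<Longrightarrow> dist x s < d \<Longrightarrow> dist (th x) (th s) < pi / 2"
    unfolding continuous_within_eps_delta using pi_half_gt_zero by metis
  have small: "th x > 0" if x: "s < x" "x < s + d" "x < e" for x
  proof -
    have "N s < N x"
    proof (rule DERIV_pos_imp_increasing_open[OF x(1)])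
      fix y assume y: "s < y" "y < x"
      then have "\<bar>th y\<bar> < pi / 2" using d(2)[of y] x \<open>th s = 0\<close> by (auto simp: dist_real_def)
      then have "A y > 0" using A[of y] \<rho>[of y] y x cos_gt_zero_pi[of "th y"] by auto
      then show "\<exists>z. (N has_real_derivative z) (at y) \<and> 0 < z" using der[of y] k[of y] y x by (intro exI[of _ "k y * A y"]) auto
    next
      show "continuous_on {s..x} N"
        using x by (intro continuous_at_imp_continuous_on ballI DERIV_isCont[OF der]) auto
    qed
    then have "0 < \<rho> x * sin (th x)" using N[of x] x \<open>N s = 0\<close> by auto
    then have "sin (th x) > 0" using \<rho>[of x] x by (simp add: zero_less_mult_iff)
    moreover have "\<bar>th x\<bar> < pi / 2" using d(2)[of x] x \<open>th s = 0\<close> by (auto simp: dist_real_def)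
    ultimately show ?thesis using sin_ge_zero[of "- th x"] by (cases "th x > 0") auto
  qed
  define t0 where "t0 = s + min d (t - s) / 2"
  have t0: "s < t0" "t0 < s + d" "t0 \<le> t" using d t by (auto simp: t0_def min_def field_simps)
  \<comment> \<open>\<open>Inf Z\<close> will be the first return; the search starts at
    \<open>t0\<close>, up to which positivity is already known.\<close>
  define Z where "Z = {x \<in> {t0..t}. th x \<le> 0}"
  have ct: "continuous_on {t0..t} th" using t0 t by (intro continuous_on_subset[OF cont]) auto
  have "Z = {t0..t} \<inter> th -` {..0}" by (auto simp: Z_def)
  then have "closed Z" using continuous_closed_preimage[OF ct closed_atLeastAtMost closed_atMost] by simp
  moreover have "t \<in> Z" using neg t0 by (auto simp: Z_def)
  moreover have "bdd_below Z" by (rule bdd_belowI[of _ t0]) (auto simp: Z_def)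
  ultimately have tZ: "Inf Z \<in> Z" by (intro closed_contains_Inf) auto
  define ts where "ts = Inf Z"
  have ts: "ts \<in> {t0..t}" "th ts \<le> 0" using tZ by (auto simp: Z_def ts_def)
  have before: "th x > 0" if "s < x" "x < ts" for x
  proof (cases "x < t0")
    case True then show ?thesis using small[of x] that t0 t by auto
  next
    case False
    then have "x \<notin> Z" using that \<open>bdd_below Z\<close> cInf_lower[of x Z] by (auto simp: ts_def)
    then show ?thesis using False that ts by (auto simp: Z_def)
  qed
  have "th t0 > 0" using small[of t0] t0 t by auto
  then have "t0 < ts" using ts by (metis atLeastAtMost_iff leD le_less)
  have "th ts = 0"
  proof (rule ccontr)
    assume "th ts \<noteq> 0"
    then have "th ts < 0" using ts by auto
    have "continuous_on {t0..ts} th" using ts by (intro continuous_on_subset[OF ct]) auto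
    then obtain x where "t0 \<le> x" "x \<le> ts" "th x = 0"
      using IVT2'[of th ts 0 t0] \<open>th t0 > 0\<close> \<open>th ts < 0\<close> \<open>t0 < ts\<close> by auto
    then show False using before[of x] t0 \<open>th ts < 0\<close> by (cases "x = ts") auto
  qed
  have tse: "ts \<in> {s<..<e}" using ts t0 t by auto
  have "N ts = 0" "A ts > 0" using N[OF tse] A[OF tse] \<rho>[OF tse] \<open>th ts = 0\<close> by auto
  then have "k ts * A ts > 0" using k[of ts] by simp
  then obtain d1 where d1: "d1 > 0" "\<And>h. h > 0 \<Longrightarrow> h < d1 \<Longrightarrow> N (ts - h) < 0"
    using DERIV_pos_inc_left[OF der[of ts]] tse \<open>N ts = 0\<close> by auto
  have "continuous (at ts within {s..<e}) th" using cont tse by (simp add: continuous_on_eq_continuous_within)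
  then obtain d2 where d2: "d2 > 0" "\<And>x. x \<in> {s..<e} \<Longrightarrow> dist x ts < d2 \<Longrightarrow> dist (th x) (th ts) < pi"
    unfolding continuous_within_eps_delta using pi_gt_zero by metis
  define h where "h = min (min d1 d2) (ts - s) / 2"
  have h: "h > 0" "h < d1" "h < d2" "h < ts - s" using d1 d2 tse by (auto simp: h_def min_def field_simps)
  have "0 < th (ts - h)" "th (ts - h) < pi"
    using before[of "ts - h"] d2(2)[of "ts - h"] h tse \<open>th ts = 0\<close> by (auto simp: dist_real_def)
  then have "N (ts - h) > 0" using N[of "ts - h"] \<rho>[of "ts - h"] h tse by (auto intro!: mult_pos_pos sin_gt_zero)
  then show False using d1(2)[of h] h by auto
qed

section \<open>Hopf's secant map on the strip of pairs of parameters\<close>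

context hyp_arc
begin

text \<open>The difference quotient of \<open>g\<close> written as a mean velocity, which stays
  continuous at \<open>t = s\<close>.\<close>

definition secant :: "real \<times> real \<Rightarrow> complex" where
  "secant p = integral (cbox 0 1) (\<lambda>\<tau>. vderivs g 1 (fst p + \<tau> * (snd p - fst p)))"

lemma secant_eq: "(t - s) * secant (s, t) = g t - g s"
proof -
  have "((\<lambda>\<tau>. complex_of_real (t - s) * vderivs g 1 (s + \<tau> * (t - s))) has_integral g (s + 1 * (t - s)) - g (s + 0 * (t - s))) {0..1}"
  proof (rule fundamental_theorem_of_calculus)
    fix x :: real
    have d: "((\<lambda>x. s + x * (t - s)) has_vector_derivative (t - s)) (at x)"
      by (auto intro!: derivative_eq_intros)
    have "((g \<circ> (\<lambda>x. s + x * (t - s))) has_vector_derivative ((t - s) *\<^sub>R vderivs g 1 (s + x * (t - s)))) (at x)"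
      by (rule vector_diff_chain_at[OF d]) (use vderivs_deriv[of 0] in simp)
    then show "((\<lambda>x. g (s + x * (t - s))) has_vector_derivative complex_of_real (t - s) * vderivs g 1 (s + x * (t - s))) (at x within {0..1})"
      by (auto simp: o_def scaleR_conv_of_real intro: has_vector_derivative_at_within)
  qed simp
  then show ?thesis unfolding secant_def by (simp add: integral_unique flip: integral_mult_right)
qed

lemma secant_diag: "secant (s, s) = vderivs g 1 s"
  unfolding secant_def by simp

lemma secant_cont: "continuous_on U secant"
proof -
  have "continuous_on UNIV secant" unfolding secant_def[abs_def]
    by (rule integral_continuous_on_param)
      (auto intro!: continuous_intros continuous_on_compose2[OF vderivs_cont[of UNIV 1]] simp: split_beta simp del: One_nat_def)
  then show ?thesis using continuous_on_subset by blast
qed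

definition strip :: "(real \<times> real) set" where
  "strip = {p. 0 \<le> snd p - fst p \<and> snd p - fst p \<le> P}"

text \<open>Hopf's secant map, divided by \<open>(t - s) * (P - (t - s))\<close> so that it extends continuously and
  without zeros to both boundary lines of the strip.\<close>

definition hopf :: "real \<times> real \<Rightarrow> complex" where
  "hopf p = (if snd p - fst p \<le> P / 2 then secant p / (P - (snd p - fst p))
     else - secant (fst p, snd p - P) / (snd p - fst p))"

text \<open>The two branches of \<open>hopf\<close> agree on the open strip because
  \<open>(s, t)\<close> and \<open>(s, t - P)\<close> belong to the same chord; each branch is
  continuous up to one boundary line.\<close>

lemma hopf_alt: "hopf (s, t) = - secant (s, t - P) / (t - s)" if "0 < t - s" "t - s < P"
proof -
  define b where "b = P - (t - s)"
  have "complex_of_real (t - s) * secant (s, t) = complex_of_real (t - P - s) * secant (s, t - P)"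
    using secant_eq[of t s] secant_eq[of "t - P" s] periodic[of "t - P"] by simp
  also have "t - P - s = - b" by (simp add: b_def)
  finally have "complex_of_real (t - s) * secant (s, t) = - complex_of_real b * secant (s, t - P)" by simp
  then have "secant (s, t) / complex_of_real b = - secant (s, t - P) / complex_of_real (t - s)"
    using that by (simp add: b_def field_simps del: of_real_diff)
  then have "secant (s, t) / (P - (t - s)) = - secant (s, t - P) / (t - s)"
    by (simp only: b_def)
  then show ?thesis by (simp add: hopf_def)
qed

lemma hopf_eq: "hopf (s, t) = (g t - g s) / complex_of_real ((t - s) * (P - (t - s)))" if "0 < t - s" "t - s < P"
proof -
  have "secant (s, t - P) = - (g t - g s) / complex_of_real (P - (t - s))"
  proof -
    have "complex_of_real (P - (t - s)) * secant (s, t - P) = - (complex_of_real (t - P - s) * secant (s, t - P))"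
      by (simp add: algebra_simps)
    also have "\<dots> = - (g t - g s)" using secant_eq[of "t - P" s] periodic[of "t - P"] by simp
    finally show ?thesis using that by (simp add: eq_divide_eq mult.commute flip: of_real_diff)
  qed
  then show ?thesis unfolding hopf_alt[OF that] of_real_mult
    by (simp add: mult.commute del: of_real_diff minus_diff_eq)
qed

lemma hopf_diag: "hopf (s, s) = vderivs g 1 s / P" and hopf_antidiag: "hopf (s, s + P) = - vderivs g 1 s / P"
  using P_pos secant_diag by (auto simp: hopf_def)

lemma hopf_cont: "continuous_on strip hopf"
proof -
  define U where "U = {p \<in> strip. snd p - fst p \<le> P / 2}"
  define V where "V = {p \<in> strip. snd p - fst p \<ge> P / 2}"
  have "strip = U \<union> V" by (auto simp: U_def V_def)
  have cl: "closed U" "closed V" unfolding U_def V_def strip_def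
    by (auto intro!: closed_Collect_conj closed_Collect_le continuous_intros)
  have 1: "continuous_on U hopf"
  proof (rule continuous_on_eq)
    show "continuous_on U (\<lambda>p. secant p / (P - (snd p - fst p)))"
      using P_pos by (intro continuous_intros secant_cont) (auto simp: U_def simp flip: of_real_diff)
  qed (auto simp: hopf_def U_def)
  have 2: "continuous_on V hopf"
  proof (rule continuous_on_eq)
    show "continuous_on V (\<lambda>p. - secant (fst p, snd p - P) / (snd p - fst p))"
      using P_pos by (intro continuous_intros continuous_on_compose2[OF secant_cont[of UNIV]]) (auto simp: V_def simp flip: of_real_diff)
  next
    fix p assume "p \<in> V"
    moreover obtain s t where "p = (s, t)" by force
    ultimately show "- secant (fst p, snd p - P) / (snd p - fst p) = hopf p"
      using hopf_alt[of t s] P_pos by (cases "t - s < P") (auto simp: V_def strip_def hopf_def)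
  qed
  show ?thesis unfolding \<open>strip = U \<union> V\<close> by (rule continuous_on_closed_Un[OF cl 1 2])
qed

lemma hopf_nz: "p \<in> strip \<Longrightarrow> hopf p \<noteq> 0"
proof -
  assume p: "p \<in> strip"
  obtain s t where st: "p = (s, t)" by force
  have "0 \<le> t - s" "t - s \<le> P" using p by (auto simp: strip_def st)
  then consider "t = s" | "t = s + P" | "0 < t - s" "t - s < P" by linarith
  then show ?thesis
  proof cases
    case 3
    then have "(t - s) * (P - (t - s)) \<noteq> 0" by simp
    then have "complex_of_real ((t - s) * (P - (t - s))) \<noteq> 0" by (simp only: of_real_eq_0_iff not_False_eq_True)
    moreover have "g t - g s \<noteq> 0" using g_neq[of t s] 3 by auto
    ultimately show ?thesis using hopf_eq[OF 3] by (simp only: st divide_eq_0_iff) blast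
  qed (use hopf_diag hopf_antidiag speed_pos P_pos st in auto)
qed

text \<open>Reversing a chord turns its direction by half a turn. Done twice, the swap advances both
  endpoints by one period.\<close>

lemma hopf_swap: "hopf (t, s + P) = - hopf (s, t)" if "(s, t) \<in> strip"
proof -
  have "0 \<le> t - s" "t - s \<le> P" using that by (auto simp: strip_def)
  then consider "t = s" | "t = s + P" | "0 < t - s" "t - s < P" by linarith
  then show ?thesis
  proof cases
    case 2 then show ?thesis using hopf_diag[of "s + P"] hopf_antidiag[of s] vderivs_periodic[of 1 s] by simp
  next
    case 3
    then have "hopf (t, s + P) = (g s - g t) / complex_of_real ((s + P - t) * (P - (s + P - t)))"
      using hopf_eq[of "s + P" t] periodic[of s] by simp
    also have "(s + P - t) * (P - (s + P - t)) = (t - s) * (P - (t - s))" by (simp add: algebra_simps)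
    finally show ?thesis using hopf_eq[OF 3] by (simp add: minus_divide_left)
  qed (use hopf_diag hopf_antidiag in simp)
qed

lemma strip_convex: "convex strip"
proof -
  have "strip = (\<lambda>p. snd p - fst p) -` {0..P}" by (auto simp: strip_def)
  moreover have "linear (\<lambda>p::real\<times>real. snd p - fst p)" by (intro linearI) (auto simp: algebra_simps)
  ultimately show ?thesis using convex_linear_vimage by force
qed

end

locale hyp_curve = hyp_arc +
  assumes curv_gt_1: "\<And>t. geod_curv g t > 1"
begin

lemma max_norm_param: obtains x0 where "\<And>t. cmod (g t) \<le> cmod (g x0)"
proof -
  obtain x0 where x0: "x0 \<in> {0..P}" "\<And>t. t \<in> {0..P} \<Longrightarrow> cmod (g t) \<le> cmod (g x0)"
    using continuous_attains_sup[of "{0..P}" "\<lambda>t. cmod (g t)"] P_pos g_cont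
    by (force intro: continuous_intros)
  have "cmod (g t) \<le> cmod (g x0)" for t
  proof -
    define r where "r = t - of_int \<lfloor>t / P\<rfloor> * P"
    have "r \<in> {0..P}"
      unfolding r_def using P_pos floor_divide_lower[OF P_pos, of t] floor_divide_upper[OF P_pos, of t] by (auto simp: algebra_simps)
    moreover have "g t = g r" unfolding g_eq_iff r_def by (rule exI[of _ "\<lfloor>t / P\<rfloor>"]) simp
    ultimately show ?thesis using x0(2) by simp
  qed
  then show ?thesis using that by blast
qed

lemma cis_eq_minus_one: "cis x = -1 \<Longrightarrow> \<exists>n::int. x = pi + 2 * pi * of_int n"
proof -
  assume "cis x = -1"
  then have "cis x = cis pi" by (simp add: cis_pi)
  then have "exp (\<i> * complex_of_real x) = exp (\<i> * complex_of_real pi)" by (simp add: cis_conv_exp)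
  then obtain n :: int where "\<i> * complex_of_real x = \<i> * complex_of_real pi + (of_int (2 * n) * pi) * \<i>"
    unfolding exp_eq by blast
  from arg_cong[OF this, of Im] show ?thesis by (intro exI[of _ n]) simp
qed

text \<open>The strip is contractible, so the argument of the nonvanishing \<open>hopf\<close> lifts
  to \<theta>. By \<open>hopf_swap\<close> the increment of \<theta> under the swap is an odd
  multiple of \<open>pi\<close>, hence constant, and \<open>2 * c\<close> is the total turning of
  the tangent. The bound on \<open>c\<close> comes from the secants at the point farthest from the
  origin, none of which points radially outwards.\<close>

lemma hopf_angle:
  obtains \<theta> c where "continuous_on strip \<theta>"
    "\<And>p. p \<in> strip \<Longrightarrow> hopf p = of_real (cmod (hopf p)) * cis (\<theta> p)"
    "\<And>s t. (s, t) \<in> strip \<Longrightarrow> \<theta> (t, s + P) = \<theta> (s, t) + c"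
    "cis c = -1" "\<bar>c\<bar> < 2 * pi"
proof -
  obtain \<Lambda> where L: "continuous_on strip \<Lambda>" "\<And>p. p \<in> strip \<Longrightarrow> hopf p = exp (\<Lambda> p)"
    using continuous_logarithm_on_contractible[OF hopf_cont convex_imp_contractible[OF strip_convex] hopf_nz] by blast
  define \<theta> where "\<theta> p = Im (\<Lambda> p)" for p
  have c\<theta>: "continuous_on strip \<theta>" unfolding \<theta>_def by (intro continuous_intros L)
  have pol: "hopf p = of_real (cmod (hopf p)) * cis (\<theta> p)" if "p \<in> strip" for p
    using L(2)[OF that] by (simp add: \<theta>_def exp_eq_polar[symmetric] flip: exp_eq_polar)
  define h where "h p = \<theta> (snd p, fst p + P) - \<theta> p" for p
  have sw: "(t, s + P) \<in> strip" if "(s, t) \<in> strip" for s t using that by (auto simp: strip_def)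
  have hc: "continuous_on strip h" unfolding h_def
    by (intro continuous_intros c\<theta> continuous_on_compose2[OF c\<theta>]) (auto simp: strip_def)
  have h1: "cis (h p) = -1" if "p \<in> strip" for p
  proof -
    obtain s t where p: "p = (s, t)" by force
    have n: "cmod (hopf p) \<noteq> 0" using hopf_nz[OF that] by simp
    have e: "cmod (hopf (t, s + P)) = cmod (hopf p)" using hopf_swap[of s t] that by (simp add: p)
    have "of_real (cmod (hopf p)) * cis (\<theta> (t, s + P)) = - (of_real (cmod (hopf p)) * cis (\<theta> p))"
      using pol[OF sw, of s t] pol[OF that] hopf_swap[of s t] that unfolding e unfolding p by metis
    then have "of_real (cmod (hopf p)) * cis (\<theta> (t, s + P)) = of_real (cmod (hopf p)) * (- cis (\<theta> p))" by simp
    then have "cis (\<theta> (t, s + P)) = - cis (\<theta> p)" using n by (metis mult_cancel_left of_real_eq_0_iff)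
    moreover have "cis (\<theta> (t, s + P)) = cis (h p) * cis (\<theta> p)" by (simp add: h_def p cis_mult)
    ultimately have "cis (h p) * cis (\<theta> p) = (-1) * cis (\<theta> p)" by (simp only: mult_minus1)
    then show ?thesis using cis_neq_zero mult_right_cancel by blast
  qed
  have "h constant_on strip"
  proof (rule continuous_discrete_range_constant[OF _ hc])
    show "connected strip" using strip_convex convex_connected by blast
    fix p assume p: "p \<in> strip"
    show "\<exists>e>0. \<forall>q. q \<in> strip \<and> h q \<noteq> h p \<longrightarrow> e \<le> norm (h q - h p)"
    proof (intro exI[of _ "2 * pi"] conjI allI impI)
      fix q assume q: "q \<in> strip \<and> h q \<noteq> h p"
      obtain n m :: int where nm: "h p = pi + 2 * pi * of_int n" "h q = pi + 2 * pi * of_int m"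
        using cis_eq_minus_one[OF h1] p q by blast
      then have "n \<noteq> m" using q by auto
      then have "1 \<le> \<bar>real_of_int m - of_int n\<bar>" by linarith
      then have "2 * pi * 1 \<le> 2 * pi * \<bar>real_of_int m - of_int n\<bar>" by (intro mult_left_mono) auto
      also have "\<dots> = \<bar>2 * pi * (real_of_int m - of_int n)\<bar>" by (simp add: abs_mult)
      also have "2 * pi * (real_of_int m - of_int n) = h q - h p" unfolding nm by (simp add: algebra_simps)
      finally show "2 * pi \<le> norm (h q - h p)" by simp
    qed simp
  qed
  then obtain c where c: "\<And>p. p \<in> strip \<Longrightarrow> h p = c" by (auto simp: constant_on_def)
  have dg: "(s, s) \<in> strip" for s using P_pos by (auto simp: strip_def)
  have c1: "cis c = -1" using h1[OF dg[of 0]] c[OF dg[of 0]] by simp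
  obtain x0 where x0: "\<And>t. cmod (g t) \<le> cmod (g x0)" using max_norm_param by blast
  have g0: "g x0 \<noteq> 0"
  proof
    assume "g x0 = 0"
    then have "g 0 = g (P / 2)" using x0[of 0] x0[of "P/2"] by simp
    then show False using g_neq[of "P/2" 0] P_pos by auto
  qed
  \<comment> \<open>A secant from the farthest point in the outward direction would leave the disk
    of radius \<open>cmod (g x0)\<close>.\<close>
  have no: False if t: "0 < t - x0" "t - x0 < P" and v: "\<theta> (x0, t) = Arg (g x0) + 2 * pi * of_int m" for t m
  proof -
    have st: "(x0, t) \<in> strip" using t by (auto simp: strip_def)
    have "cis (\<theta> (x0, t)) = cis (Arg (g x0)) * cis (2 * pi * of_int m)" unfolding v by (rule cis_mult[symmetric])
    also have "cis (2 * pi * of_int m) = 1" by (rule cis_multiple_2pi) simp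
    finally have "cis (\<theta> (x0, t)) = g x0 / cmod (g x0)" using g0 cis_Arg[of "g x0"] by (simp add: sgn_eq)
    then have "hopf (x0, t) = of_real (cmod (hopf (x0, t))) * (g x0 / cmod (g x0))" using pol[OF st] by simp
    then have "hopf (x0, t) = of_real (cmod (hopf (x0, t)) / cmod (g x0)) * g x0" by simp
    then have "hopf (x0, t) * cnj (g x0) = of_real (cmod (hopf (x0, t)) / cmod (g x0)) * (g x0 * cnj (g x0))"
      by (metis mult.assoc)
    also have "\<dots> = of_real (cmod (hopf (x0, t)) / cmod (g x0) * (cmod (g x0))^2)" unfolding of_real_mult complex_norm_square ..
    finally have "Re (hopf (x0, t) * cnj (g x0)) > 0" using g0 hopf_nz[OF st] by simp
    moreover have "Re (hopf (x0, t) * cnj (g x0)) \<le> 0"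
    proof -
      have "(t - x0) * (P - (t - x0)) > 0" using t by simp
      moreover have "hopf (x0, t) * cnj (g x0) = ((g t - g x0) * cnj (g x0)) / complex_of_real ((t - x0) * (P - (t - x0)))"
        unfolding hopf_eq[OF t] by simp
      moreover have "Re ((g t - g x0) * cnj (g x0)) \<le> 0"
      proof -
        have "Re (g t * cnj (g x0)) \<le> cmod (g t) * cmod (g x0)" using complex_Re_le_cmod[of "g t * cnj (g x0)"] by (simp add: norm_mult)
        also have "\<dots> \<le> cmod (g x0) * cmod (g x0)" using x0 by (intro mult_right_mono) auto
        also have "\<dots> = Re (g x0 * cnj (g x0))" using complex_norm_square[of "g x0"] by (metis Re_complex_of_real power2_eq_square)
        finally show ?thesis by (simp add: algebra_simps)
      qed
      ultimately show ?thesis by (simp only: Re_divide_of_real) (simp add: divide_nonpos_pos)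
    qed
    ultimately show False by simp
  qed
  have ch: "\<theta> (x0, x0 + P) = \<theta> (x0, x0) + c" using c[OF dg[of x0]] by (simp add: h_def)
  have ct: "continuous_on {x0..x0 + P} (\<lambda>t. \<theta> (x0, t))"
    by (intro continuous_on_compose2[OF c\<theta>] continuous_intros) (auto simp: strip_def)
  have c2: "\<bar>c\<bar> < 2 * pi"
  proof (rule ccontr)
    assume "\<not> \<bar>c\<bar> < 2 * pi"
    moreover have "\<bar>c\<bar> \<noteq> 2 * pi" using c1 by (auto simp: abs_if split: if_splits) (metis cis_2pi cis_inverse inverse_1 minus_equation_iff one_neq_neg_one add.inverse_inverse)+
    ultimately have big: "\<bar>c\<bar> > 2 * pi" by simp
    \<comment> \<open>If \<open>\<bar>c\<bar>\<close> exceeded \<open>2 * pi\<close>, the secant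
      angles at \<open>x0\<close> would pass through an argument of the outward direction;
      \<open>v\<close> is the first such argument above the smaller end value.\<close>
    define a where "a = min (\<theta> (x0, x0)) (\<theta> (x0, x0 + P))"
    define m where "m = \<lfloor>(a - Arg (g x0)) / (2 * pi)\<rfloor> + 1"
    define v where "v = Arg (g x0) + 2 * pi * of_int m"
    have "of_int m > (a - Arg (g x0)) / (2 * pi)" "of_int m \<le> (a - Arg (g x0)) / (2 * pi) + 1"
      unfolding m_def by linarith+
    then have "v > a" "v \<le> a + 2 * pi" unfolding v_def by (simp_all add: field_simps)
    then have "a < v" "v < max (\<theta> (x0, x0)) (\<theta> (x0, x0 + P))" using big ch unfolding a_def by (auto simp: abs_if split: if_splits)
    then have "\<exists>t. x0 \<le> t \<and> t \<le> x0 + P \<and> \<theta> (x0, t) = v"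
      using IVT'[of "\<lambda>t. \<theta> (x0, t)" x0 v "x0 + P"] IVT2'[of "\<lambda>t. \<theta> (x0, t)" "x0 + P" v x0] ct P_pos
      unfolding a_def by (auto simp: min_def max_def split: if_splits)
    then obtain t where t: "x0 \<le> t" "t \<le> x0 + P" "\<theta> (x0, t) = v" by blast
    then have "t \<noteq> x0" "t \<noteq> x0 + P" using \<open>a < v\<close> \<open>v < max _ _\<close> unfolding a_def by (auto simp: min_def max_def split: if_splits)
    then show False using no[of t m] t by (auto simp: v_def)
  qed
  show ?thesis
  proof (rule that[OF c\<theta> pol _ c1 c2])
    show "\<theta> (t, s + P) = \<theta> (s, t) + c" if "(s, t) \<in> strip" for s t using c[OF that] by (simp add: h_def)
  qed
qed

text \<open>Subtracting \<open>b\<close>, the argument of \<open>1 - cnj (g s) * g t\<close>, turns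
  the Euclidean secant direction into the initial direction of the geodesic. For a fixed target and
  a moving base point, \<open>angle_stays_positive\<close> keeps the angle above 0 and, applied from
  the other end, below \<open>c\<close>. Then \<open>0 < c < 2 * pi\<close> and
  \<open>cis c = -1\<close> force \<open>c = pi\<close>: every chord starts strictly to the left of
  the tangent.\<close>

lemma lifted_angle:
  obtains \<phi> where "continuous_on strip \<phi>" "\<And>s. \<phi> (s, s) = 0" "\<And>s. \<phi> (s, s + P) = pi"
    "\<And>s t. 0 < t - s \<Longrightarrow> t - s < P \<Longrightarrow> 0 < \<phi> (s, t) \<and> \<phi> (s, t) < pi
        \<and> polar_dir g (g t) s = of_real (cmod (polar_dir g (g t) s)) * cis (\<phi> (s, t))"
proof -
  obtain \<theta> c where ct: "continuous_on strip \<theta>"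
    and pol: "\<And>p. p \<in> strip \<Longrightarrow> hopf p = of_real (cmod (hopf p)) * cis (\<theta> p)"
    and sw: "\<And>s t. (s, t) \<in> strip \<Longrightarrow> \<theta> (t, s + P) = \<theta> (s, t) + c"
    and c: "cis c = -1" "\<bar>c\<bar> < 2 * pi" using hopf_angle by blast
  have dg: "(s, s) \<in> strip" for s using P_pos by (auto simp: strip_def)
  define b where "b p = Arg (1 - cnj (g (fst p)) * g (snd p))" for p
  have re: "Re (1 - cnj (g s) * g t) > 0" for s t
  proof -
    have "cmod (cnj (g s) * g t) < 1" using in_disc[of s] in_disc[of t]
      by (metis complex_mod_cnj mult_strict_mono' mult_1 norm_ge_zero norm_mult)
    then show ?thesis using complex_Re_le_cmod[of "cnj (g s) * g t"] by simp
  qed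
  have cb: "continuous_on strip b"
  proof -
    have "continuous_on strip (Arg \<circ> (\<lambda>p. 1 - cnj (g (fst p)) * g (snd p)))"
    proof (rule continuous_on_compose)
      show "continuous_on strip (\<lambda>p. 1 - cnj (g (fst p)) * g (snd p))"
        by (intro continuous_intros continuous_on_compose2[OF g_cont[of UNIV]]) auto
      show "continuous_on ((\<lambda>p. 1 - cnj (g (fst p)) * g (snd p)) ` strip) Arg"
      proof (intro continuous_at_imp_continuous_on ballI continuous_at_Arg)
        fix z assume "z \<in> (\<lambda>p. 1 - cnj (g (fst p)) * g (snd p)) ` strip"
        then have "Re z > 0" using re by blast
        then show "z \<notin> \<real>\<^sub>\<le>\<^sub>0" by (auto simp: complex_nonpos_Reals_iff)
      qed
    qed
    then show ?thesis by (simp add: b_def[abs_def] o_def)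
  qed
  have bcis: "1 - cnj (g s) * g t = of_real (cmod (1 - cnj (g s) * g t)) * cis (b (s, t))" for s t
  proof -
    have "1 - cnj (g s) * g t \<noteq> 0" using re[of s t] by force
    then show ?thesis by (simp add: b_def cis_Arg sgn_eq)
  qed
  define \<phi> where "\<phi> p = \<theta> p - b p - \<theta> (fst p, fst p)" for p
  have cf: "continuous_on strip \<phi>" unfolding \<phi>_def
    by (intro continuous_intros ct cb continuous_on_compose2[OF ct]) (auto simp: dg)
  have bdiag: "b (s, s) = 0" for s
  proof -
    have "1 - cnj (g s) * g s = complex_of_real (1 - (cmod (g s))^2)" unfolding of_real_one_minus_cmod2 by simp
    then show ?thesis unfolding b_def using cmod2_lt[of s] by (simp del: of_real_diff)
  qed
  have per: "b (s, t + P) = b (s, t)" for s t by (simp add: b_def periodic)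
  have ucis: "u s = cis (\<theta> (s, s))" for s
  proof -
    define r where "r = (1 - (cmod (g s))^2) / (2 * P)"
    have r: "r > 0" unfolding r_def using cmod2_lt P_pos by simp
    have "complex_of_real r = (1 - g s * cnj (g s)) / (2 * P)" unfolding r_def of_real_divide of_real_one_minus_cmod2 by simp
    then have h: "hopf (s, s) = r * u s" unfolding hopf_diag deriv_eq by simp
    then have "cmod (hopf (s, s)) = r" using r by (simp add: norm_mult cmod_u)
    then have "complex_of_real r * u s = r * cis (\<theta> (s, s))" using pol[OF dg[of s]] h by simp
    then show ?thesis using r by simp
  qed
  have main: "polar_dir g (g t) s = of_real (cmod (polar_dir g (g t) s)) * cis (\<phi> (s, t))" if st: "0 < t - s" "t - s < P" for s t
  proof -
    obtain k where k: "k > 0" "polar_dir g (g t) s = of_real k * (mob (g s) (g t) * cnj (u s))"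
      using polar_dir_mob_pos[OF in_disc] by blast
    have "(s, t) \<in> strip" using st by (auto simp: strip_def)
    note pol = pol[OF this]
    define r where "r = cmod (hopf (s, t)) * ((t - s) * (P - (t - s)))"
    have nz: "complex_of_real ((t - s) * (P - (t - s))) \<noteq> 0" using st by (simp only: of_real_eq_0_iff) simp
    have "g t - g s = hopf (s, t) * complex_of_real ((t - s) * (P - (t - s)))"
      unfolding hopf_eq[OF st] by (rule iffD1[OF nonzero_divide_eq_eq[OF nz] refl])
    also have "\<dots> = complex_of_real r * cis (\<theta> (s, t))" by (subst pol) (simp add: r_def)
    finally have 1: "g t - g s = complex_of_real r * cis (\<theta> (s, t))" .
    define q where "q = cmod (1 - cnj (g s) * g t)"
    have 2: "1 - cnj (g s) * g t = complex_of_real q * cis (b (s, t))" using bcis q_def by simp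
    have 3: "cnj (u s) = cis (- \<theta> (s, s))" unfolding ucis by (simp add: cis_cnj)
    have "polar_dir g (g t) s = of_real (k * r / q) * (cis (\<theta> (s, t)) / cis (b (s, t)) * cis (- \<theta> (s, s)))"
      unfolding k(2) mob_def 1 2 3 by simp
    also have "cis (\<theta> (s, t)) / cis (b (s, t)) * cis (- \<theta> (s, s)) = cis (\<phi> (s, t))"
      by (simp add: cis_divide cis_mult \<phi>_def)
    finally have e: "polar_dir g (g t) s = of_real (k * r / q) * cis (\<phi> (s, t))" .
    have "k * r / q \<ge> 0" using k st by (simp add: r_def q_def)
    then have "cmod (polar_dir g (g t) s) = k * r / q" unfolding e by (simp only: norm_mult norm_cis norm_of_real mult_1_right abs_of_nonneg)
    then show ?thesis using e by simp
  qed
  have diag: "\<phi> (s, s) = 0" for s by (simp add: \<phi>_def bdiag)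
  have adiag: "\<phi> (s, s + P) = c" for s using sw[OF dg[of s]] by (simp add: \<phi>_def bdiag per)
  have k: "\<kappa> t > 0" for t using curv_gt_1[of t] by simp
  have zpos: "cmod (polar_dir g (g t) s) > 0" if "0 < t - s" "t - s < P" for s t
    using polar_dir_eq_0_iff[OF in_disc] g_neq[OF that] by force
  have Imd: "((\<lambda>t. Im (polar_dir g p t)) has_real_derivative - (\<kappa> t * Re (polar_dir g p t))) (at t)" if "cmod p < 1" for p t
    using has_vector_derivative_Im[OF polar_dir_deriv[OF that, of t]] by (simp add: has_real_derivative_iff_has_vector_derivative)
  have pos1: "\<phi> (s, t) > 0" if st: "0 < t - s" "t - s < P" for s t
  proof -
    \<comment> \<open>The target \<open>g t\<close> is fixed and the base point moves backwards away
      from it.\<close>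
    define th where "th r = \<phi> (t - r, t)" for r
    define N where "N r = Im (polar_dir g (g t) (t - r))" for r
    define A where "A r = Re (polar_dir g (g t) (t - r))" for r
    have "th (t - s) > 0"
    proof (rule angle_stays_positive[of 0 P th N "\<lambda>r. cmod (polar_dir g (g t) (t - r))" A "\<lambda>r. \<kappa> (t - r)"])
      show "continuous_on {0..<P} th" unfolding th_def
        by (intro continuous_on_compose2[OF cf] continuous_intros) (auto simp: strip_def)
      show "th 0 = 0" "N 0 = 0" by (simp_all add: th_def diag N_def polar_dir_def)
      fix r assume r: "r \<in> {0<..<P}"
      then have e: "polar_dir g (g t) (t - r) = of_real (cmod (polar_dir g (g t) (t - r))) * cis (th r)"
        using main[of t "t - r"] by (simp add: th_def)
      show "N r = cmod (polar_dir g (g t) (t - r)) * sin (th r)" unfolding N_def by (subst e) simp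
      show "A r = cmod (polar_dir g (g t) (t - r)) * cos (th r)" unfolding A_def by (subst e) simp
      show "cmod (polar_dir g (g t) (t - r)) > 0" using zpos[of t "t - r"] r by simp
    next
      fix r assume "r \<in> {0..<P}"
      show "(N has_real_derivative \<kappa> (t - r) * A r) (at r)" unfolding N_def A_def
      proof -
        have d: "((\<lambda>r. t - r) has_real_derivative -1) (at r)" by (auto intro!: derivative_eq_intros)
        show "((\<lambda>r. Im (polar_dir g (g t) (t - r))) has_real_derivative \<kappa> (t - r) * Re (polar_dir g (g t) (t - r))) (at r)"
          using DERIV_chain2[where f="\<lambda>x. Im (polar_dir g (g t) x)", OF Imd[OF in_disc[of t], of "t - r"] d] by simp
      qed
    qed (use k st in auto)
    then show ?thesis by (simp add: th_def)
  qed
  have odd: "sin (c - x) = sin x" "cos (c - x) = - cos x" for x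
    using c(1) by (simp_all add: sin_diff cos_diff complex_eq_iff)
  have pos2: "\<phi> (t, s + P) < c" if st: "0 < t - s" "t - s < P" for s t
  proof -
    \<comment> \<open>The base point moves forwards away from the target. The angle is counted down
      from \<open>c\<close>, which stands in for \<open>pi\<close> until the two are known to be
      equal.\<close>
    define th where "th r = c - \<phi> (r, s + P)" for r
    define N where "N r = Im (polar_dir g (g s) r)" for r
    define A where "A r = - Re (polar_dir g (g s) r)" for r
    have "th t > 0"
    proof (rule angle_stays_positive[of s "s + P" th N "\<lambda>r. cmod (polar_dir g (g s) r)" A \<kappa>])
      show "continuous_on {s..<s + P} th" unfolding th_def
        by (intro continuous_on_compose2[OF cf] continuous_intros) (auto simp: strip_def)
      show "th s = 0" "N s = 0" by (simp_all add: th_def adiag N_def polar_dir_def)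
      fix r assume r: "r \<in> {s<..<s + P}"
      then have e: "polar_dir g (g s) r = of_real (cmod (polar_dir g (g s) r)) * cis (c - th r)"
        using main[of "s + P" r] by (simp add: th_def periodic)
      show "N r = cmod (polar_dir g (g s) r) * sin (th r)" unfolding N_def by (subst e) (simp add: odd)
      show "A r = cmod (polar_dir g (g s) r) * cos (th r)" unfolding A_def by (subst e) (simp add: odd)
      show "cmod (polar_dir g (g s) r) > 0" using zpos[of "s + P" r] r by (simp add: periodic)
    next
      fix r assume "r \<in> {s..<s + P}"
      show "(N has_real_derivative \<kappa> r * A r) (at r)" unfolding N_def A_def
        using Imd[OF in_disc[of s], of r] by simp
    qed (use k st in auto)
    then show ?thesis by (simp add: th_def)
  qed
  have lt: "\<phi> (s, t) < c" if st: "0 < t - s" "t - s < P" for s t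
    using pos2[of s "t - P"] pos2[of "s" "t"] st pos2[of "t - P" s] by simp
  have "c > 0" using pos1[of "P/2" 0] lt[of "P/2" 0] P_pos by simp
  obtain n :: int where n: "c = pi + 2 * pi * of_int n" using cis_eq_minus_one[OF c(1)] by blast
  have "c = pi"
  proof -
    have "pi * (1 + 2 * of_int n) > 0" "pi * (1 + 2 * of_int n) < pi * 2" using n \<open>c > 0\<close> c(2) by (auto simp: algebra_simps)
    then have "(0::real) < 1 + 2 * of_int n" "1 + 2 * of_int n < (2::real)" by (auto simp: zero_less_mult_iff)
    then have "n = 0" by linarith
    then show ?thesis using n by simp
  qed
  show ?thesis by (rule that[OF cf diag]) (use adiag \<open>c = pi\<close> pos1 lt main in auto)
qed

end

section \<open>Chord angles as functions of the endpoints\<close>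

context hyp_curve
begin

abbreviation dir :: "real \<Rightarrow> real \<Rightarrow> complex" where "dir x y \<equiv> polar_dir g (g y) x"

lemma param_shift:
  assumes "g y \<noteq> g x"
  obtains s where "0 < s" "s < P" "g y = g (x + s)"
proof -
  define s where "s = (y - x) - of_int \<lfloor>(y - x) / P\<rfloor> * P"
  have s: "0 \<le> s" "s < P"
    unfolding s_def using P_pos floor_divide_lower[OF P_pos, of "y - x"] floor_divide_upper[OF P_pos, of "y - x"] by (auto simp: algebra_simps)
  have e: "g y = g (x + s)" unfolding g_eq_iff s_def by (rule exI[of _ "\<lfloor>(y - x) / P\<rfloor>"]) simp
  then have "s \<noteq> 0" using assms by auto
  then show ?thesis using that[OF _ s(2) e] s by simp
qed

text \<open>Convexity in the form used from here on; it restates that the angle of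
  \<open>lifted_angle\<close> lies in \<open>(0, pi)\<close>.\<close>

lemma dir_pos: assumes "g y \<noteq> g x" shows "Im (dir x y) > 0"
proof -
  obtain s where s: "0 < s" "s < P" "g y = g (x + s)" using param_shift[OF assms] .
  obtain \<phi> where f: "\<And>s t. 0 < t - s \<Longrightarrow> t - s < P \<Longrightarrow> 0 < \<phi> (s, t) \<and> \<phi> (s, t) < pi
        \<and> polar_dir g (g t) s = of_real (cmod (polar_dir g (g t) s)) * cis (\<phi> (s, t))" using lifted_angle by metis
  have f1: "0 < \<phi> (x, x + s)" "\<phi> (x, x + s) < pi" "dir x y = of_real (cmod (dir x y)) * cis (\<phi> (x, x + s))"
    using f[of "x + s" x] s by auto
  have "dir x y \<noteq> 0" using polar_dir_eq_0_iff[OF in_disc] assms by simp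
  moreover have "Im (dir x y) = cmod (dir x y) * sin (\<phi> (x, x + s))" by (subst f1(3)) simp
  ultimately show ?thesis using sin_gt_zero[OF f1(1,2)] by simp
qed

lemma dir_nz: "g y \<noteq> g x \<Longrightarrow> dir x y \<noteq> 0"
  using dir_pos by fastforce

lemma chord_angle_bounds: assumes "g y \<noteq> g x" shows "0 < chord_angle g x y" "chord_angle g x y < pi"
  using dir_pos[OF assms] Arg_lt_pi[of "dir x y"] by (simp_all add: chord_angle_eq)

lemma dir_polar: "dir x y = of_real (cmod (dir x y)) * cis (chord_angle g x y)"
proof (cases "dir x y = 0")
  case False then show ?thesis by (simp add: chord_angle_eq cis_Arg sgn_eq)
qed simp

lemma sin_chord_angle: "g y \<noteq> g x \<Longrightarrow> sin (chord_angle g x y) = Im (dir x y) / cmod (dir x y)"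
  using dir_nz[of y x] arg_cong[OF dir_polar[where x=x and y=y], of Im] by (simp add: field_simps)

lemma cos_chord_angle: "g y \<noteq> g x \<Longrightarrow> cos (chord_angle g x y) = Re (dir x y) / cmod (dir x y)"
  using dir_nz[of y x] arg_cong[OF dir_polar[where x=x and y=y], of Re] by (simp add: field_simps)

lemma norm_dir_commute: "cmod (dir x y) = cmod (dir y x)"
  using polar_dir_norm2[OF in_disc, of x y] polar_dir_norm2[OF in_disc, of y x]
  by (metis cosh_dist_commute norm_ge_zero power2_eq_imp_eq)

lemma chord_angle_cong2: "g y = g y' \<Longrightarrow> chord_angle g x y = chord_angle g x y'"
  by (simp add: chord_angle_eq)

lemma polar_dir_shift: "polar_dir g p (t + of_int m * P) = polar_dir g p t"
  unfolding polar_dir_def utan_def by (simp only: vderivs_shift g_shift)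

lemma chord_angle_shift: "chord_angle g (x + of_int m * P) y = chord_angle g x y"
  by (simp add: chord_angle_eq polar_dir_shift)

text \<open>A chord is described by its base point and the parameter offset \<open>s\<close> to its
  far end. The values outside \<open>(0, P)\<close> are the limits at the ends, which makes
  \<open>ang\<close> continuous on the whole plane.\<close>

definition ang :: "real \<Rightarrow> real \<Rightarrow> real" where
  "ang x s = (if s \<le> 0 then 0 else if s \<ge> P then pi else chord_angle g x (x + s))"

lemma g_neq': "0 < s \<Longrightarrow> s < P \<Longrightarrow> g (x + s) \<noteq> g x" using g_neq[of "x + s" x] by auto

lemma ang_eq: "0 < s \<Longrightarrow> s < P \<Longrightarrow> ang x s = chord_angle g x (x + s)" by (simp add: ang_def)

lemma ang_ends: "ang x 0 = 0" "ang x P = pi" using P_pos by (auto simp: ang_def)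

lemma ang_bounds: "0 < s \<Longrightarrow> s < P \<Longrightarrow> 0 < ang x s" "0 < s \<Longrightarrow> s < P \<Longrightarrow> ang x s < pi"
  using chord_angle_bounds[OF g_neq'] by (simp_all add: ang_eq)

lemma ang_cont: "continuous_on (UNIV \<times> {0..P}) (\<lambda>p. ang (fst p) (snd p))"
proof -
  obtain \<phi> where f: "continuous_on strip \<phi>" "\<And>s. \<phi> (s, s) = 0" "\<And>s. \<phi> (s, s + P) = pi" "\<And>s t. 0 < t - s \<Longrightarrow> t - s < P \<Longrightarrow> 0 < \<phi> (s, t) \<and> \<phi> (s, t) < pi
        \<and> polar_dir g (g t) s = of_real (cmod (polar_dir g (g t) s)) * cis (\<phi> (s, t))" using lifted_angle by metis
  have e: "ang x s = \<phi> (x, x + s)" if "0 \<le> s" "s \<le> P" for x s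
  proof -
    consider "s = 0" | "s = P" | "0 < s" "s < P" using \<open>0 \<le> s\<close> \<open>s \<le> P\<close> by linarith
    then show ?thesis
    proof cases
      case 3
      have f1: "0 < \<phi> (x, x + s)" "\<phi> (x, x + s) < pi" "dir x (x + s) = of_real (cmod (dir x (x + s))) * cis (\<phi> (x, x + s))"
        using f(4)[of "x + s" x] 3 by auto
      have p: "cmod (dir x (x + s)) > 0" using dir_nz[OF g_neq'[OF 3]] by simp
      have "Arg (dir x (x + s)) = Arg (cis (\<phi> (x, x + s)))"
        by (subst f1(3)) (rule Arg_times_of_real[OF p])
      then show ?thesis using f1 by (simp add: ang_eq[OF 3] chord_angle_eq Arg_cis)
    qed (use f ang_ends in auto)
  qed
  have "continuous_on (UNIV \<times> {0..P}) (\<lambda>p. \<phi> (fst p, fst p + snd p))"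
    by (intro continuous_on_compose2[OF f(1)] continuous_intros) (auto simp: strip_def)
  then show ?thesis by (rule continuous_on_eq) (auto simp: e)
qed

lemma ang_cont1: "continuous_on {0..P} (ang x)"
proof -
  have "continuous_on {0..P} (\<lambda>s. ang (fst (x, s)) (snd (x, s)))"
    by (rule continuous_on_compose2[OF ang_cont]) (auto intro!: continuous_intros)
  then show ?thesis by simp
qed

text \<open>The speed \<open>sin \<psi> / sinh r\<close> at which the far end of the chord turns
  around the base point, where \<psi> is the angle of the chord at the far end.\<close>

definition ang_d :: "real \<Rightarrow> real \<Rightarrow> real" where
  "ang_d x s = Im (dir (x + s) x) / (cmod (dir (x + s) x))^2"

lemma Im_minus_inverse: "Im (- 1 / z) = Im z / (cmod z)^2"
  by (simp add: Im_divide cmod_power2)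

lemma chord_angle_deriv2:
  assumes "g y \<noteq> g x"
  shows "((\<lambda>t. chord_angle g x t) has_real_derivative Im (dir y x) / (cmod (dir y x))^2) (at y)"
proof -
  have e: "chord_angle g x t = Arg (mob (g x) (g t) * cnj (u x))" for t
  proof -
    obtain c where c: "c > 0" "polar_dir g (g t) x = of_real c * (mob (g x) (g t) * cnj (u x))"
      using polar_dir_mob_pos[OF in_disc] by blast
    then show ?thesis by (simp add: chord_angle_eq Arg_times_of_real)
  qed
  obtain c where c: "c > 0" "dir x y = of_real c * (mob (g x) (g y) * cnj (u x))"
    using polar_dir_mob_pos[OF in_disc] by blast
  then have "Im (mob (g x) (g y) * cnj (u x)) > 0" using dir_pos[OF assms] by (simp add: zero_less_mult_iff)
  from has_real_derivative_Arg[OF mob_mult_deriv[OF in_disc assms[symmetric]] this]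
  have d: "((\<lambda>t. chord_angle g x t) has_real_derivative Im (- (mob (g x) (g y) * cnj (u x)) / dir y x / (mob (g x) (g y) * cnj (u x)))) (at y)"
    by (simp add: e[abs_def])
  have "mob (g x) (g y) * cnj (u x) \<noteq> 0" using \<open>Im _ > 0\<close> by fastforce
  then have "- (mob (g x) (g y) * cnj (u x)) / dir y x / (mob (g x) (g y) * cnj (u x)) = - 1 / dir y x" by simp
  with d show ?thesis by (simp only: Im_minus_inverse)
qed

text \<open>Dividing \<open>polar_dir_deriv\<close> by \<open>polar_dir\<close> shows two
  contributions: the far point seems to turn at the rate \<open>coth r * sin a\<close>, and the
  frame itself turns at the rate \<kappa>.\<close>

lemma chord_angle_deriv1:
  assumes "g y \<noteq> g x"
  shows "((\<lambda>t. chord_angle g t y) has_real_derivative cosh_dist (g x) (g y) * Im (dir x y) / (cmod (dir x y))^2 - \<kappa> x) (at x)"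
proof -
  have "((\<lambda>t. Arg (dir t y)) has_real_derivative Im ((- of_real (cosh_dist (g y) (g x)) - \<i> * \<kappa> x * dir x y) / dir x y)) (at x)"
    by (rule has_real_derivative_Arg[OF polar_dir_deriv[OF in_disc] dir_pos[OF assms]])
  moreover have "(- of_real (cosh_dist (g y) (g x)) - \<i> * \<kappa> x * dir x y) / dir x y = of_real (cosh_dist (g y) (g x)) * (- 1 / dir x y) - \<i> * \<kappa> x"
    using dir_nz[OF assms] by (simp add: field_simps)
  moreover have "Im (of_real (cosh_dist (g y) (g x)) * (- 1 / dir x y) - \<i> * \<kappa> x) = cosh_dist (g x) (g y) * Im (dir x y) / (cmod (dir x y))^2 - \<kappa> x"
  proof -
    have "Im (of_real c * w - \<i> * of_real k) = c * Im w - k" for c k w by simp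
    then show ?thesis unfolding Im_minus_inverse cosh_dist_commute[of "g y"] by (metis Im_minus_inverse times_divide_eq_right)
  qed
  ultimately show ?thesis by (simp only: chord_angle_eq)
qed

lemma ang_deriv:
  assumes s: "0 < s" "s < P"
  shows "(ang x has_real_derivative ang_d x s) (at s)"
proof -
  have "((\<lambda>s. x + s) has_real_derivative 1) (at s)" by (auto intro!: derivative_eq_intros)
  from DERIV_chain2[where f="chord_angle g x", OF chord_angle_deriv2[OF g_neq'[OF s]] this]
  have d: "((\<lambda>s. chord_angle g x (x + s)) has_real_derivative ang_d x s) (at s)" by (simp add: ang_d_def)
  have ev: "eventually (\<lambda>s. s \<in> {0<..<P}) (nhds s)" using s by (intro eventually_nhds_in_open) auto
  show ?thesis
    by (rule iffD2[OF DERIV_cong_ev[OF refl _ refl] d]) (use ev in eventually_elim, auto simp: ang_eq)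
qed

lemma ang_d_pos: "0 < s \<Longrightarrow> s < P \<Longrightarrow> ang_d x s > 0"
  using dir_pos[of x "x + s"] dir_nz[of x "x + s"] g_neq'[of s x] by (auto simp: ang_d_def)

lemma ang_strict_mono: assumes "0 \<le> s" "s < t" "t \<le> P" shows "ang x s < ang x t"
proof (rule DERIV_pos_imp_increasing_open[OF assms(2)])
  show "\<exists>y. (ang x has_real_derivative y) (at r) \<and> 0 < y" if "s < r" "r < t" for r
    using ang_deriv[of r x] ang_d_pos[of r x] that assms by auto
  show "continuous_on {s..t} (ang x)" using assms by (intro continuous_on_subset[OF ang_cont1]) auto
qed

lemma ang_inj: "inj_on (ang x) {0<..<P}"
proof (rule linorder_inj_onI)
  fix a b assume "a < b" "a \<in> {0<..<P}" "b \<in> {0<..<P}"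
  then show "ang x a \<noteq> ang x b" using ang_strict_mono[of a b x] by auto
qed auto

text \<open>Together with \<open>ang_inj\<close> this matches the chords leaving a point with the
  inward directions, so that an angle can be traded for a far endpoint.\<close>

lemma ang_image: "ang x ` {0<..<P} = {0<..<pi}"
proof
  show "ang x ` {0<..<P} \<subseteq> {0<..<pi}" using ang_bounds by auto
  show "{0<..<pi} \<subseteq> ang x ` {0<..<P}"
  proof
    fix v assume v: "v \<in> {0<..<pi}"
    then obtain s where s: "0 \<le> s" "s \<le> P" "ang x s = v"
      using IVT'[of "ang x" 0 v P] ang_cont1[of x] P_pos ang_ends[of x] by auto
    then have "s \<noteq> 0" "s \<noteq> P" using v ang_ends[of x] by auto
    then show "v \<in> ang x ` {0<..<P}" using s by auto
  qed
qed

lemma dir_cont: "continuous_on UNIV (\<lambda>p. dir (fst p) (snd p))"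
  by (intro cont_polar_dir continuous_on_compose2[OF g_cont[of UNIV]] continuous_intros) (auto simp: in_disc)

lemma norm_dir_pos: "g y \<noteq> g x \<Longrightarrow> cmod (dir x y) > 0" using dir_nz by simp

lemma ang_d_cont: "continuous_on (UNIV \<times> {0<..<P}) (\<lambda>p. ang_d (fst p) (snd p))"
proof -
  have "continuous_on (UNIV \<times> {0<..<P}) (\<lambda>p. dir (fst p + snd p) (fst p))"
    by (intro continuous_on_compose2[OF dir_cont, of _ "\<lambda>p. (fst p + snd p, fst p)", simplified] continuous_intros)
  moreover have "cmod (dir (fst p + snd p) (fst p)) \<noteq> 0" if "p \<in> UNIV \<times> {0<..<P}" for p
    using that dir_nz[of "fst p" "fst p + snd p"] g_neq'[of "snd p" "fst p"] by auto
  ultimately show ?thesis unfolding ang_d_def by (intro continuous_intros) auto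
qed

lemma ang_reverse: "0 < s \<Longrightarrow> s < P \<Longrightarrow> chord_angle g (x + s) x = ang (x + s) (P - s)"
  by (simp add: ang_eq chord_angle_cong2[of x "x + P"] periodic)

text \<open>The integral on the right is the enclosed area in geodesic polar coordinates centred at \<open>g x\<close>,
  so this is the Gauss--Bonnet formula.\<close>

lemma gauss_bonnet_polar:
  "((\<lambda>s. \<kappa> (x + s)) has_integral (2 * pi + integral {0..P} (\<lambda>s. Im (dir (x + s) x) / (cosh_dist (g x) (g (x + s)) + 1)))) {0..P}"
proof -
  define C where "C s = cosh_dist (g x) (g (x + s))" for s
  have 1: "(ang_d x has_integral (ang x P - ang x 0)) {0..P}"
    by (rule fundamental_theorem_of_calculus_interior[OF _ ang_cont1])
      (use P_pos ang_deriv in \<open>auto simp: has_real_derivative_iff_has_vector_derivative\<close>)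
  \<comment> \<open>The supplement of the angle at the moving end back towards \<open>g x\<close>.
    Like \<open>ang x\<close> it grows from 0 to \<open>pi\<close>; the two increments make up the
    \<open>2 * pi\<close> of the formula.\<close>
  define \<psi> where "\<psi> s = pi - ang (x + s) (P - s)" for s
  have 2: "((\<lambda>s. \<kappa> (x + s) - C s * ang_d x s) has_integral (\<psi> P - \<psi> 0)) {0..P}"
  proof (rule fundamental_theorem_of_calculus_interior)
    show "continuous_on {0..P} \<psi>" unfolding \<psi>_def
      by (intro continuous_intros continuous_on_compose2[OF ang_cont, of _ "\<lambda>s. (x + s, P - s)", simplified]) auto
    fix s assume s: "s \<in> {0<..<P}"
    have d1: "((\<lambda>s. x + s) has_real_derivative 1) (at s)" by (auto intro!: derivative_eq_intros)
    have ne: "g x \<noteq> g (x + s)" using g_neq'[of s x] s by auto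
    have d: "((\<lambda>s. pi - chord_angle g (x + s) x) has_real_derivative (\<kappa> (x + s) - C s * ang_d x s)) (at s)"
      using DERIV_chain2[where f="\<lambda>t. chord_angle g t x", OF chord_angle_deriv1[OF ne] d1]
      by (auto intro!: derivative_eq_intros simp: C_def ang_d_def cosh_dist_commute)
    have ev: "eventually (\<lambda>s. s \<in> {0<..<P}) (nhds s)" using s by (intro eventually_nhds_in_open) auto
    have "(\<psi> has_real_derivative (\<kappa> (x + s) - C s * ang_d x s)) (at s)"
      by (rule iffD2[OF DERIV_cong_ev[OF refl _ refl] d]) (use ev in eventually_elim, auto simp: ang_reverse \<psi>_def)
    then show "(\<psi> has_vector_derivative (\<kappa> (x + s) - C s * ang_d x s)) (at s)"
      by (simp add: has_real_derivative_iff_has_vector_derivative)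
  qed (use P_pos in simp)
  \<comment> \<open>This is \<open>(cosh r - 1) * ang_d x s\<close>, rewritten by
    \<open>sinh^2 r = (cosh r - 1) * (cosh r + 1)\<close> so that it stays continuous at both ends,
    where \<open>r = 0\<close>.\<close>
  define f where "f s = Im (dir (x + s) x) / (C s + 1)" for s
  have Cpos: "C s \<ge> 1" for s using cosh_dist_gt_1[OF in_disc in_disc, of x "x + s"]
    by (cases "g x = g (x + s)") (auto simp: C_def cosh_dist_def)
  have "continuous_on {0..P} f" unfolding f_def
  proof (intro continuous_intros)
    show "continuous_on {0..P} (\<lambda>s. dir (x + s) x)"
      by (intro continuous_on_compose2[OF dir_cont, of _ "\<lambda>s. (x + s, x)", simplified] continuous_intros)
    show "continuous_on {0..P} C" unfolding C_def
      by (intro cont_cosh_dist continuous_on_compose2[OF g_cont[of UNIV]] continuous_intros) (auto simp: in_disc)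
    show "\<forall>s\<in>{0..P}. C s + 1 \<noteq> 0" using Cpos by (smt (verit))
  qed
  then have 3: "(f has_integral integral {0..P} f) {0..P}"
    using integrable_continuous_real integrable_integral by blast
  have eq: "(\<kappa> (x + s) - C s * ang_d x s) + ang_d x s + f s = \<kappa> (x + s)" for s
  proof (cases "dir (x + s) x = 0")
    case False
    have n: "(cmod (dir (x + s) x))^2 = (C s - 1) * (C s + 1)"
      unfolding polar_dir_norm2[OF in_disc] C_def by (simp add: power2_eq_square algebra_simps)
    have "(C s - 1) * (C s + 1) \<noteq> 0" using False unfolding n[symmetric] by simp
    then have "C s - 1 \<noteq> 0" "C s + 1 \<noteq> 0" by auto
    then have "(C s - 1) * ang_d x s = f s" unfolding f_def ang_d_def n by simp
    then show ?thesis by (simp add: algebra_simps)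
  qed (simp add: f_def ang_d_def)
  have "((\<lambda>s. (\<kappa> (x + s) - C s * ang_d x s) + ang_d x s + f s) has_integral ((\<psi> P - \<psi> 0) + (ang x P - ang x 0) + integral {0..P} f)) {0..P}"
    by (intro has_integral_add 1 2 3)
  moreover have "(\<psi> P - \<psi> 0) + (ang x P - ang x 0) = 2 * pi" by (simp add: \<psi>_def ang_ends)
  ultimately show ?thesis unfolding eq by (simp add: f_def[abs_def] C_def)
qed

end

section \<open>The enclosed region\<close>

lemma mob_inv_in_disc:
  assumes a: "cmod a < 1" and w: "cmod w < 1"
  shows "1 - mob_inv a w * cnj (mob_inv a w) = (1 - a * cnj a) * (1 - w * cnj w) / ((1 + cnj a * w) * (1 + a * cnj w))"
    and "1 + cnj a * w \<noteq> 0" "1 + a * cnj w \<noteq> 0" "cmod (mob_inv a w) < 1"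
proof -
  show nz1: "1 + cnj a * w \<noteq> 0" using one_minus_cnj_nz[OF a, of "- w"] w by simp
  show nz2: "1 + a * cnj w \<noteq> 0" using one_minus_cnj_nz[of "cnj a" "- cnj w"] a w by simp
  have c: "cnj (mob_inv a w) = (cnj w + cnj a) / (1 + a * cnj w)" by (simp add: mob_inv_def)
  have "(w + a) / D * ((w' + a') / D') = (w + a) * (w' + a') / (D * D')" for w' a' D D' :: complex by simp
  then have "1 - mob_inv a w * cnj (mob_inv a w) = ((1 + cnj a * w) * (1 + a * cnj w) - (w + a) * (cnj w + cnj a)) / ((1 + cnj a * w) * (1 + a * cnj w))"
    unfolding c mob_inv_def using nz1 nz2 by (simp add: diff_divide_distrib)
  also have "(1 + cnj a * w) * (1 + a * cnj w) - (w + a) * (cnj w + cnj a) = (1 - a * cnj a) * (1 - w * cnj w)"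
    by (simp add: algebra_simps)
  finally show e: "1 - mob_inv a w * cnj (mob_inv a w) = (1 - a * cnj a) * (1 - w * cnj w) / ((1 + cnj a * w) * (1 + a * cnj w))" .
  define m where "m = (cmod (1 + cnj a * w))^2"
  have m: "m > 0" unfolding m_def using nz1 by simp
  have "complex_of_real (1 - (cmod (mob_inv a w))^2) = of_real ((1 - (cmod a)^2) * (1 - (cmod w)^2) / m)"
    unfolding m_def of_real_divide of_real_mult of_real_one_minus_cmod2 complex_norm_square e by simp
  then have "1 - (cmod (mob_inv a w))^2 = (1 - (cmod a)^2) * (1 - (cmod w)^2) / m" by (simp only: of_real_eq_iff)
  also have "\<dots> > 0" using a w m by (simp add: abs_square_less_1)
  finally show "cmod (mob_inv a w) < 1" by (simp add: abs_square_less_1)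
qed

lemma mob_mob_inv:
  assumes a: "cmod a < 1" and w: "cmod w < 1"
  shows "mob a (mob_inv a w) = w"
proof -
  note nz = mob_inv_in_disc(2)[OF a w] one_minus_cmod2_nz[OF a]
  have "mob_inv a w - a = w * (1 - a * cnj a) / (1 + cnj a * w)"
    unfolding mob_inv_def using nz(1) by (simp add: field_simps)
  moreover have "1 - cnj a * mob_inv a w = (1 - a * cnj a) / (1 + cnj a * w)"
    unfolding mob_inv_def using nz(1) by (simp add: field_simps)
  ultimately show ?thesis unfolding mob_def using nz by simp
qed

lemma mob_inv_mob:
  assumes a: "cmod a < 1" and b: "cmod b < 1"
  shows "mob_inv a (mob a b) = b"
proof -
  note nz = one_minus_cnj_nz[OF a b] one_minus_cmod2_nz[OF a]
  have "mob a b + a = b * (1 - a * cnj a) / (1 - cnj a * b)"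
    unfolding mob_def using nz(1) by (simp add: field_simps)
  moreover have "1 + cnj a * mob a b = (1 - a * cnj a) / (1 - cnj a * b)"
    unfolding mob_def using nz(1) by (simp add: field_simps)
  ultimately show ?thesis unfolding mob_inv_def using nz by simp
qed

context hyp_curve
begin

text \<open>The intersection of the open half planes to the left of all tangent geodesics.\<close>

definition interior_pts :: "complex set" where
  "interior_pts = {p. cmod p < 1 \<and> (\<forall>t. Im (polar_dir g p t) > 0)}"

text \<open>Along a geodesic \<open>polar_dir\<close> is, up to a positive factor, an affine combination: it is linear in the
  hyperboloid coordinates of its argument.\<close>

lemma polar_dir_mob_inv:
  assumes a: "cmod a < 1" and w: "cmod w < 1"
  obtains \<alpha> \<beta> where "\<And>r. 0 \<le> r \<Longrightarrow> r \<le> 1 \<Longrightarrow>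
    polar_dir g (mob_inv a (of_real r * w)) t = (of_real r * \<alpha> + (1 + of_real (r^2) * (w * cnj w)) * \<beta>) / (1 - of_real (r^2) * (w * cnj w))"
proof -
  define A where "A = 1 - g t * cnj a"
  define B where "B = a - g t"
  define E where "E = (1 - a * cnj a) * (1 - g t * cnj (g t))"
  define V where "V = cnj (u t)"
  have E: "E \<noteq> 0" unfolding E_def using one_minus_cmod2_nz[OF a] den_nz[of t] by simp
  show ?thesis
  proof (rule that[of "2 * (w * A^2 + cnj w * B^2) * V / E" "2 * A * B * V / E"])
    fix r :: real assume r: "0 \<le> r" "r \<le> 1"
    define v where "v = complex_of_real r * w"
    have v: "cmod v < 1" unfolding v_def using r w
      by (metis abs_of_nonneg mult_left_le_one_le norm_ge_zero norm_mult norm_of_real order_le_less_trans)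
    define N where "N = v + a"
    define D where "D = 1 + cnj a * v"
    define D' where "D' = 1 + a * cnj v"
    have cN: "cnj N = cnj v + cnj a" by (simp add: N_def)
    note m = mob_inv_in_disc[OF a v, folded D_def D'_def]
    have cD: "cnj D = D'" by (simp add: D_def D'_def)
    have p: "mob_inv a v = N / D" by (simp add: mob_inv_def N_def D_def)
    have cp: "cnj (mob_inv a v) = cnj N / D'" unfolding p by (simp add: cD)
    have vv: "v * cnj v = of_real (r^2) * (w * cnj w)" by (simp add: v_def power2_eq_square)
    have vnz: "1 - v * cnj v \<noteq> 0" using one_minus_cmod2_nz[OF v] .
    have "polar_dir g (mob_inv a v) t = 2 * (N / D - g t) * (1 - g t * (cnj N / D')) * V
        / ((1 - a * cnj a) * (1 - v * cnj v) / (D * D') * (1 - g t * cnj (g t)))"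
      unfolding polar_dir_def m(1) V_def unfolding cp unfolding p by (simp only:)
    also have "\<dots> = 2 * ((N - g t * D) * (D' - g t * cnj N)) * V / (E * (1 - v * cnj v))"
    proof -
      have "N / D - g t = (N - g t * D) / D" "1 - g t * (cnj N / D') = (D' - g t * cnj N) / D'"
        using m(2,3) by (simp_all add: diff_divide_distrib)
      then have "2 * (N / D - g t) * (1 - g t * (cnj N / D')) * V
        / ((1 - a * cnj a) * (1 - v * cnj v) / (D * D') * (1 - g t * cnj (g t)))
        = 2 * ((N - g t * D) / D) * ((D' - g t * cnj N) / D') * V
        / ((1 - a * cnj a) * (1 - v * cnj v) / (D * D') * (1 - g t * cnj (g t)))" by (simp only:)
      also have "\<dots> = 2 * ((N - g t * D) * (D' - g t * cnj N)) * V / (E * (1 - v * cnj v))"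
      proof -
        have "2 * (x / D) * (y / D') * V / (e * f / (D * D') * h) = 2 * (x * y) * V / ((e * h) * f)" for x y e f h
          using m(2,3) by (simp add: field_simps)
        then show ?thesis unfolding E_def .
      qed
      finally show ?thesis .
    qed
    also have "(N - g t * D) * (D' - g t * cnj N) = (v * A + B) * (cnj v * B + A)"
      unfolding N_def D_def D'_def A_def B_def by (simp add: algebra_simps)
    also have "(v * A + B) * (cnj v * B + A) = of_real r * (w * A^2 + cnj w * B^2) + (1 + v * cnj v) * (A * B)"
      by (simp add: v_def algebra_simps power2_eq_square)
    finally have "polar_dir g (mob_inv a v) t = 2 * (of_real r * (w * A^2 + cnj w * B^2) + (1 + v * cnj v) * (A * B)) * V / (E * (1 - v * cnj v))" .
    also have "\<dots> = (of_real r * (2 * (w * A^2 + cnj w * B^2) * V / E) + (1 + v * cnj v) * (2 * A * B * V / E)) / (1 - v * cnj v)"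
    proof -
      have "2 * (r' * x + y * z) * V / (E * f) = (r' * (2 * x * V / E) + y * (2 * z * V / E)) / f" for r' x y z f
        using E by (simp add: add_divide_distrib algebra_simps)
      then show ?thesis by (simp add: mult.assoc)
    qed
    finally show "polar_dir g (mob_inv a (of_real r * w)) t = (of_real r * (2 * (w * A^2 + cnj w * B^2) * V / E) + (1 + of_real (r^2) * (w * cnj w)) * (2 * A * B * V / E)) / (1 - of_real (r^2) * (w * cnj w))"
      unfolding vv unfolding v_def .
  qed
qed

lemma mob_scaled:
  assumes "0 < r" "r < 1"
  shows "cmod (of_real r * mob (g x) (g y)) < 1"
proof -
  have "cmod (mob (g x) (g y)) < 1" using polar_dir_mob(1)[OF in_disc] .
  then show ?thesis using assms mult_strict_mono[of r 1 "cmod (mob (g x) (g y))" 1] by (simp add: norm_mult)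
qed

text \<open>Up to a positive factor, the imaginary part of \<open>polar_dir\<close> at a point of
  the open chord is a combination of its values at the two ends with positive weights. These values
  are nonnegative by \<open>dir_pos\<close>, and they cannot both vanish because the ends are
  different points of the curve.\<close>

lemma chord_interior:
  assumes ne: "g x \<noteq> g y" and r: "0 < r" "r < 1"
  shows "geod_pt (g x) (g y) r \<in> interior_pts"
proof -
  define w where "w = mob (g x) (g y)"
  have w: "cmod w < 1" unfolding w_def using polar_dir_mob(1)[OF in_disc] .
  have "Im (polar_dir g (mob_inv (g x) (of_real r * w)) t) > 0" for t
  proof -
    obtain \<alpha> \<beta> where ab: "\<And>r. 0 \<le> r \<Longrightarrow> r \<le> 1 \<Longrightarrow>
      polar_dir g (mob_inv (g x) (of_real r * w)) t = (of_real r * \<alpha> + (1 + of_real (r^2) * (w * cnj w)) * \<beta>) / (1 - of_real (r^2) * (w * cnj w))"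
      using polar_dir_mob_inv[OF in_disc[of x] w] by blast
    define o2 where "o2 = (cmod w)^2"
    have o: "w * cnj w = of_real o2" by (simp only: o2_def complex_norm_square)
    have o2: "0 \<le> o2" "o2 < 1" using w by (auto simp: o2_def abs_square_less_1)
    have im: "Im (polar_dir g (mob_inv (g x) (of_real r * w)) t) = (r * Im \<alpha> + (1 + r^2 * o2) * Im \<beta>) / (1 - r^2 * o2)" if "0 \<le> r" "r \<le> 1" for r
    proof -
      have "polar_dir g (mob_inv (g x) (of_real r * w)) t = (of_real r * \<alpha> + of_real (1 + r^2 * o2) * \<beta>) / of_real (1 - r^2 * o2)"
        unfolding ab[OF that] o by simp
      then show ?thesis by (simp only: Im_divide_of_real plus_complex.sel Im_complex_of_real times_complex.sel Re_complex_of_real mult_zero_left add_0_right)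
    qed
    have b: "Im (polar_dir g (g x) t) = Im \<beta>" using im[of 0] by (simp add: mob_inv_def)
    have a: "Im (polar_dir g (g y) t) = (Im \<alpha> + (1 + o2) * Im \<beta>) / (1 - o2)"
      using im[of 1] mob_inv_mob[OF in_disc[of x] in_disc[of y]] by (simp add: w_def)
    have nn: "Im (polar_dir g (g z) t) \<ge> 0" "g z \<noteq> g t \<Longrightarrow> Im (polar_dir g (g z) t) > 0" for z
      using dir_pos[of z t] by (cases "g z = g t"; force simp: polar_dir_def)+
    define Q where "Q = (Im \<alpha> + (1 + o2) * Im \<beta>) / (1 - o2)"
    have \<alpha>: "Im \<alpha> = Q * (1 - o2) - (1 + o2) * Im \<beta>" using o2 by (simp add: Q_def)
    \<comment> \<open>Eliminating \<alpha> in favour of the end value \<open>Q\<close> exhibits the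
      weights of the two ends, both visibly positive for \<open>0 < r < 1\<close>.\<close>
    have num: "r * Im \<alpha> + (1 + r^2 * o2) * Im \<beta> = r * (1 - o2) * Q + ((1 - r) * (1 - r * o2)) * Im \<beta>"
      unfolding \<alpha> by (simp add: algebra_simps power2_eq_square)
    have ro: "r * o2 < 1" "r^2 * o2 < 1" using r o2
      by (smt (verit, best) mult_left_le_one_le power_le_one zero_le_power)+
    have c: "r * (1 - o2) > 0" "(1 - r) * (1 - r * o2) > 0" using r o2 ro by simp_all
    have q: "Q \<ge> 0" "Im \<beta> \<ge> 0" using nn(1)[of x] nn(1)[of y] unfolding a b Q_def by auto
    have "g x \<noteq> g t \<or> g y \<noteq> g t" using ne by metis
    then have "Q > 0 \<or> Im \<beta> > 0" using nn(2)[of x] nn(2)[of y] unfolding a b Q_def by blast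
    with q
    have "r * Im \<alpha> + (1 + r^2 * o2) * Im \<beta> > 0"
      unfolding num using c by (smt (verit) mult_nonneg_nonneg mult_pos_pos)
    then show ?thesis using im[of r] r ro by simp
  qed
  then show ?thesis unfolding interior_pts_def geod_pt_def w_def[symmetric]
    using mob_inv_in_disc(4)[OF in_disc[of x] mob_scaled[OF r]] by (auto simp: w_def)
qed

section \<open>The Jordan domain and its winding numbers\<close>

definition loop :: "real \<Rightarrow> complex" where "loop t = g (P * t)"

lemma loop_deriv: "(loop has_vector_derivative (of_real P * vderivs g 1 (P * t))) (at t)"
proof -
  have d: "((\<lambda>t. P * t) has_vector_derivative P) (at t)" by (auto intro!: derivative_eq_intros)
  have "((g \<circ> (\<lambda>t. P * t)) has_vector_derivative (P *\<^sub>R vderivs g 1 (P * t))) (at t)"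
    by (rule vector_diff_chain_at[OF d]) (use vderivs_deriv[of 0] in simp)
  then show ?thesis by (simp add: o_def loop_def[abs_def] scaleR_conv_of_real)
qed

lemma loop_valid: "valid_path loop"
proof -
  have "continuous_on {0..1} (\<lambda>t. of_real P * vderivs g 1 (P * t))"
    by (intro continuous_intros continuous_on_compose2[OF vderivs_cont[of UNIV 1]]) auto
  then have "loop C1_differentiable_on {0..1}"
    using loop_deriv unfolding C1_differentiable_on_def
    by (intro exI[of _ "\<lambda>t. of_real P * vderivs g 1 (P * t)"]) auto
  then show ?thesis unfolding valid_path_def by (rule C1_differentiable_imp_piecewise)
qed

lemma loop_simple: "simple_path loop" "pathfinish loop = pathstart loop"
proof -
  show "pathfinish loop = pathstart loop" using periodic[of 0] by (simp add: pathfinish_def pathstart_def loop_def)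
  have "x = y \<or> x = 0 \<and> y = 1 \<or> x = 1 \<and> y = 0" if "x \<in> {0..1}" "y \<in> {0..1}" "loop x = loop y" for x y
  proof (rule ccontr)
    assume n: "\<not> ?thesis"
    have aux: False if "x < y" "x \<in> {0..1}" "y \<in> {0..1}" "\<not> (x = 0 \<and> y = 1)" "loop x = loop y" for x y
    proof -
      have "P * y - P * x = P * (y - x)" by (simp add: algebra_simps)
      moreover have "0 < P * (y - x)" "P * (y - x) < P * 1" using that P_pos
        by (auto intro!: mult_strict_left_mono simp del: mult_1_right)
      ultimately show False using g_neq[of "P * y" "P * x"] that(5) by (simp add: loop_def)
    qed
    show False using n that aux[of x y] aux[of y x] by (cases x y rule: linorder_cases) auto
  qed
  then show "simple_path loop"
    using loop_valid by (auto simp: simple_path_def loop_free_def valid_path_imp_path)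
qed

lemma loop_image: "path_image loop = range g"
proof -
  have "g t \<in> path_image loop" for t
  proof -
    define r where "r = t - of_int \<lfloor>t / P\<rfloor> * P"
    have r: "0 \<le> r" "r < P"
      unfolding r_def using P_pos floor_divide_lower[OF P_pos, of t] floor_divide_upper[OF P_pos, of t] by (auto simp: algebra_simps)
    have "g t = g r" unfolding g_eq_iff r_def by (rule exI[of _ "\<lfloor>t / P\<rfloor>"]) simp
    then have "g t = loop (r / P)" using P_pos by (simp add: loop_def)
    then show ?thesis unfolding path_image_def using r P_pos by (intro image_eqI[of _ _ "r / P"]) auto
  qed
  then show ?thesis by (auto simp: path_image_def loop_def)
qed

lemma region_facts: "open (region g)" "connected (region g)" "bounded (region g)" "region g \<inter> range g = {}"
  using Jordan_inside_outside[OF loop_simple] inside_no_overlap[of "range g"] unfolding loop_image region_def by blast+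

text \<open>The complement of the closed disk through the farthest point of the curve is outside the
  curve. A radius below one keeps the density of the metric bounded on the region.\<close>

lemma region_in_ball: obtains \<rho> where "0 \<le> \<rho>" "\<rho> < 1" "region g \<subseteq> cball 0 \<rho>"
proof -
  obtain x0 where x0: "\<And>t. cmod (g t) \<le> cmod (g x0)" using max_norm_param by blast
  have "inside (range g) \<subseteq> cball 0 (cmod (g x0))"
    using outside_subset_convex[of "cball 0 (cmod (g x0))" "range g"] x0 inside_Un_outside[of "range g"]
      inside_no_overlap outside_inside by fastforce
  then show ?thesis using that[of "cmod (g x0)"] in_disc[of x0] by (simp add: region_def)
qed

lemma region_in_disc: "p \<in> region g \<Longrightarrow> cmod p < 1"
  using region_in_ball by (metis dist_0_norm dual_order.strict_trans2 in_mono mem_cball order_le_less_trans)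

lemma polar_dir_cont: "cmod p < 1 \<Longrightarrow> continuous_on S (polar_dir g p)"
  by (intro cont_polar_dir[of S "\<lambda>_. p" "\<lambda>x. x"] continuous_intros) auto

text \<open>The integrand is the logarithmic derivative of \<open>mob p (g t)\<close>. It differs
  from that of \<open>g t - p\<close> by the derivative of \<open>- Ln (1 - cnj p * g t)\<close>, a
  periodic function, whose integral over a period is zero.\<close>

lemma winding_integral:
  assumes p: "cmod p < 1" "p \<notin> range g"
  shows "((\<lambda>t. - 1 / polar_dir g p t) has_integral (2 * pi * \<i> * winding_number loop p)) {0..P}"
proof -
  have nz: "g t - p \<noteq> 0" for t using p(2) by auto
  define f where "f t = vderivs g 1 t / (g t - p)" for t
  have fc: "continuous_on {0..P} f" unfolding f_def
    using nz by (intro continuous_intros vderivs_cont g_cont) auto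
  then have fi: "(f has_integral integral {0..P} f) {0..P}" using integrable_continuous_real integrable_integral by blast
  have "((\<lambda>x. f (P *\<^sub>R x + 0)) has_integral (integral {0..P} f /\<^sub>R P ^ DIM(real))) (cbox ((0 - 0) /\<^sub>R P) ((P - 0) /\<^sub>R P))"
    by (rule has_integral_affinity') (use fi P_pos in auto)
  then have "((\<lambda>x. f (P * x)) has_integral (integral {0..P} f / P)) {0..1}"
    using P_pos by (simp add: scaleR_conv_of_real divide_inverse mult.commute)
  from has_integral_mult_right[OF this, of "of_real P"]
  have 1: "((\<lambda>x. of_real P * f (P * x)) has_integral integral {0..P} f) {0..1}" using P_pos by simp
  have "((\<lambda>w. 1 / (w - p)) has_contour_integral integral {0..P} f) loop"
    unfolding has_contour_integral
  proof (rule has_integral_eq[OF _ 1])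
    fix x :: real
    show "of_real P * f (P * x) = 1 / (loop x - p) * vector_derivative loop (at x)"
      using vector_derivative_at[OF loop_deriv[of x]] by (simp add: f_def loop_def)
  qed
  then have w: "2 * pi * \<i> * winding_number loop p = integral {0..P} f"
    using winding_number_valid_path[OF loop_valid, of p] p(2) contour_integral_unique loop_image by auto
  define h where "h t = - Ln (1 - cnj p * g t)" for t
  have re: "1 - cnj p * g t \<notin> \<real>\<^sub>\<le>\<^sub>0" for t
  proof -
    have "cmod (cnj p * g t) < 1" using p(1) in_disc[of t]
      by (metis complex_mod_cnj mult_strict_mono' mult_1 norm_ge_zero norm_mult)
    then show ?thesis using complex_Re_le_cmod[of "cnj p * g t"] by (simp add: complex_nonpos_Reals_iff)
  qed
  have "((\<lambda>t. cnj p * vderivs g 1 t / (1 - cnj p * g t)) has_integral (h P - h 0)) {0..P}"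
  proof (rule fundamental_theorem_of_calculus)
    fix t
    have d: "((\<lambda>t. 1 - cnj p * g t) has_vector_derivative (- (cnj p * vderivs g 1 t))) (at t)"
      using vderivs_deriv[of 0 t] by (auto intro!: derivative_eq_intros)
    have "((Ln \<circ> (\<lambda>t. 1 - cnj p * g t)) has_vector_derivative (- (cnj p * vderivs g 1 t) * inverse (1 - cnj p * g t))) (at t)"
      by (rule field_vector_diff_chain_at[OF d has_field_derivative_Ln[OF re]])
    from has_vector_derivative_minus[OF this]
    show "(h has_vector_derivative (cnj p * vderivs g 1 t / (1 - cnj p * g t))) (at t within {0..P})"
      unfolding h_def o_def by (auto simp: divide_inverse intro: has_vector_derivative_at_within)
  qed (use P_pos in simp)
  moreover have "h P - h 0 = 0" using periodic[of 0] by (simp add: h_def)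
  ultimately have 2: "((\<lambda>t. cnj p * vderivs g 1 t / (1 - cnj p * g t)) has_integral 0) {0..P}" by simp
  have eq: "f t + cnj p * vderivs g 1 t / (1 - cnj p * g t) = - 1 / polar_dir g p t" for t
  proof -
    have n1: "1 - cnj p * g t \<noteq> 0" using one_minus_cnj_nz[OF p(1) in_disc] .
    have n2: "p \<noteq> g t" using nz[of t] by auto
    have "((\<lambda>s. (g s - p) / (1 - cnj p * g s)) has_vector_derivative
       ((vderivs g 1 t * (1 - cnj p * g t) - (g t - p) * (- (cnj p * vderivs g 1 t))) / ((1 - cnj p * g t) * (1 - cnj p * g t)))) (at t)"
      using n1 vderivs_deriv[of 0 t] by (intro has_vector_derivative_quotient) (auto intro!: derivative_eq_intros)
    then have "- mob p (g t) / polar_dir g p t = (vderivs g 1 t * (1 - cnj p * g t) - (g t - p) * (- (cnj p * vderivs g 1 t))) / ((1 - cnj p * g t) * (1 - cnj p * g t))"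
      using mob_deriv[OF p(1) n2] vector_derivative_unique_at unfolding mob_def[abs_def] by blast
    then have e: "- mob p (g t) / polar_dir g p t / mob p (g t) = (vderivs g 1 t * (1 - cnj p * g t) - (g t - p) * (- (cnj p * vderivs g 1 t))) / ((1 - cnj p * g t) * (1 - cnj p * g t)) / mob p (g t)" by simp
    have m: "mob p (g t) = (g t - p) / (1 - cnj p * g t)" by (simp add: mob_def)
    have "(d * D - c * (- (q * d))) / (D * D) / (c / D) = d / c + q * d / D" if "D \<noteq> 0" "c \<noteq> 0" for d D c q :: complex
      using that by (simp add: field_simps)
    from this[OF n1 nz, of "vderivs g 1 t" t "cnj p"] e show ?thesis
      unfolding f_def m using nz[of t] n1 by simp
  qed
  have "((\<lambda>t. f t + cnj p * vderivs g 1 t / (1 - cnj p * g t)) has_integral (integral {0..P} f + 0)) {0..P}"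
    by (rule has_integral_add[OF fi 2])
  then show ?thesis unfolding eq w by simp
qed

lemma winding_integral_Im:
  assumes p: "cmod p < 1" "p \<notin> range g"
  shows "((\<lambda>t. Im (polar_dir g p t) / (cmod (polar_dir g p t))^2) has_integral (2 * pi * Re (winding_number loop p))) {0..P}"
  using has_integral_Im[OF winding_integral[OF p]] by (simp only: Im_minus_inverse) simp

text \<open>Seen from such a point the curve always turns forwards, so its winding number cannot
  vanish and the point is not outside.\<close>

lemma interior_pts_subset: "interior_pts \<subseteq> region g"
proof
  fix p assume "p \<in> interior_pts"
  then have p: "cmod p < 1" "\<And>t. Im (polar_dir g p t) > 0" by (auto simp: interior_pts_def)
  have nr: "p \<notin> range g"
  proof
    assume "p \<in> range g"
    then obtain t where "p = g t" by auto
    then have "Im (polar_dir g p t) = 0" by (simp add: polar_dir_def)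
    then show False using p(2)[of t] by simp
  qed
  have nz: "polar_dir g p t \<noteq> 0" for t using p(2)[of t] by force
  have pos: "Im (polar_dir g p t) / (cmod (polar_dir g p t))^2 > 0" for t using p(2)[of t] nz[of t] by simp
  have "winding_number loop p \<noteq> 0"
  proof
    assume 0: "winding_number loop p = 0"
    have "Im (polar_dir g p 0) / (cmod (polar_dir g p 0))^2 = 0"
    proof (rule has_integral_0_cbox_imp_0[where f="\<lambda>t. Im (polar_dir g p t) / (cmod (polar_dir g p t))^2" and a=0 and b=P])
      show "continuous_on (cbox 0 P) (\<lambda>t. Im (polar_dir g p t) / (cmod (polar_dir g p t))^2)"
        using nz by (intro continuous_intros polar_dir_cont p) auto
    qed (use winding_integral_Im[OF p(1) nr] 0 pos P_pos less_imp_le in auto)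
    then show False using pos[of 0] by (simp only: less_irrefl)
  qed
  then have "p \<notin> outside (range g)"
    using winding_number_zero_in_outside[of loop p] loop_valid loop_simple valid_path_imp_path loop_image by metis
  then show "p \<in> region g" unfolding region_def using nr inside_Un_outside[of "range g"] by blast
qed

text \<open>Connectedness of the region. \<open>interior_pts\<close> is relatively open because the
  parameter may be restricted to a compact period. It is relatively closed because a zero minimum of
  \<open>Im (polar_dir g p t)\<close> over \<open>t\<close> makes the derivative \<kappa>
  \<open>Re (polar_dir g p t)\<close> vanish up to sign, which puts \<open>p\<close> on the curve. A
  point of one chord shows that it is not empty.\<close>

lemma region_eq: "region g = interior_pts"
proof -
  define f where "f q = Im (polar_dir g (snd q) (fst q))" for q
  have fc: "continuous_on (UNIV \<times> region g) f" unfolding f_def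
    by (intro continuous_intros cont_polar_dir) (auto intro: region_in_disc)
  have per: "\<exists>s\<in>{0..P}. polar_dir g p t = polar_dir g p s" for p t
  proof (rule bexI[of _ "t - of_int \<lfloor>t / P\<rfloor> * P"])
    show "t - of_int \<lfloor>t / P\<rfloor> * P \<in> {0..P}"
      using P_pos floor_divide_lower[OF P_pos, of t] floor_divide_upper[OF P_pos, of t] by (auto simp: algebra_simps)
    show "polar_dir g p t = polar_dir g p (t - of_int \<lfloor>t / P\<rfloor> * P)"
      using polar_dir_shift[of p t "- \<lfloor>t / P\<rfloor>"] by simp
  qed
  have i1: "region g \<inter> interior_pts = region g - {p. \<exists>t. t \<in> {0..P} \<and> (t, p) \<in> ({0..P} \<times> region g \<inter> f -` {..0})}"
  proof -
    have "(\<forall>t. Im (polar_dir g p t) > 0) \<longleftrightarrow> (\<forall>t\<in>{0..P}. f (t, p) > 0)" for p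
      using per[of p] by (auto simp: f_def) metis
    then show ?thesis using region_in_disc by (auto simp: interior_pts_def) (meson atLeastAtMost_iff leD not_le_imp_less)+
  qed
  have "closedin (top_of_set ({0..P} \<times> region g)) ({0..P} \<times> region g \<inter> f -` {..0})"
    by (rule continuous_closedin_preimage[OF continuous_on_subset[OF fc]]) auto
  from closedin_compact_projection[OF _ this]
  have op: "openin (top_of_set (region g)) (region g \<inter> interior_pts)"
    unfolding i1 by (intro openin_diff openin_subtopology_self) auto
  have i2: "region g \<inter> interior_pts = (\<Inter>t. region g \<inter> (\<lambda>p. f (t, p)) -` {0..})"
  proof (intro equalityI subsetI)
    fix p assume p: "p \<in> (\<Inter>t. region g \<inter> (\<lambda>p. f (t, p)) -` {0..})"
    then have pr: "p \<in> region g" "\<And>t. Im (polar_dir g p t) \<ge> 0" by (auto simp: f_def)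
    have pd: "cmod p < 1" using region_in_disc pr by blast
    have "Im (polar_dir g p t) \<noteq> 0" for t
    proof
      assume 0: "Im (polar_dir g p t) = 0"
      have d: "((\<lambda>t. Im (polar_dir g p t)) has_real_derivative Im (- of_real (cosh_dist p (g t)) - \<i> * \<kappa> t * polar_dir g p t)) (at t)"
        using has_vector_derivative_Im[OF polar_dir_deriv[OF pd, of t]] by (simp add: has_real_derivative_iff_has_vector_derivative)
      have "Im (- of_real (cosh_dist p (g t)) - \<i> * \<kappa> t * polar_dir g p t) = 0"
        by (rule DERIV_local_min[OF d, of 1]) (use 0 pr in auto)
      then have "\<kappa> t * Re (polar_dir g p t) = 0" by simp
      then have "Re (polar_dir g p t) = 0" using curv_gt_1[of t] by simp
      then have "polar_dir g p t = 0" using 0 by (simp add: complex_eq_iff)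
      then have "p = g t" using polar_dir_eq_0_iff[OF pd] by simp
      then show False using pr(1) region_facts(4) by auto
    qed
    then show "p \<in> region g \<inter> interior_pts" using pr pd by (auto simp: interior_pts_def less_le)
  qed (auto simp: f_def interior_pts_def less_imp_le)
  have cl: "closedin (top_of_set (region g)) (region g \<inter> interior_pts)"
    unfolding i2
  proof (rule closedin_INT)
    fix t show "closedin (top_of_set (region g)) (region g \<inter> (\<lambda>p. f (t, p)) -` {0..})"
      by (intro continuous_closedin_preimage continuous_on_compose2[OF fc] continuous_intros) auto
  qed auto
  have ne: "g 0 \<noteq> g (P/2)" using g_neq[of "P/2" 0] P_pos by auto
  have "geod_pt (g 0) (g (P/2)) (1/2) \<in> interior_pts" using chord_interior[OF ne, of "1/2"] by simp
  then have "region g \<inter> interior_pts \<noteq> {}" using interior_pts_subset by blast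
  then have "region g \<inter> interior_pts = region g"
    using region_facts(2) op cl unfolding connected_clopen by blast
  then show ?thesis using interior_pts_subset by blast
qed

text \<open>The integral is the total visual angle of the curve seen from \<open>p\<close>. A simple
  loop has winding number 1 or -1 at its inner points, and either value gives the bound.\<close>

lemma winding_bound:
  assumes p: "p \<in> region g"
  obtains I where "((\<lambda>t. Im (polar_dir g p t) / (cmod (polar_dir g p t))^2) has_integral I) {0..P}" "I \<le> 2 * pi"
proof -
  have "winding_number loop p \<in> {-1, 1}"
    by (rule simple_closed_path_winding_number_inside[OF loop_simple(1)]) (use loop_simple p loop_image in \<open>auto simp: region_def\<close>)
  then have "2 * pi * Re (winding_number loop p) \<le> 2 * pi" by auto
  then show ?thesis using that winding_integral_Im[OF region_in_disc[OF p]] p region_facts(4) by blast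
qed

end

section \<open>Change of variables in the plane\<close>

lemma continuous_on_vimage_borel:
  assumes "continuous_on S f" "S \<in> sets borel" "B \<in> sets borel"
  shows "S \<inter> f -` B \<in> sets borel"
proof -
  have "f -` B \<inter> space (restrict_space borel S) \<in> sets (restrict_space borel S)"
    by (rule measurable_sets[OF borel_measurable_continuous_on_restrict[OF assms(1)] assms(3)])
  then show ?thesis using assms(2) by (simp add: sets_restrict_space_iff space_restrict_space Int_commute)
qed

text \<open>\<open>key\<close> says that the density \<open>J\<close> on \<open>S\<close> is pushed
  forward by \<open>f\<close> to Lebesgue measure on the image. Integrals of every nonnegative
  \<open>F\<close> against these two equal measures agree.\<close>

lemma nn_integral_change_of_variables_aux:
  fixes f :: "'a::euclidean_space \<Rightarrow> 'b::euclidean_space" and J :: "'a \<Rightarrow> ennreal"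
  assumes S: "S \<in> sets borel" and f: "continuous_on S f"
    and J: "(\<lambda>x. indicator S x * J x) \<in> borel_measurable borel"
    and T: "f ` S \<in> sets borel"
    and key: "\<And>B. B \<in> sets borel \<Longrightarrow> B \<subseteq> f ` S \<Longrightarrow> emeasure lborel B = (\<integral>\<^sup>+x. J x * indicator (S \<inter> f -` B) x \<partial>lborel)"
    and F: "F \<in> borel_measurable borel"
  shows "(\<integral>\<^sup>+y. F y * indicator (f ` S) y \<partial>lborel) = (\<integral>\<^sup>+x. F (f x) * J x * indicator S x \<partial>lborel)"
proof -
  \<comment> \<open>\<open>f\<close> is controlled on \<open>S\<close> only; its extension by 0 is
    Borel measurable on the whole space.\<close>
  define f0 where "f0 x = indicator S x *\<^sub>R f x" for x
  have f0: "f0 \<in> borel_measurable borel"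
    unfolding f0_def[abs_def] by (rule borel_measurable_continuous_on_indicator[OF S f])
  define D where "D = density lborel (\<lambda>x. indicator S x * J x)"
  have f0D: "f0 \<in> measurable D borel" unfolding D_def using f0 by simp
  have eq: "distr D borel f0 = density lborel (indicator (f ` S))"
  proof (rule measure_eqI)
    show "sets (distr D borel f0) = sets (density lborel (indicator (f ` S)))" by simp
    fix B assume "B \<in> sets (distr D borel f0)"
    then have B: "B \<in> sets borel" by simp
    have "emeasure (distr D borel f0) B = emeasure D (f0 -` B)"
      using emeasure_distr[OF f0D B] by (simp add: D_def)
    also have "\<dots> = (\<integral>\<^sup>+x. (indicator S x * J x) * indicator (f0 -` B) x \<partial>lborel)"
      unfolding D_def using J measurable_sets[OF f0 B] by (intro emeasure_density) auto
    also have "\<dots> = (\<integral>\<^sup>+x. J x * indicator (S \<inter> f -` (B \<inter> f ` S)) x \<partial>lborel)"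
      by (intro nn_integral_cong) (auto simp: indicator_def f0_def)
    also have "\<dots> = emeasure lborel (B \<inter> f ` S)"
      using B T by (intro key[symmetric]) auto
    also have "\<dots> = emeasure (density lborel (indicator (f ` S))) B"
      using B T by (subst emeasure_density) (auto simp: indicator_inter_arith[symmetric] Int_commute)
    finally show "emeasure (distr D borel f0) B = emeasure (density lborel (indicator (f ` S))) B" .
  qed
  have "(\<integral>\<^sup>+y. F y * indicator (f ` S) y \<partial>lborel) = (\<integral>\<^sup>+y. F y \<partial>density lborel (indicator (f ` S)))"
    using T F by (subst nn_integral_density) (auto simp: mult.commute)
  also have "\<dots> = (\<integral>\<^sup>+x. F (f0 x) \<partial>D)" unfolding eq[symmetric]
    by (rule nn_integral_distr[OF f0D]) (use F in simp)
  also have "\<dots> = (\<integral>\<^sup>+x. (indicator S x * J x) * F (f0 x) \<partial>lborel)"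
    unfolding D_def using F J f0 by (subst nn_integral_density) auto
  also have "\<dots> = (\<integral>\<^sup>+x. F (f x) * J x * indicator S x \<partial>lborel)"
    by (intro nn_integral_cong) (auto simp: indicator_def f0_def mult.commute)
  finally show ?thesis .
qed

lemma nn_integral_change_of_variables_real:
  fixes f f' :: "real \<Rightarrow> real"
  assumes S: "S \<in> sets borel" and T: "f ` S \<in> sets borel" "bounded (f ` S)"
    and d: "\<And>x. x \<in> S \<Longrightarrow> (f has_real_derivative f' x) (at x)"
    and inj: "inj_on f S" and c: "continuous_on S f'"
    and F: "F \<in> borel_measurable borel"
  shows "(\<integral>\<^sup>+y. F y * indicator (f ` S) y \<partial>lborel) = (\<integral>\<^sup>+x. F (f x) * ennreal \<bar>f' x\<bar> * indicator S x \<partial>lborel)"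
proof (rule nn_integral_change_of_variables_aux[OF S _ _ T(1) _ F])
  show cf: "continuous_on S f" using d by (meson DERIV_isCont continuous_at_imp_continuous_on)
  have "(\<lambda>x. indicator S x *\<^sub>R \<bar>f' x\<bar>) \<in> borel_measurable borel"
    by (rule borel_measurable_continuous_on_indicator[OF S]) (intro continuous_intros c)
  then have "(\<lambda>x. ennreal (indicator S x *\<^sub>R \<bar>f' x\<bar>)) \<in> borel_measurable borel" by simp
  moreover have "(\<lambda>x. indicator S x * ennreal \<bar>f' x\<bar>) = (\<lambda>x. ennreal (indicator S x *\<^sub>R \<bar>f' x\<bar>))"
    by (auto simp: indicator_def fun_eq_iff)
  ultimately show "(\<lambda>x. indicator S x * ennreal \<bar>f' x\<bar>) \<in> borel_measurable borel" by (simp only:)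
  fix B assume B: "B \<in> sets borel" "B \<subseteq> f ` S"
  define S' where "S' = S \<inter> f -` B"
  have SB: "S' \<in> sets borel" unfolding S'_def by (rule continuous_on_vimage_borel[OF cf S B(1)])
  have img: "f ` S' = B" using B by (auto simp: S'_def)
  have Bm: "B \<in> lmeasurable" using B T by (intro bounded_set_imp_lmeasurable) (auto intro: bounded_subset)
  then have "(\<lambda>x. 1::real) absolutely_integrable_on B \<and> integral B (\<lambda>x. 1) = measure lebesgue B"
    by (simp add: absolutely_integrable_on_const lmeasure_integral)
  then have "(\<lambda>x. \<bar>f' x\<bar> * 1) absolutely_integrable_on S' \<and> integral S' (\<lambda>x. \<bar>f' x\<bar> * 1) = measure lebesgue B"
    using has_absolute_integral_change_of_variables_1'[of S' f f' "\<lambda>_. 1" "measure lebesgue B"] SB d inj img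
    by (auto simp: S'_def inj_on_Int intro: has_field_derivative_at_within)
  then have "((\<lambda>x. \<bar>f' x\<bar>) has_integral measure lebesgue B) S'"
    by (simp add: has_integral_iff set_lebesgue_integral_eq_integral(1))
  then have "(\<integral>\<^sup>+x. ennreal \<bar>f' x\<bar> * indicator S' x \<partial>lborel) = ennreal (measure lebesgue B)"
    by (intro nn_integral_has_integral_lebesgue') auto
  also have "\<dots> = emeasure lebesgue B" using Bm by (simp add: emeasure_eq_measure2)
  also have "\<dots> = emeasure lborel B" using B by simp
  finally show "emeasure lborel B = (\<integral>\<^sup>+x. ennreal \<bar>f' x\<bar> * indicator (S \<inter> f -` B) x \<partial>lborel)" by (simp add: S'_def)
qed

text \<open>Coordinates on \<open>real^2\<close>, where Jacobian determinants are formulated. They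
  preserve Lebesgue measure, which carries the area formula over to \<open>complex\<close> and to
  pairs of reals.\<close>

definition vec2_complex :: "real^2 \<Rightarrow> complex" where "vec2_complex x = Complex (x $ 1) (x $ 2)"
definition complex_vec2 :: "complex \<Rightarrow> real^2" where "complex_vec2 z = vector [Re z, Im z]"
definition vec2_pair :: "real^2 \<Rightarrow> real \<times> real" where "vec2_pair x = (x $ 1, x $ 2)"
definition pair_vec2 :: "real \<times> real \<Rightarrow> real^2" where "pair_vec2 p = vector [fst p, snd p]"

lemma vec2_inverses [simp]:
  "vec2_complex (complex_vec2 z) = z" "complex_vec2 (vec2_complex x) = x"
  "vec2_pair (pair_vec2 p) = p" "pair_vec2 (vec2_pair x) = x"
  by (simp_all add: vec2_complex_def complex_vec2_def vec2_pair_def pair_vec2_def vec_eq_iff forall_2)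

lemma vec2_linear:
  "bounded_linear vec2_complex" "bounded_linear complex_vec2" "bounded_linear vec2_pair" "bounded_linear pair_vec2"
  by (auto intro!: linear_conv_bounded_linear[THEN iffD1] linearI
      simp: vec2_complex_def complex_vec2_def vec2_pair_def pair_vec2_def vec_eq_iff forall_2 complex_eq_iff)

lemma vec2_measurable [measurable]:
  "vec2_complex \<in> borel_measurable borel" "complex_vec2 \<in> borel_measurable borel"
  "vec2_pair \<in> borel_measurable borel" "pair_vec2 \<in> borel_measurable borel"
  by (auto intro!: borel_measurable_continuous_onI linear_continuous_on vec2_linear)

lemma Basis_vec2: "(Basis :: (real^2) set) = {axis 1 1, axis 2 1}"
  by (auto simp: Basis_vec_def UNIV_2)

lemma emeasure_box_vec2:
  fixes l u :: "real^2"
  assumes "l $ 1 \<le> u $ 1" "l $ 2 \<le> u $ 2"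
  shows "emeasure lborel (box l u) = ennreal ((u $ 1 - l $ 1) * (u $ 2 - l $ 2))"
proof -
  have ne: "axis 1 1 \<noteq> (axis 2 1 :: real^2)" by (simp add: axis_eq_axis)
  have "emeasure lborel (box l u) = (\<Prod>b\<in>Basis. (u - l) \<bullet> b)"
    by (rule emeasure_lborel_box) (use assms in \<open>auto simp: Basis_vec2 inner_axis\<close>)
  then show ?thesis using ne by (simp add: Basis_vec2 inner_axis)
qed

lemma distr_vec2_complex: "distr lborel borel vec2_complex = lborel"
proof (rule lborel_eqI[symmetric])
  fix l u :: complex assume le: "\<And>b. b \<in> Basis \<Longrightarrow> l \<bullet> b \<le> u \<bullet> b"
  have le': "Re l \<le> Re u" "Im l \<le> Im u" using le[of 1] le[of \<i>] by (auto simp: Basis_complex_def)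
  have "vec2_complex -` box l u = box (complex_vec2 l) (complex_vec2 u)"
    by (auto simp: mem_box Basis_complex_def Basis_vec2 inner_axis vec2_complex_def complex_vec2_def)
  then have "emeasure (distr lborel borel vec2_complex) (box l u) = emeasure lborel (box (complex_vec2 l) (complex_vec2 u))"
    by (subst emeasure_distr) auto
  also have "\<dots> = ennreal ((Re u - Re l) * (Im u - Im l))"
    by (subst emeasure_box_vec2) (use le' in \<open>auto simp: complex_vec2_def\<close>)
  also have "\<dots> = (\<Prod>b\<in>Basis. (u - l) \<bullet> b)"
    by (simp add: Basis_complex_def)
  finally show "emeasure (distr lborel borel vec2_complex) (box l u) = (\<Prod>b\<in>Basis. (u - l) \<bullet> b)" .
qed simp

lemma distr_vec2_pair: "distr lborel borel vec2_pair = lborel"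
proof (rule lborel_eqI[symmetric])
  fix l u :: "real \<times> real" assume le: "\<And>b. b \<in> Basis \<Longrightarrow> l \<bullet> b \<le> u \<bullet> b"
  have le': "fst l \<le> fst u" "snd l \<le> snd u" using le[of "(1,0)"] le[of "(0,1)"] by (auto simp: Basis_prod_def inner_prod_def)
  have B: "(Basis :: (real \<times> real) set) = {(1,0), (0,1)}" by (auto simp: Basis_prod_def)
  have "vec2_pair -` box l u = box (pair_vec2 l) (pair_vec2 u)"
    by (auto simp: mem_box B Basis_vec2 inner_axis vec2_pair_def pair_vec2_def inner_prod_def)
  then have "emeasure (distr lborel borel vec2_pair) (box l u) = emeasure lborel (box (pair_vec2 l) (pair_vec2 u))"
    by (subst emeasure_distr) auto
  also have "\<dots> = ennreal ((fst u - fst l) * (snd u - snd l))"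
    by (subst emeasure_box_vec2) (use le' in \<open>auto simp: pair_vec2_def\<close>)
  also have "\<dots> = (\<Prod>b\<in>Basis. (u - l) \<bullet> b)"
    by (simp add: B inner_prod_def)
  finally show "emeasure (distr lborel borel vec2_pair) (box l u) = (\<Prod>b\<in>Basis. (u - l) \<bullet> b)" .
qed simp

text \<open>\<open>A\<close> and \<open>B\<close> are the partial derivatives, and
  \<open>Im (cnj (A p) * B p)\<close> is their determinant. Invariance of domain makes the image
  open and hence Borel.\<close>

lemma nn_integral_change_of_variables_complex:
  fixes \<Psi> :: "real \<times> real \<Rightarrow> complex" and A B :: "real \<times> real \<Rightarrow> complex"
  assumes S: "open S" and bd: "bounded (\<Psi> ` S)" and inj: "inj_on \<Psi> S"
    and d: "\<And>p. p \<in> S \<Longrightarrow> (\<Psi> has_derivative (\<lambda>h. fst h *\<^sub>R A p + snd h *\<^sub>R B p)) (at p)"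
    and cA: "continuous_on S A" and cB: "continuous_on S B"
    and F: "F \<in> borel_measurable borel"
  shows "\<Psi> ` S \<in> sets borel"
    "(\<integral>\<^sup>+z. F z * indicator (\<Psi> ` S) z \<partial>lborel) = (\<integral>\<^sup>+p. F (\<Psi> p) * ennreal \<bar>Im (cnj (A p) * B p)\<bar> * indicator S p \<partial>lborel)"
proof -
  have cf: "continuous_on S \<Psi>" using d by (meson has_derivative_continuous continuous_at_imp_continuous_on)
  have "open (\<Psi> ` S)" by (rule invariance_of_domain_gen[OF S cf inj]) simp
  then show T: "\<Psi> ` S \<in> sets borel" by simp
  show "(\<integral>\<^sup>+z. F z * indicator (\<Psi> ` S) z \<partial>lborel) = (\<integral>\<^sup>+p. F (\<Psi> p) * ennreal \<bar>Im (cnj (A p) * B p)\<bar> * indicator S p \<partial>lborel)"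
  proof (rule nn_integral_change_of_variables_aux[OF _ cf _ T _ F])
    show Sb: "S \<in> sets borel" using S by simp
    have Jm: "(\<lambda>p. indicator S p *\<^sub>R \<bar>Im (cnj (A p) * B p)\<bar>) \<in> borel_measurable borel"
      by (rule borel_measurable_continuous_on_indicator[OF Sb]) (intro continuous_intros cA cB)
    then have "(\<lambda>p. ennreal (indicator S p *\<^sub>R \<bar>Im (cnj (A p) * B p)\<bar>)) \<in> borel_measurable borel" by simp
    moreover have "(\<lambda>p. indicator S p * ennreal \<bar>Im (cnj (A p) * B p)\<bar>) = (\<lambda>p. ennreal (indicator S p *\<^sub>R \<bar>Im (cnj (A p) * B p)\<bar>))"
      by (auto simp: indicator_def fun_eq_iff)
    ultimately show "(\<lambda>p. indicator S p * ennreal \<bar>Im (cnj (A p) * B p)\<bar>) \<in> borel_measurable borel" by (simp only:)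
    fix E assume E: "E \<in> sets borel" "E \<subseteq> \<Psi> ` S"
    define S' where "S' = S \<inter> \<Psi> -` E"
    have S'b: "S' \<in> sets borel" unfolding S'_def by (rule continuous_on_vimage_borel[OF cf Sb E(1)])
    define V where "V = vec2_pair -` S'"
    have Vb: "V \<in> sets borel" using measurable_sets[OF vec2_measurable(3) S'b] by (simp add: V_def)
    define f where "f = complex_vec2 \<circ> \<Psi> \<circ> vec2_pair"
    define f' where "f' x h = complex_vec2 ((h $ 1) *\<^sub>R A (vec2_pair x) + (h $ 2) *\<^sub>R B (vec2_pair x))" for x h :: "real^2"
    have img: "f ` V = vec2_complex -` E"
    proof (intro equalityI subsetI)
      fix y assume "y \<in> vec2_complex -` E"
      then obtain p where p: "p \<in> S" "vec2_complex y = \<Psi> p" using E by auto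
      then have "y = f (pair_vec2 p)" by (simp add: f_def flip: p(2))
      moreover have "pair_vec2 p \<in> V" using p \<open>y \<in> _\<close> by (auto simp: V_def S'_def)
      ultimately show "y \<in> f ` V" by blast
    qed (auto simp: f_def V_def S'_def)
    have injf: "inj_on f V"
    proof (rule inj_onI)
      fix x y assume "x \<in> V" "y \<in> V" "f x = f y"
      then have "\<Psi> (vec2_pair x) = \<Psi> (vec2_pair y)" unfolding f_def o_def by (metis vec2_inverses(1))
      then have "vec2_pair x = vec2_pair y" using inj \<open>x \<in> V\<close> \<open>y \<in> V\<close> by (auto simp: V_def S'_def dest: inj_onD)
      then show "x = y" by (metis vec2_inverses(4))
    qed
    have df: "(f has_derivative f' x) (at x within V)" if "x \<in> V" for x
    proof -
      have 1: "(vec2_pair has_derivative vec2_pair) (at x)" by (rule bounded_linear_imp_has_derivative[OF vec2_linear(3)])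
      have "vec2_pair x \<in> S" using that by (auto simp: V_def S'_def)
      from has_derivative_compose[OF 1 d[OF this]]
      have "((\<lambda>x. complex_vec2 (\<Psi> (vec2_pair x))) has_derivative (\<lambda>h. complex_vec2 (fst (vec2_pair h) *\<^sub>R A (vec2_pair x) + snd (vec2_pair h) *\<^sub>R B (vec2_pair x)))) (at x)"
        by (rule bounded_linear.has_derivative[OF vec2_linear(2)])
      then show ?thesis unfolding f_def o_def f'_def[abs_def] by (simp add: vec2_pair_def has_derivative_at_withinI)
    qed
    have det: "det (matrix (f' x)) = Im (cnj (A (vec2_pair x)) * B (vec2_pair x))" for x
      by (simp add: det_2 matrix_def f'_def complex_vec2_def axis_def)
    have bE: "bounded (vec2_complex -` E)"
    proof -
      have "vec2_complex -` E = complex_vec2 ` E" by (auto intro: image_eqI[of _ _ "vec2_complex _"])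
      then show ?thesis using bounded_linear_image[OF bounded_subset[OF bd E(2)] vec2_linear(2)] by simp
    qed
    have Em: "vec2_complex -` E \<in> sets borel" using measurable_sets[OF vec2_measurable(1) E(1)] by simp
    have Elm: "vec2_complex -` E \<in> lmeasurable" using bE Em by (intro bounded_set_imp_lmeasurable) auto
    have "((\<lambda>x. \<bar>det (matrix (f' x))\<bar>) has_integral measure lebesgue (vec2_complex -` E)) V"
      using has_measure_differentiable_image[OF _ df injf, of "measure lebesgue (vec2_complex -` E)"] Vb Elm img by simp
    then have "(\<integral>\<^sup>+x. ennreal \<bar>det (matrix (f' x))\<bar> * indicator V x \<partial>lborel) = ennreal (measure lebesgue (vec2_complex -` E))"
      by (intro nn_integral_has_integral_lebesgue') auto
    also have "\<dots> = emeasure lebesgue (vec2_complex -` E)" using Elm by (simp add: emeasure_eq_measure2)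
    also have "\<dots> = emeasure lborel (vec2_complex -` E)" using Em by simp
    also have "\<dots> = emeasure (distr lborel borel vec2_complex) E"
      using E by (subst emeasure_distr) auto
    also have "\<dots> = emeasure lborel E" by (simp add: distr_vec2_complex)
    finally have 1: "(\<integral>\<^sup>+x. ennreal \<bar>det (matrix (f' x))\<bar> * indicator V x \<partial>lborel) = emeasure lborel E" .
    have "(\<integral>\<^sup>+p. ennreal \<bar>Im (cnj (A p) * B p)\<bar> * indicator S' p \<partial>lborel) = (\<integral>\<^sup>+p. ennreal (indicator S p *\<^sub>R \<bar>Im (cnj (A p) * B p)\<bar>) * indicator S' p \<partial>distr lborel borel vec2_pair)"
      unfolding distr_vec2_pair by (intro nn_integral_cong) (auto simp: indicator_def S'_def)
    also have "\<dots> = (\<integral>\<^sup>+x. ennreal (indicator S (vec2_pair x) *\<^sub>R \<bar>Im (cnj (A (vec2_pair x)) * B (vec2_pair x))\<bar>) * indicator S' (vec2_pair x) \<partial>lborel)"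
      using Jm S'b by (intro nn_integral_distr) auto
    also have "\<dots> = (\<integral>\<^sup>+x. ennreal \<bar>det (matrix (f' x))\<bar> * indicator V x \<partial>lborel)"
      unfolding det by (intro nn_integral_cong) (auto simp: indicator_def V_def S'_def)
    finally show "emeasure lborel E = (\<integral>\<^sup>+p. ennreal \<bar>Im (cnj (A p) * B p)\<bar> * indicator (S \<inter> \<Psi> -` E) p \<partial>lborel)"
      using 1 by (simp add: S'_def)
  qed
qed

section \<open>Area and Santalo's formula in polar coordinates\<close>

abbreviation hyp_dens :: "complex \<Rightarrow> real" where "hyp_dens z \<equiv> 4 / (1 - (cmod z)^2)^2"

lemma tanh_artanh:
  fixes w :: real
  assumes "\<bar>w\<bar> < 1"
  shows "tanh (artanh w) = w"
proof -
  define q where "q = (1 + w) / (1 - w)"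
  have w: "1 + w > 0" "1 - w > 0" using assms by auto
  then have q: "q > 0" by (simp add: q_def)
  have "exp (- 2 * artanh w) = inverse q"
    using q by (simp add: artanh_def exp_minus q_def[symmetric])
  then have e: "exp (- 2 * artanh w) = (1 - w) / (1 + w)" by (simp add: q_def)
  show ?thesis unfolding tanh_real_altdef e using w by (simp add: field_simps)
qed

text \<open>A point of modulus \<open>w\<close> has hyperbolic distance \<open>2 * artanh w\<close>
  from the origin, and the argument of \<open>arcosh\<close> is the \<open>cosh\<close> of that
  distance.\<close>

lemma cosh_2_artanh:
  fixes w :: real
  assumes "0 \<le> w" "w < 1"
  shows "arcosh ((1 + w^2) / (1 - w^2)) = 2 * artanh w"
proof -
  have nn: "artanh w \<ge> 0" using assms by (auto simp: artanh_def intro!: ln_ge_zero)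
  have t: "tanh (artanh w) = w" using assms by (intro tanh_artanh) auto
  have "cosh (2 * artanh w) = (1 + w^2) / (1 - w^2)"
  proof -
    let ?c = "cosh (artanh w)" and ?s = "sinh (artanh w)"
    have cp: "?c > 0" by (rule cosh_real_pos)
    have s: "?s = w * ?c" using t cp by (simp add: tanh_def field_simps)
    have "?c^2 - ?s^2 = 1" using hyperbolic_pythagoras[of "artanh w"] by simp
    then have c2: "?c^2 * (1 - w^2) = 1" unfolding s by (simp add: algebra_simps power_mult_distrib)
    have "w^2 < 1" using assms by (simp add: abs_square_less_1)
    then have c3: "?c^2 = 1 / (1 - w^2)" using c2 by (simp add: field_simps)
    have "cosh (2 * artanh w) = ?c^2 + ?s^2" by (rule cosh_double)
    also have "\<dots> = (1 + w^2) * ?c^2" unfolding s by (simp add: algebra_simps power_mult_distrib)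
    finally show ?thesis unfolding c3 by simp
  qed
  then show ?thesis using arcosh_cosh_real[of "2 * artanh w"] nn by simp
qed

lemma nn_integral_FTC_interior:
  fixes f F :: "real \<Rightarrow> real"
  assumes "a \<le> b" "continuous_on {a..b} F" "\<And>x. x \<in> {a<..<b} \<Longrightarrow> (F has_real_derivative f x) (at x)"
    and nn: "\<And>x. x \<in> {a<..<b} \<Longrightarrow> 0 \<le> f x"
  shows "(\<integral>\<^sup>+x. ennreal (f x) * indicator {a<..<b} x \<partial>lborel) = ennreal (F b - F a)"
proof (rule nn_integral_has_integral_lebesgue')
  have "(f has_integral F b - F a) {a..b}"
    by (rule fundamental_theorem_of_calculus_interior[OF assms(1,2)])
      (use assms(3) in \<open>auto simp: has_real_derivative_iff_has_vector_derivative\<close>)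
  then show "(f has_integral F b - F a) {a<..<b}"
    by (simp add: has_integral_Icc_iff_Ioo)
qed (use nn in auto)

context hyp_curve
begin

definition chord_len :: "real \<Rightarrow> real \<Rightarrow> real" where "chord_len x s = hdist (g x) (g (x + s))"

lemma hdist_eq: "hdist p q = arcosh (cosh_dist p q)" by (simp add: hdist_def cosh_dist_def)

text \<open>Polar coordinates at \<open>g x\<close>. The direction is recorded by the far end
  \<open>g (x + s)\<close>; the radial coordinate is the fraction of the straight segment in the
  disk chart centred at \<open>g x\<close>, not a hyperbolic length.\<close>

definition polar_map :: "real \<Rightarrow> real \<times> real \<Rightarrow> complex" where
  "polar_map x p = geod_pt (g x) (g (x + fst p)) (snd p)"

definition polar_dom :: "(real \<times> real) set" where "polar_dom = {0<..<P} \<times> {0<..<1}"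

definition chord_mob :: "real \<Rightarrow> real \<Rightarrow> complex" where "chord_mob x s = mob (g x) (g (x + s))"

lemma chord_mob_lt: "cmod (chord_mob x s) < 1" unfolding chord_mob_def using polar_dir_mob(1)[OF in_disc] .

lemma chord_mob_nz: "0 < s \<Longrightarrow> s < P \<Longrightarrow> chord_mob x s \<noteq> 0"
  unfolding chord_mob_def by (intro mob_nz in_disc g_neq')

lemma scaled_lt: "(s, r) \<in> polar_dom \<Longrightarrow> cmod (of_real r * chord_mob x s) < 1"
  unfolding chord_mob_def polar_dom_def by (intro mob_scaled) auto

lemma polar_map_eq: "polar_map x (s, r) = mob_inv (g x) (of_real r * chord_mob x s)"
  by (simp add: polar_map_def geod_pt_def chord_mob_def)

lemma mob_polar_map: "(s, r) \<in> polar_dom \<Longrightarrow> mob (g x) (polar_map x (s, r)) = of_real r * chord_mob x s"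
  unfolding polar_map_eq by (intro mob_mob_inv in_disc scaled_lt)

lemma polar_map_region: "p \<in> polar_dom \<Longrightarrow> polar_map x p \<in> region g"
  unfolding region_eq polar_map_def by (intro chord_interior) (use g_neq'[of "fst p" x] in \<open>auto simp: polar_dom_def\<close>)

lemma chord_angle_mw: "chord_angle g x (x + s) = Arg (chord_mob x s * cnj (u x))"
proof -
  obtain c where c: "c > 0" "polar_dir g (g (x + s)) x = of_real c * (mob (g x) (g (x + s)) * cnj (u x))"
    using polar_dir_mob_pos[OF in_disc] by blast
  then show ?thesis by (simp add: chord_angle_eq Arg_times_of_real chord_mob_def)
qed

text \<open>Equal points have equal directions at \<open>g x\<close>, so \<open>s\<close> is
  determined by injectivity of \<open>ang x\<close>; the radial fraction then follows by cancelling
  the nonzero \<open>chord_mob x s\<close>.\<close>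

lemma polar_map_inj: "inj_on (polar_map x) polar_dom"
proof (rule inj_onI)
  fix p q assume p: "p \<in> polar_dom" and q: "q \<in> polar_dom" and e: "polar_map x p = polar_map x q"
  obtain s r s' r' where pq: "p = (s, r)" "q = (s', r')" by (metis surj_pair)
  have b: "0 < s" "s < P" "0 < r" "0 < s'" "s' < P" "0 < r'" using p q by (auto simp: pq polar_dom_def)
  have m: "of_real r * chord_mob x s = of_real r' * chord_mob x s'"
    using mob_polar_map[of s r x] mob_polar_map[of s' r' x] p q e by (simp add: pq)
  then have "of_real r * (chord_mob x s * cnj (u x)) = of_real r' * (chord_mob x s' * cnj (u x))" by (metis mult.assoc)
  then have "chord_angle g x (x + s) = chord_angle g x (x + s')"
    unfolding chord_angle_mw using Arg_times_of_real[OF b(3)] Arg_times_of_real[OF b(6)] by metis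
  then have "ang x s = ang x s'" using b by (simp add: ang_eq)
  then have "s = s'" using inj_onD[OF ang_inj, of x s s'] b by auto
  with m have "r = r'" using chord_mob_nz[of s x] b by simp
  with \<open>s = s'\<close> show "p = q" by (simp add: pq)
qed

definition dmob :: "real \<Rightarrow> complex \<Rightarrow> complex" where
  "dmob x v = (1 - g x * cnj (g x)) / ((1 + cnj (g x) * v) * (1 + cnj (g x) * v))"

lemma polar_map_deriv:
  assumes "(s, r) \<in> polar_dom"
  shows "(polar_map x has_derivative (\<lambda>h. fst h *\<^sub>R (dmob x (of_real r * chord_mob x s) * (of_real r * (- chord_mob x s / dir (x + s) x)))
     + snd h *\<^sub>R (dmob x (of_real r * chord_mob x s) * chord_mob x s))) (at (s, r))"
proof -
  have s: "0 < s" "s < P" using assms by (auto simp: polar_dom_def)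
  have d1: "((\<lambda>s. x + s) has_vector_derivative 1) (at s)" by (auto intro!: derivative_eq_intros)
  have "(((\<lambda>t. mob (g x) (g t)) \<circ> (\<lambda>s. x + s)) has_vector_derivative (1 *\<^sub>R (- mob (g x) (g (x + s)) / dir (x + s) x))) (at s)"
    by (rule vector_diff_chain_at[OF d1 mob_deriv[OF in_disc]]) (use g_neq'[OF s, of x] in auto)
  then have "(chord_mob x has_vector_derivative (- chord_mob x s / dir (x + s) x)) (at s)" by (simp add: o_def chord_mob_def[abs_def])
  then have dm: "(chord_mob x has_derivative (\<lambda>h. h *\<^sub>R (- chord_mob x s / dir (x + s) x))) (at s)" by (simp add: has_vector_derivative_def)
  have "((\<lambda>p. chord_mob x (fst p)) has_derivative (\<lambda>h. fst h *\<^sub>R (- chord_mob x s / dir (x + s) x))) (at (s, r))"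
    by (rule has_derivative_compose[of fst fst, OF has_derivative_fst[OF has_derivative_ident]]) (use dm in simp)
  moreover have "((\<lambda>p. complex_of_real (snd p)) has_derivative (\<lambda>h. of_real (snd h))) (at (s, r))"
    by (intro derivative_intros)
  ultimately have dv: "((\<lambda>p. of_real (snd p) * chord_mob x (fst p)) has_derivative
     (\<lambda>h. of_real r * (fst h *\<^sub>R (- chord_mob x s / dir (x + s) x)) + of_real (snd h) * chord_mob x s)) (at (s, r))"
    using has_derivative_mult by fastforce
  define v where "v = of_real r * chord_mob x s"
  have v: "cmod v < 1" unfolding v_def using scaled_lt[OF assms] .
  note nz = mob_inv_in_disc(2)[OF in_disc[of x] v]
  have "(mob_inv (g x) has_field_derivative (1 * (1 + cnj (g x) * v) - (v + g x) * cnj (g x)) / ((1 + cnj (g x) * v) * (1 + cnj (g x) * v))) (at v)"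
    unfolding mob_inv_def[abs_def] using nz by (auto intro!: derivative_eq_intros)
  also have "1 * (1 + cnj (g x) * v) - (v + g x) * cnj (g x) = 1 - g x * cnj (g x)" by (simp add: algebra_simps)
  finally have "(mob_inv (g x) has_derivative (\<lambda>h. dmob x v * h)) (at v)"
    by (simp only: has_field_derivative_def dmob_def)
  then have "((\<lambda>p. mob_inv (g x) (of_real (snd p) * chord_mob x (fst p))) has_derivative
     (\<lambda>h. dmob x v * (of_real r * (fst h *\<^sub>R (- chord_mob x s / dir (x + s) x)) + of_real (snd h) * chord_mob x s))) (at (s, r))"
    using has_derivative_compose[OF dv, of "mob_inv (g x)"] by (simp add: v_def)
  moreover have "(\<lambda>p. mob_inv (g x) (of_real (snd p) * chord_mob x (fst p))) = polar_map x"
    using polar_map_eq[of x] by (auto simp: fun_eq_iff)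
  ultimately show ?thesis unfolding v_def[symmetric]
    by (simp add: scaleR_conv_of_real algebra_simps)
qed

lemma chord_mob_cont: "continuous_on S (chord_mob x)"
  unfolding chord_mob_def mob_def using one_minus_cnj_nz[OF in_disc in_disc]
  by (intro continuous_intros continuous_on_compose2[OF g_cont[of UNIV]]) auto

text \<open>This is the polar area element \<open>sinh \<rho> d\<rho> d\<alpha>\<close> in the
  coordinates \<open>(s, r)\<close>, where
  \<open>tanh (\<rho> / 2) = r * cmod (chord_mob x s)\<close> and
  \<open>d\<alpha> = ang_d x s ds\<close>. The derivative \<open>dmob\<close> of the chart cancels
  against the conformal density.\<close>

lemma polar_jacobian:
  fixes x s r :: real
  assumes sr: "(s, r) \<in> polar_dom"
  defines "A \<equiv> dmob x (of_real r * chord_mob x s) * (of_real r * (- chord_mob x s / dir (x + s) x))"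
    and "B \<equiv> dmob x (of_real r * chord_mob x s) * chord_mob x s" and "\<omega> \<equiv> (cmod (chord_mob x s))^2"
  shows "hyp_dens (polar_map x (s, r)) * \<bar>Im (cnj A * B)\<bar> = 4 * r * \<omega> / (1 - r^2 * \<omega>)^2 * ang_d x s"
proof -
  have b: "0 < s" "s < P" "0 < r" "r < 1" using sr by (auto simp: polar_dom_def)
  define v where "v = of_real r * chord_mob x s"
  have v: "cmod v < 1" unfolding v_def using scaled_lt[OF sr] .
  define m where "m = (cmod (1 + cnj (g x) * v))^2"
  have m: "m > 0" unfolding m_def using mob_inv_in_disc(2)[OF in_disc[of x] v] by simp
  define E where "E = 1 - (cmod (g x))^2"
  have E: "E > 0" using cmod2_lt by (simp add: E_def)
  have v2: "(cmod v)^2 = r^2 * \<omega>" by (simp add: v_def \<omega>_def norm_mult power_mult_distrib)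
  have o: "r^2 * \<omega> < 1" using v v2 by (metis abs_norm_cancel abs_square_less_1)
  have "complex_of_real (1 - (cmod (mob_inv (g x) v))^2) = of_real (E * (1 - (cmod v)^2) / m)"
    unfolding E_def m_def of_real_divide of_real_mult of_real_one_minus_cmod2 complex_norm_square mob_inv_in_disc(1)[OF in_disc v] by simp
  then have 1: "1 - (cmod (polar_map x (s, r)))^2 = E * (1 - r^2 * \<omega>) / m"
    unfolding polar_map_eq v_def[symmetric] v2 by (simp only: of_real_eq_iff)
  have "cmod (dmob x v) = E / m"
  proof -
    have "cmod (1 - g x * cnj (g x)) = E" unfolding of_real_one_minus_cmod2[symmetric] norm_of_real using E by (simp add: E_def)
    then show ?thesis by (simp add: dmob_def norm_divide norm_mult m_def power2_eq_square)
  qed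
  then have dm: "dmob x v * cnj (dmob x v) = of_real ((E / m)^2)" by (metis complex_norm_square)
  have "cnj A * B = (dmob x v * cnj (dmob x v)) * of_real r * (chord_mob x s * cnj (chord_mob x s)) * cnj (- 1 / dir (x + s) x)"
    unfolding A_def B_def v_def[symmetric] by simp
  also have "chord_mob x s * cnj (chord_mob x s) = of_real \<omega>" unfolding \<omega>_def by (rule complex_norm_square[symmetric])
  also have "dmob x v * cnj (dmob x v) * of_real r * of_real \<omega> * cnj (- 1 / dir (x + s) x) = of_real ((E / m)^2 * r * \<omega>) * cnj (- 1 / dir (x + s) x)"
    unfolding dm by simp
  finally have "Im (cnj A * B) = (E / m)^2 * r * \<omega> * (- Im (- 1 / dir (x + s) x))"
    by (simp only: times_complex.sel Re_complex_of_real Im_complex_of_real complex_cnj mult_zero_left add_0_right cnj.sel)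
  also have "Im (- 1 / dir (x + s) x) = ang_d x s" unfolding Im_minus_inverse ang_d_def ..
  finally have "\<bar>Im (cnj A * B)\<bar> = (E / m)^2 * r * \<omega> * ang_d x s"
    using b ang_d_pos[OF b(1,2), of x] by (simp add: abs_mult \<omega>_def)
  then have "hyp_dens (polar_map x (s, r)) * \<bar>Im (cnj A * B)\<bar> = 4 / (E * (1 - r^2 * \<omega>) / m)^2 * ((E / m)^2 * r * \<omega> * ang_d x s)"
    unfolding 1 by simp
  also have "\<dots> = 4 * r * \<omega> / (1 - r^2 * \<omega>)^2 * ang_d x s"
    using E m o by (simp add: power_divide power_mult_distrib)
  finally show ?thesis .
qed

abbreviation polar_dens :: "real \<Rightarrow> real \<Rightarrow> real \<Rightarrow> real" where
  "polar_dens x s r \<equiv> 4 * r * (cmod (chord_mob x s))^2 / (1 - r^2 * (cmod (chord_mob x s))^2)^2 * ang_d x s"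

lemma polar_dom_borel: "polar_dom \<in> sets borel" "open polar_dom"
  unfolding polar_dom_def by (auto intro!: borel_open open_Times)

text \<open>The change of variables is exact onto the image of \<open>polar_map\<close>; the
  inequality comes from the inclusion of that image in the region.\<close>

lemma polar_integral_le:
  assumes F: "F \<in> borel_measurable borel"
  shows "(\<integral>\<^sup>+p. F (polar_map x p) * ennreal (polar_dens x (fst p) (snd p)) * indicator polar_dom p \<partial>lborel)
     \<le> (\<integral>\<^sup>+z. F z * ennreal (hyp_dens z) * indicator (region g) z \<partial>lborel)"
proof -
  define A where "A p = dmob x (of_real (snd p) * chord_mob x (fst p)) * (of_real (snd p) * (- chord_mob x (fst p) / dir (x + fst p) x))" for p
  define B where "B p = dmob x (of_real (snd p) * chord_mob x (fst p)) * chord_mob x (fst p)" for p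
  have cm: "continuous_on polar_dom (\<lambda>p. chord_mob x (fst p))"
    by (intro continuous_on_compose2[OF chord_mob_cont[of UNIV]] continuous_intros) auto
  have cdm: "continuous_on polar_dom (\<lambda>p. dmob x (of_real (snd p) * chord_mob x (fst p)))"
    unfolding dmob_def using mob_inv_in_disc(2)[OF in_disc scaled_lt]
    by (intro continuous_intros cm) auto
  have cd: "continuous_on polar_dom (\<lambda>p. dir (x + fst p) x)"
    by (intro cont_polar_dir continuous_intros) (auto simp: in_disc)
  have dnz: "dir (x + fst p) x \<noteq> 0" if "p \<in> polar_dom" for p
    using dir_nz[of x "x + fst p"] g_neq'[of "fst p" x] that by (auto simp: polar_dom_def)
  have cA: "continuous_on polar_dom A" and cB: "continuous_on polar_dom B"
    unfolding A_def B_def using dnz by (intro continuous_intros cm cdm cd; auto)+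
  have bd: "bounded (polar_map x ` polar_dom)"
    by (rule bounded_subset[OF region_facts(3)]) (use polar_map_region in auto)
  have der: "(polar_map x has_derivative (\<lambda>h. fst h *\<^sub>R A p + snd h *\<^sub>R B p)) (at p)" if "p \<in> polar_dom" for p
    using polar_map_deriv[of "fst p" "snd p" x] that by (simp add: A_def B_def)
  define G where "G z = F z * ennreal (hyp_dens z)" for z
  have G: "G \<in> borel_measurable borel" unfolding G_def using F by measurable
  note cov = nn_integral_change_of_variables_complex[OF polar_dom_borel(2) bd polar_map_inj der cA cB G]
  have "(\<integral>\<^sup>+p. F (polar_map x p) * ennreal (polar_dens x (fst p) (snd p)) * indicator polar_dom p \<partial>lborel)
     = (\<integral>\<^sup>+p. G (polar_map x p) * ennreal \<bar>Im (cnj (A p) * B p)\<bar> * indicator polar_dom p \<partial>lborel)"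
  proof (rule nn_integral_cong)
    fix p
    show "F (polar_map x p) * ennreal (polar_dens x (fst p) (snd p)) * indicator polar_dom p
       = G (polar_map x p) * ennreal \<bar>Im (cnj (A p) * B p)\<bar> * indicator polar_dom p"
    proof (cases "p \<in> polar_dom")
      case True
      have "hyp_dens (polar_map x p) * \<bar>Im (cnj (A p) * B p)\<bar> = polar_dens x (fst p) (snd p)"
        using polar_jacobian[of "fst p" "snd p" x] True by (simp add: A_def B_def)
      then have "ennreal (hyp_dens (polar_map x p)) * ennreal \<bar>Im (cnj (A p) * B p)\<bar> = ennreal (polar_dens x (fst p) (snd p))"
        by (subst ennreal_mult[symmetric]) auto
      then show ?thesis by (simp add: G_def mult.assoc)
    qed simp
  qed
  also have "\<dots> = (\<integral>\<^sup>+z. G z * indicator (polar_map x ` polar_dom) z \<partial>lborel)" using cov(2) by simp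
  also have "\<dots> \<le> (\<integral>\<^sup>+z. G z * indicator (region g) z \<partial>lborel)"
    by (intro nn_integral_mono mult_left_mono) (use polar_map_region in \<open>auto simp: indicator_def\<close>)
  finally show ?thesis by (simp add: G_def)
qed

lemma polar_fubini:
  assumes "f \<in> borel_measurable (borel :: (real \<times> real) measure)"
  shows "(\<integral>\<^sup>+p. f p * indicator polar_dom p \<partial>lborel) = (\<integral>\<^sup>+s. (\<integral>\<^sup>+r. f (s, r) * indicator {0<..<1} r \<partial>lborel) * indicator {0<..<P} s \<partial>lborel)"
proof -
  have m: "(\<lambda>p. f p * indicator polar_dom p) \<in> borel_measurable (lborel \<Otimes>\<^sub>M lborel)"
    using assms polar_dom_borel by (simp add: lborel_prod)
  have "(\<integral>\<^sup>+p. f p * indicator polar_dom p \<partial>lborel) = (\<integral>\<^sup>+s. (\<integral>\<^sup>+r. f (s, r) * indicator polar_dom (s, r) \<partial>lborel) \<partial>lborel)"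
    using lborel.nn_integral_fst[OF m] by (simp add: lborel_prod)
  also have "\<dots> = (\<integral>\<^sup>+s. (\<integral>\<^sup>+r. f (s, r) * indicator {0<..<1} r \<partial>lborel) * indicator {0<..<P} s \<partial>lborel)"
  proof (rule nn_integral_cong)
    fix s
    have "f (s, r) * indicator polar_dom (s, r) = (if s \<in> {0<..<P} then f (s, r) * indicator {0<..<1} r else 0)" for r
      by (auto simp: polar_dom_def indicator_def)
    then show "(\<integral>\<^sup>+r. f (s, r) * indicator polar_dom (s, r) \<partial>lborel) = (\<integral>\<^sup>+r. f (s, r) * indicator {0<..<1} r \<partial>lborel) * indicator {0<..<P} s"
      by (auto simp: indicator_def)
  qed
  finally show ?thesis .
qed

end

section \<open>The area and the Gauss--Bonnet bound\<close>

context hyp_curve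
begin

abbreviation "area \<equiv> hyp_area (region g)"

text \<open>By \<open>region_in_ball\<close> the density is bounded on the region, so the gauge
  integral defining \<open>hyp_area\<close> is finite and agrees with the Lebesgue integral.\<close>

lemma nn_area: "(\<integral>\<^sup>+z. ennreal (hyp_dens z) * indicator (region g) z \<partial>lborel) = ennreal area" and area_nonneg: "area \<ge> 0"
proof -
  define f where "f z = hyp_dens z * indicat_real (region g) z" for z
  obtain \<rho> where r: "0 \<le> \<rho>" "\<rho> < 1" "region g \<subseteq> cball 0 \<rho>" using region_in_ball .
  have f: "f \<in> borel_measurable borel" unfolding f_def using borel_open[OF region_facts(1)] by measurable
  have "(\<integral>\<^sup>+z. ennreal (f z) \<partial>lborel) \<le> (\<integral>\<^sup>+z. ennreal (4 / (1 - \<rho>^2)^2) * indicator (cball 0 \<rho> :: complex set) z \<partial>lborel)"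
  proof (rule nn_integral_mono)
    fix z
    show "ennreal (f z) \<le> ennreal (4 / (1 - \<rho>^2)^2) * indicator (cball 0 \<rho>) z"
    proof (cases "z \<in> region g")
      case True
      then have z: "cmod z \<le> \<rho>" using r by auto
      then have "(cmod z)^2 \<le> \<rho>^2" "\<rho>^2 < 1" using r by (auto simp: abs_square_less_1 intro: power_mono)
      then have "(1 - \<rho>^2)^2 \<le> (1 - (cmod z)^2)^2" "0 < (1 - \<rho>^2)^2" by (auto intro!: power_mono)
      then have "hyp_dens z \<le> 4 / (1 - \<rho>^2)^2"
        by (intro divide_left_mono mult_pos_pos) (auto intro: less_le_trans simp del: zero_less_power2)
      then show ?thesis using True z by (auto simp: f_def intro: ennreal_leI)
    qed (simp add: f_def)
  qed
  also have "\<dots> = ennreal (4 / (1 - \<rho>^2)^2) * emeasure lborel (cball 0 \<rho> :: complex set)"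
    by (rule nn_integral_cmult_indicator) simp
  also have "\<dots> < \<infinity>" using emeasure_bounded_finite[OF bounded_cball, of "0::complex" \<rho>] by (simp add: ennreal_mult_less_top)
  finally have fin: "(\<integral>\<^sup>+z. ennreal (f z) \<partial>lborel) < \<infinity>" .
  define I where "I = enn2real (\<integral>\<^sup>+z. ennreal (f z) \<partial>lborel)"
  have I: "(\<integral>\<^sup>+z. ennreal (f z) \<partial>lborel) = ennreal I" "0 \<le> I" using fin by (auto simp: I_def)
  have "(f has_integral I) UNIV"
    by (rule nn_integral_has_integral[OF f _ I]) (simp add: f_def)
  moreover have "f = (\<lambda>z. if z \<in> region g then hyp_dens z else 0)" by (auto simp: f_def)
  ultimately have "((\<lambda>z. hyp_dens z) has_integral I) (region g)" by (simp add: has_integral_restrict_UNIV)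
  then have a: "area = I" unfolding hyp_area_def by (rule integral_unique)
  then show "area \<ge> 0" using I by simp
  show "(\<integral>\<^sup>+z. ennreal (hyp_dens z) * indicator (region g) z \<partial>lborel) = ennreal area"
    unfolding a I(1)[symmetric] by (intro nn_integral_cong) (auto simp: f_def indicator_def)
qed

lemma ang_d_mw_measurable:
  "(\<lambda>p. indicator polar_dom p *\<^sub>R (polar_dens x (fst p) (snd p))) \<in> borel_measurable borel"
proof (rule borel_measurable_continuous_on_indicator[OF polar_dom_borel(1)])
  have cm: "continuous_on polar_dom (\<lambda>p. chord_mob x (fst p))"
    by (intro continuous_on_compose2[OF chord_mob_cont[of UNIV]] continuous_intros) auto
  have ca: "continuous_on polar_dom (\<lambda>p. ang_d x (fst p))"
    using continuous_on_compose2[OF ang_d_cont, of polar_dom "\<lambda>p. (x, fst p)"]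
    by (force intro!: continuous_intros simp: polar_dom_def)
  have "1 - (snd p)^2 * (cmod (chord_mob x (fst p)))^2 \<noteq> 0" if "p \<in> polar_dom" for p
  proof -
    have "(cmod (of_real (snd p) * chord_mob x (fst p)))^2 < 1" using scaled_lt[of "fst p" "snd p" x] that by (simp add: abs_square_less_1)
    then show ?thesis by (simp add: norm_mult power_mult_distrib)
  qed
  then show "continuous_on polar_dom (\<lambda>p. polar_dens x (fst p) (snd p))"
    by (intro continuous_intros cm ca) auto
qed

text \<open>Iterated form of \<open>polar_integral_le\<close>: \<open>h s\<close> is the integrand
  along the chord to \<open>g (x + s)\<close>, and \<open>H s\<close> its integral over that
  chord.\<close>

lemma polar_integral_fubini:
  assumes F: "F \<in> borel_measurable borel"
    and h: "\<And>s r. s \<in> {0<..<P} \<Longrightarrow> r \<in> {0<..<1} \<Longrightarrow> F (polar_map x (s, r)) * ennreal (polar_dens x s r) = ennreal (h s r)"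
    and H: "\<And>s. s \<in> {0<..<P} \<Longrightarrow> (\<integral>\<^sup>+r. ennreal (h s r) * indicator {0<..<1} r \<partial>lborel) = ennreal (H s)"
  shows "(\<integral>\<^sup>+s. ennreal (H s) * indicator {0<..<P} s \<partial>lborel) \<le> (\<integral>\<^sup>+z. F z * ennreal (hyp_dens z) * indicator (region g) z \<partial>lborel)"
proof -
  define k where "k p = ennreal (indicator polar_dom p *\<^sub>R (polar_dens x (fst p) (snd p)))" for p
  define q where "q p = F (indicator polar_dom p *\<^sub>R polar_map x p) * k p" for p
  have cpm: "continuous_on polar_dom (polar_map x)"
  proof (intro continuous_at_imp_continuous_on ballI)
    fix p assume "p \<in> polar_dom"
    then have "(fst p, snd p) \<in> polar_dom" by simp
    from has_derivative_continuous[OF polar_map_deriv[OF this, of x]] show "isCont (polar_map x) p" by simp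
  qed
  have k: "k \<in> borel_measurable borel" unfolding k_def using ang_d_mw_measurable by simp
  have "(\<lambda>p. indicator polar_dom p *\<^sub>R polar_map x p) \<in> borel_measurable borel"
    by (rule borel_measurable_continuous_on_indicator[OF polar_dom_borel(1) cpm])
  from measurable_compose[OF this F] k have q: "q \<in> borel_measurable borel" unfolding q_def by simp
  have "(\<integral>\<^sup>+s. ennreal (H s) * indicator {0<..<P} s \<partial>lborel) = (\<integral>\<^sup>+s. (\<integral>\<^sup>+r. q (s, r) * indicator {0<..<1} r \<partial>lborel) * indicator {0<..<P} s \<partial>lborel)"
  proof (rule nn_integral_cong)
    fix s
    show "ennreal (H s) * indicator {0<..<P} s = (\<integral>\<^sup>+r. q (s, r) * indicator {0<..<1} r \<partial>lborel) * indicator {0<..<P} s"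
    proof (cases "s \<in> {0<..<P}")
      case True
      have "(\<integral>\<^sup>+r. q (s, r) * indicator {0<..<1} r \<partial>lborel) = (\<integral>\<^sup>+r. ennreal (h s r) * indicator {0<..<1} r \<partial>lborel)"
      proof (rule nn_integral_cong)
        fix r :: real
        show "q (s, r) * indicator {0<..<1} r = ennreal (h s r) * indicator {0<..<1} r"
          using h[OF True, of r] True by (cases "r \<in> {0<..<1}") (auto simp: q_def k_def polar_dom_def)
      qed
      then show ?thesis using H[OF True] by simp
    qed simp
  qed
  also have "\<dots> = (\<integral>\<^sup>+p. q p * indicator polar_dom p \<partial>lborel)" by (rule polar_fubini[OF q, symmetric])
  also have "\<dots> = (\<integral>\<^sup>+p. F (polar_map x p) * ennreal (polar_dens x (fst p) (snd p)) * indicator polar_dom p \<partial>lborel)"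
    by (intro nn_integral_cong) (auto simp: q_def k_def indicator_def)
  also have "\<dots> \<le> (\<integral>\<^sup>+z. F z * ennreal (hyp_dens z) * indicator (region g) z \<partial>lborel)"
    by (rule polar_integral_le[OF F])
  finally show ?thesis .
qed

lemma cosh_dist_mw: "cosh_dist (g x) (g (x + s)) = (1 + (cmod (chord_mob x s))^2) / (1 - (cmod (chord_mob x s))^2)"
  using polar_dir_mob(3)[OF in_disc[of "x + s"], of x] by (simp add: chord_mob_def cosh_dist_commute)

lemma chord_mob2_lt: "(cmod (chord_mob x s))^2 < 1" using chord_mob_lt by (simp add: abs_square_less_1)

lemma r2_mw2_lt: "0 \<le> r \<Longrightarrow> r \<le> 1 \<Longrightarrow> r^2 * (cmod (chord_mob x s))^2 < 1"
  using chord_mob2_lt[of x s] mult_left_le_one_le[of "(cmod (chord_mob x s))^2" "r^2"] by (auto simp: power_le_one intro: order_le_less_trans)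

text \<open>A sector of radius \<rho> and angle d\<alpha> has area
  \<open>(cosh \<rho> - 1) d\<alpha>\<close>. The primitive in \<open>r\<close> below is
  \<open>cosh \<rho> + 1 = 2 / (1 - tanh^2 (\<rho> / 2))\<close>, taken between the base point and
  the far end.\<close>

lemma polar_area_le:
  "integral {0..P} (\<lambda>s. Im (dir (x + s) x) / (cosh_dist (g x) (g (x + s)) + 1)) \<le> area"
proof -
  define f where "f s = Im (dir (x + s) x) / (cosh_dist (g x) (g (x + s)) + 1)" for s
  define H where "H s = ang_d x s * (2 / (1 - (cmod (chord_mob x s))^2)) - ang_d x s * 2" for s
  have Cpos: "cosh_dist (g x) (g (x + s)) \<ge> 1" for s using cosh_dist_gt_1[OF in_disc in_disc, of x "x + s"]
    by (cases "g x = g (x + s)") (auto simp: cosh_dist_def)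
  have Hf: "H s = f s" if "s \<in> {0<..<P}" for s
  proof -
    define C where "C = cosh_dist (g x) (g (x + s))"
    have "dir (x + s) x \<noteq> 0" using dir_nz[of x "x + s"] g_neq'[of s x] that by auto
    moreover have n: "(cmod (dir (x + s) x))^2 = (C - 1) * (C + 1)"
      unfolding polar_dir_norm2[OF in_disc] C_def by (simp add: power2_eq_square algebra_simps)
    ultimately have "(C - 1) * (C + 1) \<noteq> 0" unfolding n[symmetric] by simp
    then have "(C - 1) * ang_d x s = f s" unfolding f_def ang_d_def n C_def[symmetric] by simp
    moreover have "C - 1 = 2 / (1 - (cmod (chord_mob x s))^2) - 2"
      unfolding C_def cosh_dist_mw using chord_mob2_lt[of x s] by (simp add: field_simps)
    ultimately show ?thesis unfolding H_def by (simp add: algebra_simps)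
  qed
  have f0: "f s \<ge> 0" for s
  proof -
    have "Im (dir (x + s) x) \<ge> 0" using dir_pos[of x "x + s"] by (cases "g x = g (x + s)") (auto simp: polar_dir_def less_imp_le)
    then show ?thesis using Cpos[of s] by (simp add: f_def)
  qed
  have "continuous_on {0..P} f" unfolding f_def
  proof (intro continuous_intros)
    show "continuous_on {0..P} (\<lambda>s. dir (x + s) x)"
      by (intro continuous_on_compose2[OF dir_cont, of _ "\<lambda>s. (x + s, x)", simplified] continuous_intros)
    show "continuous_on {0..P} (\<lambda>s. cosh_dist (g x) (g (x + s)))"
      by (intro cont_cosh_dist continuous_on_compose2[OF g_cont[of UNIV]] continuous_intros) (auto simp: in_disc)
    show "\<forall>s\<in>{0..P}. cosh_dist (g x) (g (x + s)) + 1 \<noteq> 0" using Cpos by (smt (verit))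
  qed
  then have "(f has_integral integral {0..P} f) {0..P}"
    using integrable_continuous_real integrable_integral by blast
  then have "(f has_integral integral {0..P} f) {0<..<P}" by (simp add: has_integral_Icc_iff_Ioo)
  then have "ennreal (integral {0..P} f) = (\<integral>\<^sup>+s. ennreal (f s) * indicator {0<..<P} s \<partial>lborel)"
    by (intro nn_integral_has_integral_lebesgue'[symmetric]) (auto simp: f0)
  also have "\<dots> = (\<integral>\<^sup>+s. ennreal (H s) * indicator {0<..<P} s \<partial>lborel)"
    by (intro nn_integral_cong) (auto simp: Hf indicator_def)
  also have "\<dots> \<le> (\<integral>\<^sup>+z. 1 * ennreal (hyp_dens z) * indicator (region g) z \<partial>lborel)"
  proof (rule polar_integral_fubini[where h="\<lambda>s r. polar_dens x s r"])
    fix s assume s: "s \<in> {0<..<P}"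
    let ?o = "(cmod (chord_mob x s))^2"
    have nz: "1 - r^2 * ?o \<noteq> 0" if "0 \<le> r" "r \<le> 1" for r using r2_mw2_lt[OF that, of x s] by simp
    have "(\<integral>\<^sup>+r. ennreal (4 * r * ?o / (1 - r^2 * ?o)^2 * ang_d x s) * indicator {0<..<1} r \<partial>lborel)
      = ennreal (ang_d x s * (2 / (1 - 1^2 * ?o)) - ang_d x s * (2 / (1 - 0^2 * ?o)))"
    proof (rule nn_integral_FTC_interior)
      show "continuous_on {0..1} (\<lambda>r. ang_d x s * (2 / (1 - r^2 * ?o)))"
        using nz by (intro continuous_intros) auto
      fix r :: real assume r: "r \<in> {0<..<1}"
      have d: "((\<lambda>r. 1 - r^2 * ?o) has_real_derivative (- (2 * r * ?o))) (at r)"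
        by (auto intro!: derivative_eq_intros)
      show "((\<lambda>r. ang_d x s * (2 / (1 - r^2 * ?o))) has_real_derivative 4 * r * ?o / (1 - r^2 * ?o)^2 * ang_d x s) (at r)"
        using nz[of r] r by (auto intro!: derivative_eq_intros d simp: power2_eq_square)
      show "0 \<le> 4 * r * ?o / (1 - r^2 * ?o)^2 * ang_d x s" using r s ang_d_pos[of s x] by auto
    qed simp
    then show "(\<integral>\<^sup>+r. ennreal (4 * r * ?o / (1 - r^2 * ?o)^2 * ang_d x s) * indicator {0<..<1} r \<partial>lborel) = ennreal (H s)"
      by (simp add: H_def)
  qed auto
  also have "\<dots> = ennreal area" using nn_area by simp
  finally show ?thesis using area_nonneg by (simp add: f_def[abs_def])
qed

lemma gauss_bonnet_le: obtains K where "(\<kappa> has_integral K) {0..P}" "K \<le> 2 * pi + area"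
proof -
  have "(\<kappa> has_integral (2 * pi + integral {0..P} (\<lambda>s. Im (dir (0 + s) 0) / (cosh_dist (g 0) (g (0 + s)) + 1)))) {0..P}"
    using gauss_bonnet_polar[of 0] by simp
  then show ?thesis using that polar_area_le[of 0] by fastforce
qed

section \<open>Santalo's formula and the weight of a chord\<close>

lemma sin_ang_mw:
  assumes "0 < s" "s < P"
  shows "sin (ang x s) = Im (chord_mob x s * cnj (u x)) / cmod (chord_mob x s)" "Im (chord_mob x s * cnj (u x)) > 0"
proof -
  have ne: "g (x + s) \<noteq> g x" using g_neq'[OF assms] .
  obtain c where c: "c > 0" "dir x (x + s) = of_real c * (chord_mob x s * cnj (u x))"
    unfolding chord_mob_def using polar_dir_mob_pos[OF in_disc] by blast
  have i: "Im (dir x (x + s)) = c * Im (chord_mob x s * cnj (u x))" unfolding c(2) by (simp only: times_complex.sel(2) Im_complex_of_real Re_complex_of_real mult_zero_left add_0_right)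
  have n: "cmod (dir x (x + s)) = c * cmod (chord_mob x s)" unfolding c(2) using c(1) by (simp add: norm_mult cmod_u)
  show "Im (chord_mob x s * cnj (u x)) > 0" using dir_pos[OF ne] c(1) unfolding i by (simp only: zero_less_mult_iff) auto
  have "sin (ang x s) = c * Im (chord_mob x s * cnj (u x)) / (c * cmod (chord_mob x s))"
    using sin_chord_angle[OF ne] unfolding ang_eq[OF assms] i n .
  then show "sin (ang x s) = Im (chord_mob x s * cnj (u x)) / cmod (chord_mob x s)" using c(1) by simp
qed

text \<open>The invariant measure in terms of the endpoints of a chord:
  \<open>sin \<phi> d\<phi> = chord_wt x s ds\<close>. Its value is
  \<open>sin \<phi> * sin \<psi> / sinh L\<close>, with \<phi> and \<psi> the angles at the two
  ends.\<close>

definition chord_wt :: "real \<Rightarrow> real \<Rightarrow> real" where "chord_wt x s = sin (ang x s) * ang_d x s"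

lemma polar_dir_measurable: "(\<lambda>p. Im (polar_dir g p x) / (cmod (polar_dir g p x))^2) \<in> borel_measurable borel"
proof -
  have c: "cnj \<in> borel_measurable borel" by (intro borel_measurable_continuous_onI continuous_intros)
  have "(\<lambda>p. polar_dir g p x) \<in> borel_measurable borel"
    unfolding polar_dir_def using c by measurable
  then show ?thesis by measurable
qed

text \<open>Santalo's formula at a boundary point: the kernel \<open>sinh r\<close> of polar coordinates is cancelled by the
  visual angle under which \<open>p\<close> sees the boundary near \<open>g x\<close>.\<close>

lemma santalo_point:
  "(\<integral>\<^sup>+s. ennreal (chord_len x s * chord_wt x s) * indicator {0<..<P} s \<partial>lborel)
   \<le> (\<integral>\<^sup>+z. ennreal (Im (polar_dir g z x) / (cmod (polar_dir g z x))^2) * ennreal (hyp_dens z) * indicator (region g) z \<partial>lborel)"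
proof (rule polar_integral_fubini[where h="\<lambda>s r. ang_d x s * (2 * Im (chord_mob x s * cnj (u x)) / (1 - r^2 * (cmod (chord_mob x s))^2))"])
  show "(\<lambda>z. ennreal (Im (polar_dir g z x) / (cmod (polar_dir g z x))^2)) \<in> borel_measurable borel"
    using polar_dir_measurable by simp
next
  fix s r :: real assume s: "s \<in> {0<..<P}" and r: "r \<in> {0<..<1}"
  let ?o = "(cmod (chord_mob x s))^2" and ?I = "Im (chord_mob x s * cnj (u x))"
  have sr: "(s, r) \<in> polar_dom" using s r by (simp add: polar_dom_def)
  have o: "?o > 0" using chord_mob_nz[of s x] s by simp
  have q: "1 - r^2 * ?o > 0" using r2_mw2_lt[of r x s] r by simp
  have I: "?I > 0" using sin_ang_mw(2)[of s x] s by simp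
  define c where "c = 2 / (1 - r^2 * ?o)"
  have c: "c > 0" using q by (simp add: c_def)
  have Z: "polar_dir g (polar_map x (s, r)) x = of_real (c * r) * (chord_mob x s * cnj (u x))"
    using polar_dir_mob(2)[OF region_in_disc[OF polar_map_region[OF sr]], of x x]
    unfolding mob_polar_map[OF sr] by (simp add: c_def norm_mult power_mult_distrib)
  have Zi: "Im (polar_dir g (polar_map x (s, r)) x) = c * r * ?I"
    unfolding Z by (simp only: times_complex.sel(2) Im_complex_of_real Re_complex_of_real mult_zero_left add_0_right)
  have Zn: "(cmod (polar_dir g (polar_map x (s, r)) x))^2 = (c * r)^2 * ?o"
    unfolding Z by (simp add: norm_mult cmod_u power_mult_distrib)
  have "Im (polar_dir g (polar_map x (s, r)) x) / (cmod (polar_dir g (polar_map x (s, r)) x))^2 = ?I / (c * r * ?o)"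
    unfolding Zi Zn using c r by (simp add: power2_eq_square)
  moreover have "?I / (c * r * ?o) * (4 * r * ?o / (1 - r^2 * ?o)^2 * ang_d x s) = ang_d x s * (2 * ?I / (1 - r^2 * ?o))"
  proof -
    have alg: "2 * Q * i / Q^2 * a = a * (2 * i / Q)" if "Q > 0" for Q i a :: real
      using that by (simp add: power2_eq_square)
    have "?I / (c * r * ?o) * (4 * r * ?o / (1 - r^2 * ?o)^2 * ang_d x s) = (4 / c) * ?I / (1 - r^2 * ?o)^2 * ang_d x s"
      using c r o by simp
    also have "4 / c = 2 * (1 - r^2 * ?o)" by (simp add: c_def)
    also have "2 * (1 - r^2 * ?o) * ?I / (1 - r^2 * ?o)^2 * ang_d x s = ang_d x s * (2 * ?I / (1 - r^2 * ?o))"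
      by (rule alg[OF q])
    finally show ?thesis .
  qed
  ultimately show "ennreal (Im (polar_dir g (polar_map x (s, r)) x) / (cmod (polar_dir g (polar_map x (s, r)) x))^2) * ennreal (4 * r * ?o / (1 - r^2 * ?o)^2 * ang_d x s)
      = ennreal (ang_d x s * (2 * ?I / (1 - r^2 * ?o)))"
    using c r o I q s ang_d_pos[of s x] by (subst ennreal_mult[symmetric]) auto
next
  fix s :: real assume s: "s \<in> {0<..<P}"
  let ?o = "(cmod (chord_mob x s))^2" and ?I = "Im (chord_mob x s * cnj (u x))" and ?w = "cmod (chord_mob x s)"
  have w: "?w > 0" "?w < 1" using chord_mob_nz[of s x] s chord_mob_lt by auto
  have I: "?I > 0" using sin_ang_mw(2)[of s x] s by simp
  have "(\<integral>\<^sup>+r. ennreal (ang_d x s * (2 * ?I / (1 - r^2 * ?o))) * indicator {0<..<1} r \<partial>lborel)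
    = ennreal (ang_d x s * (2 * ?I / ?w * artanh (1 * ?w)) - ang_d x s * (2 * ?I / ?w * artanh (0 * ?w)))"
  proof (rule nn_integral_FTC_interior)
    have rw: "\<bar>r * ?w\<bar> < 1" if "0 \<le> r" "r \<le> 1" for r
    proof -
      have "r * ?w \<le> ?w" "0 \<le> r * ?w" using that w by (auto intro: mult_left_le_one_le)
      then show ?thesis using w by linarith
    qed
    show "continuous_on {0..1} (\<lambda>r. ang_d x s * (2 * ?I / ?w * artanh (r * ?w)))"
    proof (intro continuous_on_mult continuous_on_const continuous_on_artanh')
      fix r :: real assume "r \<in> {0..1}"
      then have "\<bar>r * ?w\<bar> < 1" by (intro rw) auto
      then show "r * ?w \<in> {- 1<..<1}" unfolding abs_less_iff greaterThanLessThan_iff by linarith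
    qed (rule continuous_on_id)
    fix r :: real assume r: "r \<in> {0<..<1}"
    have "((\<lambda>r. artanh (r * ?w)) has_real_derivative (1 / (1 - (r * ?w)^2) * ?w)) (at r)"
      by (rule DERIV_chain2[OF artanh_real_has_field_derivative]) (use rw[of r] r in \<open>auto intro!: derivative_eq_intros\<close>)
    from DERIV_cmult[OF DERIV_cmult[OF this, of "2 * ?I / ?w"], of "ang_d x s"]
    show "((\<lambda>r. ang_d x s * (2 * ?I / ?w * artanh (r * ?w))) has_real_derivative ang_d x s * (2 * ?I / (1 - r^2 * ?o))) (at r)"
      using w by (simp add: power_mult_distrib)
    show "0 \<le> ang_d x s * (2 * ?I / (1 - r^2 * ?o))" using r s ang_d_pos[of s x] I r2_mw2_lt[of r x s] by simp
  qed simp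
  \<comment> \<open>Since \<open>?w = tanh (L / 2)\<close>, the radial integral has produced the
    chord length \<open>L = 2 * artanh ?w\<close> times the weight.\<close>
  also have "ang_d x s * (2 * ?I / ?w * artanh (1 * ?w)) - ang_d x s * (2 * ?I / ?w * artanh (0 * ?w)) = chord_len x s * chord_wt x s"
  proof -
    have "chord_len x s = 2 * artanh ?w"
      unfolding chord_len_def hdist_eq cosh_dist_mw by (rule cosh_2_artanh) (use w in auto)
    then show ?thesis unfolding chord_wt_def using sin_ang_mw(1)[of s x] s by simp
  qed
  finally show "(\<integral>\<^sup>+r. ennreal (ang_d x s * (2 * ?I / (1 - r^2 * ?o))) * indicator {0<..<1} r \<partial>lborel) = ennreal (chord_len x s * chord_wt x s)" .
qed

text \<open>Integrating \<open>santalo_point\<close> over the boundary and exchanging the order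
  leaves, for each inner point, the total visual angle of the curve, which is at most
  \<open>2 * pi\<close> by \<open>winding_bound\<close>.\<close>

lemma santalo_le:
  "(\<integral>\<^sup>+x. (\<integral>\<^sup>+s. ennreal (chord_len x s * chord_wt x s) * indicator {0<..<P} s \<partial>lborel) * indicator {0..P} x \<partial>lborel) \<le> ennreal (2 * pi * area)"
proof -
  define k where "k z x = Im (polar_dir g z x) / (cmod (polar_dir g z x))^2" for z x
  define R where "R = region g \<times> (UNIV :: real set)"
  have Rb: "R \<in> sets borel" unfolding R_def using region_facts(1) by (intro borel_open open_Times) auto
  have nz: "polar_dir g z x \<noteq> 0" if "z \<in> region g" for z x
    using polar_dir_eq_0_iff[OF region_in_disc[OF that]] that region_facts(4) by auto
  have "continuous_on R (\<lambda>p. k (fst p) (snd p))" unfolding k_def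
    by (intro continuous_intros cont_polar_dir) (auto simp: R_def region_in_disc nz)
  then have km: "(\<lambda>p. indicator R p *\<^sub>R k (fst p) (snd p)) \<in> borel_measurable borel"
    by (rule borel_measurable_continuous_on_indicator[OF Rb])
  define h where "h p = ennreal (indicator R p *\<^sub>R k (fst p) (snd p)) * ennreal (hyp_dens (fst p)) * indicator (region g) (fst p) * indicator {0..P} (snd p)" for p
  have "h \<in> borel_measurable borel"
  proof -
    have "(\<lambda>p::complex \<times> real. indicator (region g) (fst p) * indicator {0..P} (snd p) :: ennreal) \<in> borel_measurable borel"
    proof -
      have "indicator (region g \<times> {0..P}) \<in> borel_measurable (borel :: (complex \<times> real) measure)"
        using region_facts(1) by (intro borel_measurable_indicator) (auto simp: borel_prod[symmetric])
      moreover have "(\<lambda>p::complex \<times> real. indicator (region g) (fst p) * indicator {0..P} (snd p) :: ennreal) = indicator (region g \<times> {0..P})"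
        by (auto simp: indicator_def fun_eq_iff)
      ultimately show ?thesis by simp
    qed
    moreover have "(\<lambda>p::complex \<times> real. hyp_dens (fst p)) \<in> borel_measurable borel"
      by (intro borel_measurable_divide borel_measurable_continuous_onI continuous_intros)
    ultimately show ?thesis unfolding h_def using km by (simp add: mult.assoc)
  qed
  then have hm: "h \<in> borel_measurable (lborel \<Otimes>\<^sub>M lborel)" by (simp add: lborel_prod)
  have "(\<integral>\<^sup>+x. (\<integral>\<^sup>+s. ennreal (chord_len x s * chord_wt x s) * indicator {0<..<P} s \<partial>lborel) * indicator {0..P} x \<partial>lborel)
     \<le> (\<integral>\<^sup>+x. (\<integral>\<^sup>+z. ennreal (k z x) * ennreal (hyp_dens z) * indicator (region g) z \<partial>lborel) * indicator {0..P} x \<partial>lborel)"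
    unfolding k_def by (intro nn_integral_mono mult_right_mono santalo_point) auto
  also have "\<dots> = (\<integral>\<^sup>+x. (\<integral>\<^sup>+z. h (z, x) \<partial>lborel) \<partial>lborel)"
  proof (rule nn_integral_cong)
    fix x
    have "(\<integral>\<^sup>+z. h (z, x) \<partial>lborel) = (\<integral>\<^sup>+z. (if x \<in> {0..P} then ennreal (k z x) * ennreal (hyp_dens z) * indicator (region g) z else 0) \<partial>lborel)"
      by (intro nn_integral_cong) (auto simp: h_def R_def indicator_def)
    then show "(\<integral>\<^sup>+z. ennreal (k z x) * ennreal (hyp_dens z) * indicator (region g) z \<partial>lborel) * indicator {0..P} x = (\<integral>\<^sup>+z. h (z, x) \<partial>lborel)"
      by (auto simp: indicator_def)
  qed
  also have "\<dots> = (\<integral>\<^sup>+z. (\<integral>\<^sup>+x. h (z, x) \<partial>lborel) \<partial>lborel)"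
    by (rule lborel_pair.Fubini'[where f="\<lambda>z x. h (z, x)"]) (use hm in simp)
  also have "\<dots> \<le> (\<integral>\<^sup>+z. ennreal (2 * pi) * (ennreal (hyp_dens z) * indicator (region g) z) \<partial>lborel)"
  proof (rule nn_integral_mono)
    fix z
    show "(\<integral>\<^sup>+x. h (z, x) \<partial>lborel) \<le> ennreal (2 * pi) * (ennreal (hyp_dens z) * indicator (region g) z)"
    proof (cases "z \<in> region g")
      case True
      obtain I where I: "(k z has_integral I) {0..P}" "I \<le> 2 * pi"
        using winding_bound[OF True] unfolding k_def by blast
      have kp: "k z x \<ge> 0" for x using True unfolding region_eq interior_pts_def k_def by (simp add: less_imp_le)
      have "(\<integral>\<^sup>+x. h (z, x) \<partial>lborel) = (\<integral>\<^sup>+x. ennreal (hyp_dens z) * (ennreal (k z x) * indicator {0..P} x) \<partial>lborel)"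
        using True by (intro nn_integral_cong) (simp add: h_def R_def mult_ac)
      also have "\<dots> = ennreal (hyp_dens z) * (\<integral>\<^sup>+x. ennreal (k z x) * indicator {0..P} x \<partial>lborel)"
      proof (rule nn_integral_cmult)
        have "k z = (\<lambda>x. k z x)" by simp
        have "continuous_on UNIV (k z)" unfolding k_def using nz[OF True]
          by (intro continuous_intros polar_dir_cont region_in_disc True) auto
        then have "k z \<in> borel_measurable borel" by (rule borel_measurable_continuous_onI)
        then show "(\<lambda>x. ennreal (k z x) * indicator {0..P} x) \<in> borel_measurable lborel" by simp
      qed
      also have "(\<integral>\<^sup>+x. ennreal (k z x) * indicator {0..P} x \<partial>lborel) = ennreal I"
        by (rule nn_integral_has_integral_lebesgue'[OF _ I(1)]) (rule kp)
      also have "ennreal (hyp_dens z) * ennreal I \<le> ennreal (hyp_dens z) * ennreal (2 * pi)"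
        using I(2) by (intro mult_left_mono ennreal_leI) auto
      finally show ?thesis using True by (simp add: mult.commute)
    qed (simp add: h_def)
  qed
  also have "\<dots> = ennreal (2 * pi) * (\<integral>\<^sup>+z. ennreal (hyp_dens z) * indicator (region g) z \<partial>lborel)"
    using region_facts(1) by (intro nn_integral_cmult) (auto intro!: borel_measurable_times)
  also have "\<dots> = ennreal (2 * pi * area)" unfolding nn_area using area_nonneg by (subst ennreal_mult[symmetric]) auto
  finally show ?thesis .
qed

end

section \<open>The billiard map\<close>

lemma nn_integral_periodic_shift:
  fixes f :: "real \<Rightarrow> ennreal"
  assumes f[measurable]: "f \<in> borel_measurable borel" and per: "\<And>x. f (x + p) = f x" and s: "0 \<le> s" "s \<le> p"
  shows "(\<integral>\<^sup>+x. f (x + s) * indicator {0..<p} x \<partial>lborel) = (\<integral>\<^sup>+x. f x * indicator {0..<p} x \<partial>lborel)"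
proof -
  have "(\<integral>\<^sup>+x. f x * indicator {s..<s + p} x \<partial>lborel) = (\<integral>\<^sup>+x. f (s + 1 * x) * indicator {s..<s + p} (s + 1 * x) \<partial>lborel)"
    by (subst nn_integral_real_affine[of _ 1 s]) auto
  also have "\<dots> = (\<integral>\<^sup>+x. f (x + s) * indicator {0..<p} x \<partial>lborel)"
    by (intro nn_integral_cong) (auto simp: indicator_def add.commute)
  finally have 1: "(\<integral>\<^sup>+x. f (x + s) * indicator {0..<p} x \<partial>lborel) = (\<integral>\<^sup>+x. f x * indicator {s..<s + p} x \<partial>lborel)" ..
  also have "\<dots> = (\<integral>\<^sup>+x. f x * indicator {s..<p} x + f x * indicator {p..<p + s} x \<partial>lborel)"
    using s by (intro nn_integral_cong) (auto simp: indicator_def)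
  also have "\<dots> = (\<integral>\<^sup>+x. f x * indicator {s..<p} x \<partial>lborel) + (\<integral>\<^sup>+x. f x * indicator {p..<p + s} x \<partial>lborel)"
    by (rule nn_integral_add) auto
  also have "(\<integral>\<^sup>+x. f x * indicator {p..<p + s} x \<partial>lborel) = (\<integral>\<^sup>+x. f (p + 1 * x) * indicator {p..<p + s} (p + 1 * x) \<partial>lborel)"
    by (subst nn_integral_real_affine[of _ 1 p]) auto
  also have "\<dots> = (\<integral>\<^sup>+x. f x * indicator {0..<s} x \<partial>lborel)"
    using per by (intro nn_integral_cong) (auto simp: indicator_def add.commute)
  also have "(\<integral>\<^sup>+x. f x * indicator {s..<p} x \<partial>lborel) + (\<integral>\<^sup>+x. f x * indicator {0..<s} x \<partial>lborel) = (\<integral>\<^sup>+x. f x * indicator {s..<p} x + f x * indicator {0..<s} x \<partial>lborel)"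
    by (rule nn_integral_add[symmetric]) auto
  also have "\<dots> = (\<integral>\<^sup>+x. f x * indicator {0..<p} x \<partial>lborel)"
    using s by (intro nn_integral_cong) (auto simp: indicator_def)
  finally show ?thesis .
qed

lemma nn_integral_reflect:
  fixes f :: "real \<Rightarrow> ennreal"
  assumes f[measurable]: "f \<in> borel_measurable borel"
  shows "(\<integral>\<^sup>+x. f (c - x) * indicator {0<..<c} x \<partial>lborel) = (\<integral>\<^sup>+x. f x * indicator {0<..<c} x \<partial>lborel)"
proof -
  have "(\<integral>\<^sup>+x. f x * indicator {0<..<c} x \<partial>lborel) = (\<integral>\<^sup>+x. f (c + (-1) * x) * indicator {0<..<c} (c + (-1) * x) \<partial>lborel)"
    by (subst nn_integral_real_affine[of _ "-1" c]) auto
  also have "\<dots> = (\<integral>\<^sup>+x. f (c - x) * indicator {0<..<c} x \<partial>lborel)"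
    by (intro nn_integral_cong) (auto simp: indicator_def)
  finally show ?thesis ..
qed

context hyp_curve
begin

lemma ang_shift: "ang (x + of_int m * P) s = ang x s"
proof -
  have "g (x + of_int m * P + s) = g (x + s)" using g_shift[of "x + s" m] by (simp add: algebra_simps)
  then have "chord_angle g (x + of_int m * P) (x + of_int m * P + s) = chord_angle g x (x + s)"
    unfolding chord_angle_shift by (rule chord_angle_cong2)
  then show ?thesis by (simp only: ang_def)
qed

lemma ang_d_shift: "ang_d (x + of_int m * P) s = ang_d x s"
proof -
  have "x + of_int m * P + s = (x + s) + of_int m * P" by simp
  then show ?thesis unfolding ang_d_def by (simp only: polar_dir_shift g_shift)
qed

lemma chord_wt_shift: "chord_wt (x + of_int m * P) s = chord_wt x s" by (simp only: chord_wt_def ang_shift ang_d_shift)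

text \<open>Both sides are \<open>sin \<phi> * sin \<psi> / sinh L\<close>, which is symmetric in
  the two ends. From \<open>x + s\<close> the offset \<open>P - s\<close> leads back to the same
  point \<open>g x\<close>, one period later.\<close>

lemma chord_wt_reverse: assumes "0 < s" "s < P" shows "chord_wt x s = chord_wt (x + s) (P - s)"
proof -
  have ne: "g (x + s) \<noteq> g x" using g_neq'[OF assms] .
  have a: "ang (x + s) (P - s) = chord_angle g (x + s) x" using ang_reverse[of s x] assms by simp
  have "x + s + (P - s) = x + of_int 1 * P" by simp
  then have b: "ang_d (x + s) (P - s) = Im (dir x (x + s)) / (cmod (dir x (x + s)))^2"
    unfolding ang_d_def by (simp only: polar_dir_shift)
  show ?thesis unfolding chord_wt_def a b ang_eq[OF assms] sin_chord_angle[OF ne] sin_chord_angle[OF ne[symmetric]] ang_d_def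
    using norm_dir_commute[where x=x and y="x + s"] by (simp add: polar_dir_periodic)
qed

lemma chord_wt_nonneg: "0 < s \<Longrightarrow> s < P \<Longrightarrow> chord_wt x s \<ge> 0"
  unfolding chord_wt_def using ang_bounds[of s x] ang_d_pos[of s x] by (intro mult_nonneg_nonneg sin_ge_zero) auto

lemma ang_cont_all: "continuous_on UNIV (\<lambda>p. ang (fst p) (snd p))"
proof -
  have "continuous_on UNIV (\<lambda>p. ang (fst (fst p, min P (max 0 (snd p)))) (snd (fst p :: real, min P (max 0 (snd p)))))"
    by (rule continuous_on_compose2[OF ang_cont]) (use P_pos in \<open>auto intro!: continuous_intros\<close>)
  moreover have "ang x (min P (max 0 s)) = ang x s" for x s
    using P_pos by (auto simp: ang_def min_def max_def)
  ultimately show ?thesis by simp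
qed

lemma ang_measurable [measurable (raw)]:
  assumes "f \<in> borel_measurable M" "h \<in> borel_measurable M"
  shows "(\<lambda>x. ang (f x) (h x)) \<in> borel_measurable M"
proof -
  have "(\<lambda>p. ang (fst p) (snd p)) \<in> borel_measurable borel" by (rule borel_measurable_continuous_onI[OF ang_cont_all])
  moreover have "(\<lambda>x. (f x, h x)) \<in> borel_measurable M" using assms by simp
  ultimately show ?thesis by (auto dest: measurable_compose[rotated])
qed

definition chord_wt0 :: "real \<Rightarrow> real \<Rightarrow> ennreal" where "chord_wt0 x s = ennreal (chord_wt x s) * indicator {0<..<P} s"

lemma chord_wt0_measurable [measurable (raw)]:
  assumes "f \<in> borel_measurable M" "h \<in> borel_measurable M"
  shows "(\<lambda>x. chord_wt0 (f x) (h x)) \<in> borel_measurable M"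
proof -
  let ?S = "(UNIV :: real set) \<times> {0<..<P}"
  have S: "?S \<in> sets borel" by (intro borel_open open_Times) auto
  have "(\<lambda>p. indicator ?S p *\<^sub>R chord_wt (fst p) (snd p)) \<in> borel_measurable borel"
  proof (rule borel_measurable_continuous_on_indicator[OF S])
    show "continuous_on ?S (\<lambda>p. chord_wt (fst p) (snd p))"
      unfolding chord_wt_def by (intro continuous_intros continuous_on_subset[OF ang_cont_all] ang_d_cont) auto
  qed
  then have "(\<lambda>p. ennreal (indicator ?S p *\<^sub>R chord_wt (fst p) (snd p))) \<in> borel_measurable borel" by simp
  moreover have "(\<lambda>p. ennreal (indicator ?S p *\<^sub>R chord_wt (fst p) (snd p))) = (\<lambda>p. chord_wt0 (fst p) (snd p))"
    by (auto simp: chord_wt0_def indicator_def fun_eq_iff)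
  ultimately have "(\<lambda>p. chord_wt0 (fst p) (snd p)) \<in> borel_measurable borel" by (simp only:)
  moreover have "(\<lambda>x. (f x, h x)) \<in> borel_measurable M" using assms by simp
  ultimately show ?thesis by (auto dest: measurable_compose[rotated])
qed

text \<open>The substitution \<phi> = \<open>ang x s\<close>, where \<open>ang x\<close> is a
  bijection from \<open>(0, P)\<close> onto \<open>(0, pi)\<close> with derivative
  \<open>ang_d x\<close>.\<close>

lemma angle_substitution:
  assumes G[measurable]: "G \<in> borel_measurable borel"
  shows "(\<integral>\<^sup>+\<phi>. G \<phi> * (ennreal (sin \<phi>) * indicator {0<..<pi} \<phi>) \<partial>lborel) = (\<integral>\<^sup>+s. G (ang x s) * chord_wt0 x s \<partial>lborel)"
proof -
  have "(\<integral>\<^sup>+\<phi>. G \<phi> * (ennreal (sin \<phi>) * indicator {0<..<pi} \<phi>) \<partial>lborel) = (\<integral>\<^sup>+\<phi>. (G \<phi> * ennreal (sin \<phi>)) * indicator (ang x ` {0<..<P}) \<phi> \<partial>lborel)"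
    unfolding ang_image by (simp add: mult.assoc)
  also have "\<dots> = (\<integral>\<^sup>+s. (G (ang x s) * ennreal (sin (ang x s))) * ennreal \<bar>ang_d x s\<bar> * indicator {0<..<P} s \<partial>lborel)"
  proof (rule nn_integral_change_of_variables_real)
    show "continuous_on {0<..<P} (ang_d x)"
      using continuous_on_compose2[OF ang_d_cont, of "{0<..<P}" "\<lambda>s. (x, s)"] by (force intro!: continuous_intros)
    show "bounded (ang x ` {0<..<P})" "ang x ` {0<..<P} \<in> sets borel" unfolding ang_image by auto
    show "(ang x has_real_derivative ang_d x s) (at s)" if "s \<in> {0<..<P}" for s using ang_deriv[of s x] that by auto
  qed (use ang_inj in auto)
  also have "\<dots> = (\<integral>\<^sup>+s. G (ang x s) * chord_wt0 x s \<partial>lborel)"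
  proof (rule nn_integral_cong)
    fix s
    show "(G (ang x s) * ennreal (sin (ang x s))) * ennreal \<bar>ang_d x s\<bar> * indicator {0<..<P} s = G (ang x s) * chord_wt0 x s"
    proof (cases "s \<in> {0<..<P}")
      case True
      then have "sin (ang x s) \<ge> 0" "ang_d x s > 0" using ang_bounds[of s x] ang_d_pos[of s x] by (auto intro!: sin_ge_zero)
      then show ?thesis using True by (simp add: chord_wt0_def chord_wt_def mult.assoc ennreal_mult)
    qed (simp add: chord_wt0_def)
  qed
  finally show ?thesis .
qed

section \<open>The phase space in angle and in chord coordinates\<close>

abbreviation "\<Omega> \<equiv> phase_space P"

definition phase_measure :: "(real \<times> real) measure" where "phase_measure = restrict_space bmeasure \<Omega>"

lemma Omega_borel: "\<Omega> \<in> sets borel"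
  unfolding phase_space_def borel_prod[symmetric] by (intro pair_measureI) auto

lemma bmeasure_sets: "sets bmeasure = sets borel" by (simp add: bmeasure_def)
lemma bmeasure_space: "space bmeasure = UNIV" by (simp add: bmeasure_def)

lemma phase_space_space: "space phase_measure = \<Omega>"
  by (simp add: phase_measure_def space_restrict_space bmeasure_space)

lemma phase_sets: "A \<in> sets phase_measure \<longleftrightarrow> A \<in> sets borel \<and> A \<subseteq> \<Omega>"
  unfolding phase_measure_def using Omega_borel by (subst sets_restrict_space_iff) (auto simp: bmeasure_sets bmeasure_space)

lemma sin_snd_measurable: "(\<lambda>(x::real, \<phi>::real). ennreal (sin \<phi>)) \<in> borel_measurable borel"
proof -
  have "(\<lambda>p::real\<times>real. sin (snd p)) \<in> borel_measurable borel" by (intro borel_measurable_continuous_onI continuous_intros)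
  then show ?thesis by (simp add: split_beta)
qed

lemma borel_pair_measurable: "f \<in> borel_measurable (borel :: (real \<times> real) measure) \<Longrightarrow> f \<in> borel_measurable (lborel \<Otimes>\<^sub>M lborel)"
  by (simp add: lborel_prod)

lemma phase_integral:
  assumes F: "F \<in> borel_measurable borel"
  shows "(\<integral>\<^sup>+p. F p \<partial>phase_measure) = (\<integral>\<^sup>+x. (\<integral>\<^sup>+\<phi>. F (x, \<phi>) * (ennreal (sin \<phi>) * indicator {0<..<pi} \<phi>) \<partial>lborel) * indicator {0..<P} x \<partial>lborel)"
proof -
  have "(\<integral>\<^sup>+p. F p \<partial>phase_measure) = (\<integral>\<^sup>+p. F p * indicator \<Omega> p \<partial>bmeasure)"
    unfolding phase_measure_def using Omega_borel by (subst nn_integral_restrict_space) (auto simp: bmeasure_sets bmeasure_space)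
  also have "\<dots> = (\<integral>\<^sup>+p. (case p of (x, \<phi>) \<Rightarrow> ennreal (sin \<phi>)) * (F p * indicator \<Omega> p) \<partial>lborel)"
    unfolding bmeasure_def using F Omega_borel sin_snd_measurable by (subst nn_integral_density) auto
  also have "\<dots> = (\<integral>\<^sup>+x. (\<integral>\<^sup>+\<phi>. ennreal (sin \<phi>) * (F (x, \<phi>) * indicator \<Omega> (x, \<phi>)) \<partial>lborel) \<partial>lborel)"
  proof -
    have "(\<lambda>p. (case p of (x, \<phi>) \<Rightarrow> ennreal (sin \<phi>)) * (F p * indicator \<Omega> p)) \<in> borel_measurable (lborel \<Otimes>\<^sub>M lborel)"
      using F Omega_borel sin_snd_measurable by (intro borel_pair_measurable) auto
    from lborel.nn_integral_fst[OF this] show ?thesis by (simp add: lborel_prod)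
  qed
  also have "\<dots> = (\<integral>\<^sup>+x. (\<integral>\<^sup>+\<phi>. F (x, \<phi>) * (ennreal (sin \<phi>) * indicator {0<..<pi} \<phi>) \<partial>lborel) * indicator {0..<P} x \<partial>lborel)"
  proof (rule nn_integral_cong)
    fix x
    have "ennreal (sin \<phi>) * (F (x, \<phi>) * indicator \<Omega> (x, \<phi>)) = (if x \<in> {0..<P} then F (x, \<phi>) * (ennreal (sin \<phi>) * indicator {0<..<pi} \<phi>) else 0)" for \<phi>
      by (auto simp: phase_space_def indicator_def mult.commute)
    then show "(\<integral>\<^sup>+\<phi>. ennreal (sin \<phi>) * (F (x, \<phi>) * indicator \<Omega> (x, \<phi>)) \<partial>lborel) = (\<integral>\<^sup>+\<phi>. F (x, \<phi>) * (ennreal (sin \<phi>) * indicator {0<..<pi} \<phi>) \<partial>lborel) * indicator {0..<P} x"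
      by (auto simp: indicator_def)
  qed
  finally show ?thesis .
qed

lemma section_measurable: "F \<in> borel_measurable (borel :: (real \<times> real) measure) \<Longrightarrow> (\<lambda>y. F (x, y)) \<in> borel_measurable borel"
  using measurable_compose[of "\<lambda>y. (x, y)" borel borel F] by simp

lemma phase_integral_chord:
  assumes F: "F \<in> borel_measurable borel"
  shows "(\<integral>\<^sup>+p. F p \<partial>phase_measure) = (\<integral>\<^sup>+x. (\<integral>\<^sup>+s. F (x, ang x s) * chord_wt0 x s \<partial>lborel) * indicator {0..<P} x \<partial>lborel)"
  unfolding phase_integral[OF F] using angle_substitution[OF section_measurable[OF F]] by simp

section \<open>The billiard map on one period and its invariant measure\<close>

definition reduce :: "real \<Rightarrow> real" where "reduce x = x - of_int \<lfloor>x / P\<rfloor> * P"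

lemma reduce_bounds: "0 \<le> reduce x" "reduce x < P"
  unfolding reduce_def using P_pos floor_divide_lower[OF P_pos, of x] floor_divide_upper[OF P_pos, of x] by (auto simp: algebra_simps)

lemma reduce_shift: "reduce x = x + of_int (- \<lfloor>x / P\<rfloor>) * P" by (simp add: reduce_def)

lemma reduce_id: "0 \<le> x \<Longrightarrow> x < P \<Longrightarrow> reduce x = x"
  using P_pos by (simp add: reduce_def floor_eq_iff)

lemma reduce_periodic: "reduce (x + P) = reduce x"
  using P_pos by (simp add: reduce_def add_divide_distrib algebra_simps)

lemma reduce_measurable [measurable]: "reduce \<in> borel_measurable borel" unfolding reduce_def by measurable

definition next_param :: "real \<times> real \<Rightarrow> real" where "next_param p = inv_into {0<..<P} (ang (fst p)) (snd p)"

lemma next_param: assumes "p \<in> \<Omega>" shows "0 < next_param p" "next_param p < P" "ang (fst p) (next_param p) = snd p"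
proof -
  have "snd p \<in> ang (fst p) ` {0<..<P}" unfolding ang_image using assms by (auto simp: phase_space_def)
  from inv_into_into[OF this] f_inv_into_f[OF this] show "0 < next_param p" "next_param p < P" "ang (fst p) (next_param p) = snd p"
    by (auto simp: next_param_def)
qed

lemma next_param_ang: "0 < s \<Longrightarrow> s < P \<Longrightarrow> next_param (x, ang x s) = s"
  unfolding next_param_def using inv_into_f_f[OF ang_inj, of s x] by simp

text \<open>\<open>ang\<close> increases in the offset, so a sublevel set of its inverse consists of
  the points below the graph of the continuous function \<open>x \<mapsto> ang x c\<close>.\<close>

lemma next_param_measurable: "next_param \<in> borel_measurable phase_measure"
proof (rule borel_measurable_iff_le[THEN iffD2], rule allI)
  fix c
  consider "c \<le> 0" | "c \<ge> P" | "0 < c" "c < P" by linarith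
  then have "{p \<in> \<Omega>. next_param p \<le> c} \<in> sets phase_measure"
  proof cases
    case 1
    then have e: "{p \<in> \<Omega>. next_param p \<le> c} = {}" using next_param(1) by force
    show ?thesis unfolding e by simp
  next
    case 2
    then have e: "{p \<in> \<Omega>. next_param p \<le> c} = \<Omega>" using next_param(2) by force
    show ?thesis unfolding e using sets.top[of phase_measure] by (simp add: phase_space_space)
  next
    case 3
    have "{p \<in> \<Omega>. next_param p \<le> c} = {p. snd p \<le> ang (fst p) c} \<inter> \<Omega>"
    proof -
      have "next_param p \<le> c \<longleftrightarrow> snd p \<le> ang (fst p) c" if "p \<in> \<Omega>" for p
        using ang_strict_mono[of "next_param p" c "fst p"] ang_strict_mono[of c "next_param p" "fst p"] next_param[OF that] 3 by (cases "next_param p" c rule: linorder_cases) auto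
      then show ?thesis by auto
    qed
    moreover have "{p. snd p \<le> ang (fst p) c} \<in> sets (borel :: (real \<times> real) measure)"
    proof -
      have "continuous_on UNIV (\<lambda>p::real \<times> real. ang (fst (fst p, c)) (snd (fst p, c)))"
        by (rule continuous_on_compose2[OF ang_cont_all]) (auto intro!: continuous_intros)
      then have "closed {p::real\<times>real. snd p \<le> ang (fst p) c}" by (intro closed_Collect_le continuous_intros) simp
      then show ?thesis by (rule borel_closed)
    qed
    ultimately show ?thesis using Omega_borel by (auto simp: phase_sets)
  qed
  then show "{p \<in> space phase_measure. next_param p \<le> c} \<in> sets phase_measure" by (simp add: phase_space_space)
qed

text \<open>\<open>P - next_param p\<close> is the offset of the reversed chord, so the
  \<open>ang\<close> term is the angle back towards the start; its supplement is the reflected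
  angle.\<close>

definition billiard :: "real \<times> real \<Rightarrow> real \<times> real" where
  "billiard p = (reduce (fst p + next_param p), pi - ang (fst p + next_param p) (P - next_param p))"

lemma billiard_in: assumes "p \<in> \<Omega>" shows "billiard p \<in> \<Omega>"
  using next_param(1,2)[OF assms] reduce_bounds[of "fst p + next_param p"] ang_bounds[of "P - next_param p" "fst p + next_param p"]
  by (simp add: billiard_def phase_space_def)

lemma phase_measurable_borel: "F \<in> borel_measurable borel \<Longrightarrow> F \<in> measurable phase_measure N" if "sets N = sets borel" for F :: "real \<times> real \<Rightarrow> 'b::topological_space"
  unfolding phase_measure_def using that by (intro measurable_restrict_space1) (auto cong: measurable_cong_sets simp: bmeasure_sets)

lemma fst_snd_phase [measurable]: "fst \<in> borel_measurable phase_measure" "snd \<in> borel_measurable phase_measure"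
  by (auto intro!: phase_measurable_borel borel_measurable_continuous_onI continuous_intros)

lemma billiard_measurable: "billiard \<in> measurable phase_measure phase_measure"
proof -
  note next_param_measurable[measurable]
  have "billiard \<in> borel_measurable phase_measure" unfolding billiard_def by measurable
  then have "billiard \<in> measurable phase_measure (restrict_space borel \<Omega>)"
    by (intro measurable_restrict_space2) (auto simp: phase_space_space billiard_in)
  moreover have "sets (restrict_space borel \<Omega>) = sets phase_measure"
    unfolding phase_measure_def by (simp add: sets_restrict_space bmeasure_sets)
  ultimately show ?thesis using measurable_cong_sets by blast
qed

text \<open>In chord coordinates the map first reverses a chord, which preserves the weight by
  \<open>chord_wt_reverse\<close>, and then replaces \<phi> by \<open>pi - \<phi>\<close>, which
  preserves \<open>sin \<phi> d\<phi>\<close>.\<close>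

lemma billiard_preserves: "distr phase_measure phase_measure billiard = phase_measure"
proof (rule measure_eqI)
  fix B assume "B \<in> sets (distr phase_measure phase_measure billiard)"
  then have B: "B \<in> sets phase_measure" by simp
  then have Bb: "B \<in> sets borel" "B \<subseteq> \<Omega>" by (auto simp: phase_sets)
  define F where "F p = (indicator B p :: ennreal)" for p
  have F[measurable]: "F \<in> borel_measurable borel" unfolding F_def using Bb by simp
  have "billiard -` B \<inter> \<Omega> \<in> sets phase_measure"
    using measurable_sets[OF billiard_measurable B] by (simp add: phase_space_space)
  then have Tb: "billiard -` B \<inter> \<Omega> \<in> sets borel" by (simp add: phase_sets)
  \<comment> \<open>\<open>H y s\<close> is the integrand expressed at the far endpoint
    \<open>y = x + s\<close>. For fixed \<open>s\<close> it is periodic in \<open>y\<close>, so the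
    shift by \<open>s\<close> disappears on integrating over a period.\<close>
  define H where "H y s = F (reduce y, pi - ang y (P - s)) * chord_wt0 y (P - s)" for y s
  have Fm: "(\<lambda>x. F (f x, h x)) \<in> borel_measurable M" if "f \<in> borel_measurable M" "h \<in> borel_measurable M" for f h and M :: "'z measure"
    using measurable_compose[of "\<lambda>x. (f x, h x)" M borel F borel] that by simp
  have Hm: "(\<lambda>x. H (f x) (h x)) \<in> borel_measurable M" if [measurable]: "f \<in> borel_measurable M" "h \<in> borel_measurable M" for f h and M :: "'z measure"
    unfolding H_def by (intro borel_measurable_times_ennreal Fm chord_wt0_measurable) measurable
  have Hper: "H (y + P) s = H y s" for y s
    unfolding H_def reduce_periodic chord_wt0_def using ang_shift[of y 1] chord_wt_shift[of y 1] by simp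
  have "emeasure (distr phase_measure phase_measure billiard) B = emeasure phase_measure (billiard -` B \<inter> \<Omega>)"
    using emeasure_distr[OF billiard_measurable B] by (simp add: phase_space_space)
  also have "\<dots> = (\<integral>\<^sup>+p. indicator (billiard -` B \<inter> \<Omega>) p \<partial>phase_measure)"
    using Tb by (intro nn_integral_indicator[symmetric]) (simp add: phase_sets)
  also have "\<dots> = (\<integral>\<^sup>+x. (\<integral>\<^sup>+s. indicator (billiard -` B \<inter> \<Omega>) (x, ang x s) * chord_wt0 x s \<partial>lborel) * indicator {0..<P} x \<partial>lborel)"
    by (rule phase_integral_chord) (use Tb in simp)
  also have "\<dots> = (\<integral>\<^sup>+x. (\<integral>\<^sup>+s. H (x + s) s * indicator {0..<P} x \<partial>lborel) \<partial>lborel)"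
  proof (rule nn_integral_cong)
    fix x
    have "indicator (billiard -` B \<inter> \<Omega>) (x, ang x s) * chord_wt0 x s = H (x + s) s" if x: "x \<in> {0..<P}" for s
    proof (cases "s \<in> {0<..<P}")
      case True
      then have "(x, ang x s) \<in> \<Omega>" using x ang_bounds[of s x] by (auto simp: phase_space_def)
      moreover have "billiard (x, ang x s) = (reduce (x + s), pi - ang (x + s) (P - s))"
        using next_param_ang[of s x] True by (simp add: billiard_def)
      moreover have "chord_wt0 x s = chord_wt0 (x + s) (P - s)" using chord_wt_reverse[of s x] True by (auto simp: chord_wt0_def)
      ultimately show ?thesis by (auto simp: H_def F_def indicator_def)
    qed (auto simp: chord_wt0_def H_def)
    then show "(\<integral>\<^sup>+s. indicator (billiard -` B \<inter> \<Omega>) (x, ang x s) * chord_wt0 x s \<partial>lborel) * indicator {0..<P} x = (\<integral>\<^sup>+s. H (x + s) s * indicator {0..<P} x \<partial>lborel)"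
      by (cases "x \<in> {0..<P}") auto
  qed
  also have "\<dots> = (\<integral>\<^sup>+s. (\<integral>\<^sup>+x. H (x + s) s * indicator {0..<P} x \<partial>lborel) \<partial>lborel)"
    by (rule lborel_pair.Fubini'[where f="\<lambda>s x. H (x + s) s * indicator {0..<P} x"])
      (unfold case_prod_beta, intro borel_measurable_times_ennreal Hm; measurable)
  also have "\<dots> = (\<integral>\<^sup>+s. (\<integral>\<^sup>+x. H x s * indicator {0..<P} x \<partial>lborel) \<partial>lborel)"
  proof (rule nn_integral_cong)
    fix s
    show "(\<integral>\<^sup>+x. H (x + s) s * indicator {0..<P} x \<partial>lborel) = (\<integral>\<^sup>+x. H x s * indicator {0..<P} x \<partial>lborel)"
    proof (cases "s \<in> {0<..<P}")
      case True
      then show ?thesis by (intro nn_integral_periodic_shift Hm Hper) auto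
    next
      case False
      then have "H y s = 0" for y by (auto simp: H_def chord_wt0_def indicator_def)
      then show ?thesis by simp
    qed
  qed
  also have "\<dots> = (\<integral>\<^sup>+x. (\<integral>\<^sup>+s. H x s * indicator {0..<P} x \<partial>lborel) \<partial>lborel)"
    by (rule lborel_pair.Fubini'[where f="\<lambda>x s. H x s * indicator {0..<P} x"])
      (unfold case_prod_beta, intro borel_measurable_times_ennreal Hm; measurable)
  also have "\<dots> = (\<integral>\<^sup>+x. (\<integral>\<^sup>+\<phi>. F (x, \<phi>) * (ennreal (sin \<phi>) * indicator {0<..<pi} \<phi>) \<partial>lborel) * indicator {0..<P} x \<partial>lborel)"
  proof (rule nn_integral_cong)
    fix x
    show "(\<integral>\<^sup>+s. H x s * indicator {0..<P} x \<partial>lborel) = (\<integral>\<^sup>+\<phi>. F (x, \<phi>) * (ennreal (sin \<phi>) * indicator {0<..<pi} \<phi>) \<partial>lborel) * indicator {0..<P} x"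
    proof (cases "x \<in> {0..<P}")
      case True
      define G where "G s = F (x, pi - ang x s) * chord_wt0 x s" for s
      have Gm: "G \<in> borel_measurable borel" unfolding G_def by (intro borel_measurable_times_ennreal Fm chord_wt0_measurable) measurable
      have "(\<integral>\<^sup>+s. H x s * indicator {0..<P} x \<partial>lborel) = (\<integral>\<^sup>+s. G (P - s) * indicator {0<..<P} s \<partial>lborel)"
        using True by (intro nn_integral_cong) (auto simp: H_def G_def reduce_id chord_wt0_def indicator_def)
      also have "\<dots> = (\<integral>\<^sup>+s. G s * indicator {0<..<P} s \<partial>lborel)" by (rule nn_integral_reflect[OF Gm])
      also have "\<dots> = (\<integral>\<^sup>+s. F (x, pi - ang x s) * chord_wt0 x s \<partial>lborel)"
        by (intro nn_integral_cong) (auto simp: G_def chord_wt0_def indicator_def)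
      also have "\<dots> = (\<integral>\<^sup>+\<phi>. F (x, pi - \<phi>) * (ennreal (sin \<phi>) * indicator {0<..<pi} \<phi>) \<partial>lborel)"
        by (rule angle_substitution[symmetric]) (intro Fm; measurable)
      also have "\<dots> = (\<integral>\<^sup>+\<phi>. (F (x, pi - \<phi>) * ennreal (sin (pi - \<phi>))) * indicator {0<..<pi} \<phi> \<partial>lborel)"
        by (simp add: mult.assoc)
      also have "\<dots> = (\<integral>\<^sup>+\<phi>. (F (x, \<phi>) * ennreal (sin \<phi>)) * indicator {0<..<pi} \<phi> \<partial>lborel)"
        by (rule nn_integral_reflect[of "\<lambda>\<phi>. F (x, \<phi>) * ennreal (sin \<phi>)"]) (intro borel_measurable_times_ennreal Fm; measurable)
      finally show ?thesis using True by (simp add: mult.assoc)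
    qed simp
  qed
  also have "\<dots> = (\<integral>\<^sup>+p. F p \<partial>phase_measure)" by (rule phase_integral[OF F, symmetric])
  also have "\<dots> = emeasure phase_measure B" unfolding F_def using B by simp
  finally show "emeasure (distr phase_measure phase_measure billiard) B = emeasure phase_measure B" .
qed simp

end

section \<open>Focal points along an orbit\<close>

lemma artanh_inverse: "X > 1 \<Longrightarrow> artanh (1 / X) = ln ((X + 1) / (X - 1)) / 2" for X :: real
proof -
  assume X: "X > 1"
  have "(1 + 1 / X) / (1 - 1 / X) = (X + 1) / (X - 1)" using X by (simp add: field_simps)
  then show ?thesis by (simp add: artanh_def)
qed

text \<open>Midpoint convexity of the inverse hyperbolic cotangent \<open>artanh (1 / X)\<close>.
  After exponentiating, the two sides of the polynomial inequality differ by
  \<open>m * (X - Y)^2\<close>.\<close>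

lemma artanh_inverse_midpoint:
  fixes X Y :: real
  assumes "X > 1" "Y > 1"
  shows "2 * artanh (2 / (X + Y)) \<le> artanh (1 / X) + artanh (1 / Y)"
proof -
  define m where "m = (X + Y) / 2"
  have m: "m > 1" using assms by (simp add: m_def)
  have le: "((m + 1) / (m - 1))^2 \<le> ((X + 1) / (X - 1)) * ((Y + 1) / (Y - 1))"
  proof -
    have "(X - 1) * (Y - 1) > 0" "(m - 1)^2 > 0" using assms m by auto
    moreover have "(m + 1)^2 * ((X - 1) * (Y - 1)) \<le> ((X + 1) * (Y + 1)) * (m - 1)^2"
    proof -
      have "((X + 1) * (Y + 1)) * (m - 1)^2 - (m + 1)^2 * ((X - 1) * (Y - 1)) = m * (X - Y)^2"
        unfolding m_def by (simp add: field_simps power2_eq_square)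
      moreover have "m * (X - Y)^2 \<ge> 0" using m by simp
      ultimately show ?thesis by linarith
    qed
    ultimately show ?thesis by (simp add: power_divide frac_le_eq divide_le_eq le_divide_eq mult.commute)
  qed
  have p: "(m + 1) / (m - 1) > 0" "(X + 1) / (X - 1) > 0" "(Y + 1) / (Y - 1) > 0" using assms m by auto
  have "2 * ln ((m + 1) / (m - 1)) = ln (((m + 1) / (m - 1))^2)" using p by (simp add: ln_realpow)
  also have "\<dots> \<le> ln (((X + 1) / (X - 1)) * ((Y + 1) / (Y - 1)))"
    by (rule iffD2[OF ln_le_cancel_iff[OF zero_less_power[OF p(1)] mult_pos_pos[OF p(2,3)]] le])
  also have "\<dots> = ln ((X + 1) / (X - 1)) + ln ((Y + 1) / (Y - 1))" using p by (intro ln_mult_pos) auto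
  finally have "2 * artanh (1 / m) \<le> artanh (1 / X) + artanh (1 / Y)"
    using artanh_inverse[OF m] artanh_inverse[OF assms(1)] artanh_inverse[OF assms(2)] by simp
  then show ?thesis by (simp add: m_def)
qed

text \<open>With \<open>c = coth L\<close> and \<open>X = coth a\<close> the formula for
  \<open>Y\<close> is \<open>coth (L - a)\<close>: a focal point at distance \<open>a\<close> after
  one bounce is at distance \<open>L - a\<close> before the next.\<close>

lemma artanh_inverse_add:
  fixes X Y c :: real
  assumes "c > 1" "X > c" "Y = c + (c^2 - 1) / (X - c)"
  shows "artanh (1 / X) + artanh (1 / Y) = artanh (1 / c)" "Y > c"
proof -
  have c2: "c^2 > 1" using assms(1) by simp
  then show Y: "Y > c" using assms by simp
  have XY: "X * Y = c * (X + Y) - 1"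
    unfolding assms(3) using assms(2) by (simp add: field_simps power2_eq_square)
  have eq: "((X + 1) / (X - 1)) * ((Y + 1) / (Y - 1)) = (c + 1) / (c - 1)"
  proof -
    have 1: "(X + 1) * (Y + 1) = (c + 1) * (X + Y)" using XY by (simp add: algebra_simps)
    have 2: "(X - 1) * (Y - 1) = (c - 1) * (X + Y)" using XY by (simp add: algebra_simps)
    have "X + Y \<noteq> 0" using assms(1,2) Y by linarith
    then show ?thesis unfolding times_divide_times_eq 1 2 by simp
  qed
  have "ln ((X + 1) / (X - 1)) + ln ((Y + 1) / (Y - 1)) = ln ((c + 1) / (c - 1))"
    unfolding eq[symmetric] using assms(1,2) Y by (intro ln_mult_pos[symmetric]) auto
  then show "artanh (1 / X) + artanh (1 / Y) = artanh (1 / c)"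
    using artanh_inverse[of X] artanh_inverse[of Y] artanh_inverse[of c] assms(1,2) Y by simp
qed

lemma artanh_nonneg: "0 \<le> x \<Longrightarrow> x < 1 \<Longrightarrow> artanh x \<ge> (0::real)"
  by (auto simp: artanh_def intro!: ln_ge_zero)

lemma artanh_mono: "0 \<le> x \<Longrightarrow> x \<le> y \<Longrightarrow> y < 1 \<Longrightarrow> artanh x \<le> artanh (y::real)"
  by (auto simp: artanh_def intro!: ln_mono frac_le divide_right_mono)

text \<open>Mirror-equation form of a discrete Jacobi field: \<open>Y n\<close> and \<open>X n\<close> are hyperbolic cotangents of the distances
  from the \<open>n\<close>-th bounce to the focal points of the incoming and the outgoing beam emanating from bounce \<open>0\<close>.\<close>

fun focalY :: "(nat \<Rightarrow> real) \<Rightarrow> (nat \<Rightarrow> real) \<Rightarrow> nat \<Rightarrow> real" where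
  "focalY c k 0 = 0"
| "focalY c k (Suc 0) = c 0"
| "focalY c k (Suc (Suc n)) = c (Suc n) + ((c (Suc n))^2 - 1) / (2 * k (Suc n) - focalY c k (Suc n) - c (Suc n))"

text \<open>Elimination of a tridiagonal quadratic form from the left; the pivots are
  \<open>focalY c k n + c n - 2 * k n\<close>. The test vector is found by back substitution from
  \<open>\<eta> m = 1\<close>, each earlier entry maximising the part of the form already
  eliminated, so that the value of the form is exactly the last pivot.\<close>

lemma focal_pivots:
  fixes c e k :: "nat \<Rightarrow> real"
  assumes e2: "\<And>n. (c n)^2 - 1 = (e n)^2"
    and neg: "\<And>m \<eta>. m \<ge> 1 \<Longrightarrow> (\<And>i. i = 0 \<or> i > m \<Longrightarrow> \<eta> i = 0) \<Longrightarrow> \<eta> m = 1 \<Longrightarrow>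
       (\<Sum>n<Suc m. c n * ((\<eta> n)^2 + (\<eta> (Suc n))^2) + 2 * e n * \<eta> n * \<eta> (Suc n) - k n * (\<eta> n)^2 - k (Suc n) * (\<eta> (Suc n))^2) < 0"
    and "m \<ge> 1"
  shows "2 * k m - focalY c k m > c m"
  using \<open>m \<ge> 1\<close>
proof (induction m rule: less_induct)
  case (less m)
  define X where "X n = 2 * k n - focalY c k n" for n
  have IH: "X i > c i" if "1 \<le> i" "i < m" for i using less.IH[of i] that by (simp add: X_def)
  define \<eta> where "\<eta> i = (if 1 \<le> i \<and> i \<le> m then (\<Prod>l=i..<m. e l / (X l - c l)) else 0)" for i
  have \<eta>m: "\<eta> m = 1" using less.prems by (simp add: \<eta>_def)
  have \<eta>0: "\<eta> i = 0" if "i = 0 \<or> i > m" for i using that by (auto simp: \<eta>_def)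
  have rec: "\<eta> i = e i / (X i - c i) * \<eta> (Suc i)" if "1 \<le> i" "i < m" for i
    using that by (simp add: \<eta>_def prod.atLeast_Suc_lessThan)
  define q where "q n = c n * ((\<eta> n)^2 + (\<eta> (Suc n))^2) + 2 * e n * \<eta> n * \<eta> (Suc n) - k n * (\<eta> n)^2 - k (Suc n) * (\<eta> (Suc n))^2" for n
  \<comment> \<open>Only half of the curvature term at bounce \<open>j\<close> is spent on the
    chords behind it; the other half enters with the chord ahead.\<close>
  have part: "(\<Sum>n<j. q n) = (focalY c k j - k j) * (\<eta> j)^2" if "1 \<le> j" "j \<le> m" for j
    using that
  proof (induction j rule: dec_induct)
    case base
    then show ?case using \<eta>0[of 0] by (simp add: q_def algebra_simps)
  next
    case (step j)
    define p where "p = X j - c j"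
    have p: "p > 0" using IH[of j] step by (simp add: p_def)
    have h: "\<eta> j = e j / p * \<eta> (Suc j)" using rec[of j] step by (simp add: p_def)
    obtain j' where j': "j = Suc j'" using step by (cases j) auto
    have fY: "focalY c k (Suc j) = c j + (e j)^2 / p"
      unfolding j' by (simp add: e2 p_def X_def j')
    have "(\<Sum>n<Suc j. q n) = (focalY c k j - k j) * (\<eta> j)^2 + q j" using step by simp
    also have "\<dots> = - p * (\<eta> j)^2 + 2 * e j * \<eta> j * \<eta> (Suc j) + (c j - k (Suc j)) * (\<eta> (Suc j))^2"
      unfolding q_def p_def X_def by (simp add: algebra_simps)
    also have "\<dots> = (focalY c k (Suc j) - k (Suc j)) * (\<eta> (Suc j))^2"
      unfolding h fY using p by (simp add: field_simps power2_eq_square)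
    finally show ?case .
  qed
  have "(\<Sum>n<Suc m. q n) < 0" unfolding q_def using neg[of m \<eta>] less.prems \<eta>0 \<eta>m by blast
  moreover have "(\<Sum>n<Suc m. q n) = (focalY c k m - k m) + c m - k m"
    using part[of m] less.prems \<eta>m \<eta>0[of "Suc m"] by (simp add: q_def)
  ultimately show ?case by simp
qed

text \<open>At each bounce the mirror equation \<open>X n + Y n = 2 * k n\<close> and convexity
  bound the two focal distances from below. On each chord the outgoing distance and the next
  incoming one add up to the length by \<open>artanh_inverse_add\<close>. The first chord
  contributes only its incoming distance, since the beam starts at bounce 0, and the last incoming
  distance is dropped as nonnegative.\<close>

lemma focal_sum_le:
  fixes c e k :: "nat \<Rightarrow> real"
  assumes e2: "\<And>n. (c n)^2 - 1 = (e n)^2" and c: "\<And>n. c n > 1"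
    and neg: "\<And>m \<eta>. m \<ge> 1 \<Longrightarrow> (\<And>i. i = 0 \<or> i > m \<Longrightarrow> \<eta> i = 0) \<Longrightarrow> \<eta> m = 1 \<Longrightarrow>
       (\<Sum>n<Suc m. c n * ((\<eta> n)^2 + (\<eta> (Suc n))^2) + 2 * e n * \<eta> n * \<eta> (Suc n) - k n * (\<eta> n)^2 - k (Suc n) * (\<eta> (Suc n))^2) < 0"
    and N: "N \<ge> 1"
  shows "(\<Sum>n=1..<N. 2 * artanh (1 / k n)) \<le> (\<Sum>n<N. artanh (1 / c n))"
proof -
  have piv: "2 * k m - focalY c k m > c m" if "m \<ge> 1" for m
    by (rule focal_pivots[OF e2 _ that]) (rule neg)
  define Y where "Y = focalY c k"
  define X where "X n = 2 * k n - Y n" for n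
  have X: "X n > c n" if "n \<ge> 1" for n using piv[OF that] unfolding X_def Y_def .
  have Ystep: "Y (Suc n) = c n + ((c n)^2 - 1) / (X n - c n)" if "n \<ge> 1" for n
  proof -
    obtain n' where n': "n = Suc n'" using \<open>n \<ge> 1\<close> by (cases n) auto
    show ?thesis unfolding n' by (simp add: X_def Y_def)
  qed
  have Yc: "Y n > 1" if "n \<ge> 1" for n
  proof (cases "n = 1")
    case True then show ?thesis using c[of 0] by (simp add: Y_def)
  next
    case False
    then obtain n' where n': "n = Suc n'" "n' \<ge> 1" using \<open>n \<ge> 1\<close> by (cases n) auto
    show ?thesis unfolding n'(1) using artanh_inverse_add(2)[OF c X[OF n'(2)] Ystep[OF n'(2)]] c[of n'] by simp
  qed
  have "(\<Sum>n=1..<N. artanh (1 / X n) + artanh (1 / Y n)) + artanh (1 / Y N) = (\<Sum>n<N. artanh (1 / c n))"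
    using N
  proof (induction N rule: dec_induct)
    case base then show ?case by (simp add: Y_def)
  next
    case (step n)
    have "artanh (1 / X n) + artanh (1 / Y (Suc n)) = artanh (1 / c n)"
      using artanh_inverse_add(1)[OF c X Ystep] step by simp
    then show ?case using step by simp
  qed
  moreover have "(\<Sum>n=1..<N. 2 * artanh (1 / k n)) \<le> (\<Sum>n=1..<N. artanh (1 / X n) + artanh (1 / Y n))"
  proof (rule sum_mono)
    fix n assume "n \<in> {1..<N}"
    then have n: "n \<ge> 1" by simp
    have "X n > 1" using X[OF n] c[of n] by simp
    from artanh_inverse_midpoint[OF this Yc[OF n]]
    show "2 * artanh (1 / k n) \<le> artanh (1 / X n) + artanh (1 / Y n)" by (simp add: X_def)
  qed
  moreover have "artanh (1 / Y N) \<ge> 0" using Yc[OF N] by (intro artanh_nonneg) auto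
  ultimately show ?thesis by linarith
qed

text \<open>The set \<open>E\<close> is forward invariant, hence invariant up to a null set, so all terms of a Birkhoff sum have
  the same integral over \<open>E\<close>.\<close>

lemma bounded_birkhoff_integral_le:
  fixes u :: "'a \<Rightarrow> real" and K :: real
  assumes fin: "finite_measure M" and T: "T \<in> measurable M M" and inv: "distr M M T = M"
    and u[measurable]: "u \<in> borel_measurable M" and bnd: "\<And>p. p \<in> space M \<Longrightarrow> \<bar>u p\<bar> \<le> C"
  defines "E \<equiv> {p \<in> space M. \<forall>j N. (\<Sum>i<N. u ((T ^^ (j + i)) p)) \<le> K}"
  shows "E \<in> sets M" "(\<integral>p. indicator E p * u p \<partial>M) \<le> 0"
proof -
  interpret finite_measure M by (rule fin)
  have Tn[measurable]: "(T ^^ n) \<in> measurable M M" for n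
  proof (induction n)
    case (Suc n)
    then show ?case using measurable_comp[OF Suc T] by (simp add: comp_def)
  qed simp
  have Em: "E \<in> sets M" unfolding E_def by measurable
  then show "E \<in> sets M" .
  note Em[measurable] T[measurable]
  \<comment> \<open>Forward invariance is built into \<open>E\<close> by letting the starting time
    \<open>j\<close> of the sums vary.\<close>
  have ET: "T p \<in> E" if "p \<in> E" for p
  proof -
    have "(\<Sum>i<N. u ((T ^^ (j + i)) (T p))) \<le> K" for j N
    proof -
      have eq: "(T ^^ (j + i)) (T p) = (T ^^ (Suc j + i)) p" for i by (simp add: funpow_swap1)
      have "(\<Sum>i<N. u ((T ^^ (j + i)) (T p))) = (\<Sum>i<N. u ((T ^^ (Suc j + i)) p))"
        by (rule sum.cong[OF refl]) (simp only: eq)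
      moreover have "(\<Sum>i<N. u ((T ^^ (Suc j + i)) p)) \<le> K" using that unfolding E_def by blast
      ultimately show ?thesis by (simp only:)
    qed
    then show ?thesis using that measurable_space[OF T] by (auto simp: E_def)
  qed
  have invI: "(\<integral>p. f (T p) \<partial>M) = (\<integral>p. f p \<partial>M)" if "f \<in> borel_measurable M" for f :: "'a \<Rightarrow> real"
    using integral_distr[OF T that] unfolding inv by simp
  have bI: "integrable M f" if "f \<in> borel_measurable M" "\<And>p. p \<in> space M \<Longrightarrow> \<bar>f p\<bar> \<le> B" for f :: "'a \<Rightarrow> real" and B
    using that by (intro integrable_const_bound[of _ B]) (auto intro: AE_I2)
  have iE: "integrable M (indicator E :: 'a \<Rightarrow> real)" "integrable M (\<lambda>p. indicator E (T p) :: real)"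
    by (rule bI[of _ 1]; simp add: indicator_def)+
  \<comment> \<open>The difference of indicators integrates to zero by invariance of the measure and
    is nonnegative by \<open>ET\<close>, so it vanishes almost everywhere.\<close>
  have "(\<integral>p. indicator E (T p) - indicator E p \<partial>M) = (0::real)"
    using invI[of "indicator E"] iE by (simp add: Bochner_Integration.integral_diff)
  moreover have "AE p in M. 0 \<le> indicator E (T p) - (indicator E p :: real)"
    using ET by (intro AE_I2) (auto simp: indicator_def)
  ultimately have AE: "AE p in M. indicator E (T p) - (indicator E p :: real) = 0"
    using iE by (subst (asm) integral_nonneg_eq_0_iff_AE) auto
  have Tsp: "(T ^^ n) p \<in> space M" if "p \<in> space M" for n p using measurable_space[OF Tn that] .
  define a where "a n = (\<integral>p. indicator E p * u ((T ^^ n) p) \<partial>M)" for n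
  have step: "a (Suc n) = a n" for n
  proof -
    have "a (Suc n) = (\<integral>p. indicator E (T p) * u ((T ^^ n) (T p)) \<partial>M)"
      unfolding a_def
    proof (rule integral_cong_AE)
      show "AE p in M. indicator E p * u ((T ^^ Suc n) p) = indicator E (T p) * u ((T ^^ n) (T p))"
        using AE by eventually_elim (simp add: funpow_swap1)
    qed measurable
    also have "\<dots> = a n" unfolding a_def by (rule invI) measurable
    finally show ?thesis .
  qed
  then have an: "a n = a 0" for n by (induction n) auto
  have iu: "integrable M (\<lambda>p. indicator E p * u ((T ^^ n) p))" for n
  proof (rule bI[of _ "\<bar>C\<bar>"])
    fix p assume "p \<in> space M"
    from bnd[OF Tsp[OF this, of n]] show "\<bar>indicator E p * u ((T ^^ n) p)\<bar> \<le> \<bar>C\<bar>"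
      by (auto simp: indicator_def)
  qed measurable
  \<comment> \<open>All \<open>N\<close> terms have the same integral \<open>a 0\<close>, while
    their sum is bounded on \<open>E\<close> independently of \<open>N\<close>; letting
    \<open>N\<close> grow leaves \<open>a 0 \<le> 0\<close>.\<close>
  have "real N * a 0 \<le> \<bar>K\<bar> * measure M (space M)" for N
  proof -
    have "(\<Sum>i<N. a i) = (\<Sum>i<N. a 0)" by (intro sum.cong an refl)
    then have "real N * a 0 = (\<Sum>i<N. a i)" by simp
    also have "\<dots> = (\<integral>p. (\<Sum>i<N. indicator E p * u ((T ^^ i) p)) \<partial>M)"
      unfolding a_def using iu by (intro Bochner_Integration.integral_sum[symmetric]) auto
    also have "\<dots> \<le> (\<integral>p. \<bar>K\<bar> \<partial>M)"
    proof (rule integral_mono)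
      show "integrable M (\<lambda>p. \<Sum>i<N. indicator E p * u ((T ^^ i) p))"
        by (intro Bochner_Integration.integrable_sum iu)
      fix p assume "p \<in> space M"
      show "(\<Sum>i<N. indicator E p * u ((T ^^ i) p)) \<le> \<bar>K\<bar>"
      proof (cases "p \<in> E")
        case True
        then have "(\<Sum>i<N. u ((T ^^ (0 + i)) p)) \<le> K" unfolding E_def by blast
        then show ?thesis using True by simp
      qed simp
    qed simp
    finally show ?thesis by (simp add: mult.commute)
  qed
  note key = this
  have "a 0 \<le> 0"
  proof (rule ccontr)
    assume "\<not> a 0 \<le> 0"
    then obtain N :: nat where "real N * a 0 > \<bar>K\<bar> * measure M (space M)" using ex_less_of_nat_mult[of "a 0"] by auto
    then show False using key[of N] by simp
  qed
  then show "(\<integral>p. indicator E p * u p \<partial>M) \<le> 0" by (simp add: a_def)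
qed

text \<open>Integration by parts leaves a rational function of sine and cosine whose usual primitive
  contains \<open>arctan (s * tan \<phi>)\<close>, which jumps at \<open>pi / 2\<close>. The
  quotient with denominator \<open>D\<close> is the tangent of
  \<open>\<phi> - arctan (s * tan \<phi>)\<close>, so the arctangent in \<open>F\<close> is smooth
  on the whole interval.\<close>

lemma artanh_sin_integral:
  fixes c :: real
  assumes c: "0 < c" "c < 1"
  shows "((\<lambda>\<phi>. artanh (c * sin \<phi>) * sin \<phi>) has_integral (pi * (1 - sqrt (1 - c^2)) / c)) {0..pi}"
proof -
  define s where "s = sqrt (1 - c^2)"
  have c2: "c^2 < 1" using c by (simp add: abs_square_less_1)
  have s: "s > 0" "s^2 = 1 - c^2" using c2 by (auto simp: s_def)
  define D where "D \<phi> = (cos \<phi>)^2 + s * (sin \<phi>)^2" for \<phi>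
  have D: "D \<phi> > 0" for \<phi>
    unfolding D_def using s sin_cos_squared_add[of \<phi>] by (cases "cos \<phi> = 0") (auto intro: add_pos_nonneg)
  define F where "F \<phi> = - cos \<phi> * artanh (c * sin \<phi>) + (1 / c) * (\<phi> - s * \<phi> + s * arctan ((1 - s) * sin \<phi> * cos \<phi> / D \<phi>))" for \<phi>
  have "((\<lambda>\<phi>. artanh (c * sin \<phi>) * sin \<phi>) has_integral (F pi - F 0)) {0..pi}"
  proof (rule fundamental_theorem_of_calculus)
    fix \<phi> :: real
    let ?x = "sin \<phi>" and ?y = "cos \<phi>"
    have xy: "?y^2 = 1 - ?x^2" by (simp add: cos_squared_eq)
    have ab: "\<bar>c * ?x\<bar> < 1"
    proof -
      have "\<bar>c * ?x\<bar> \<le> c * 1" using c abs_sin_le_one[of \<phi>] by (simp add: abs_mult)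
      then show ?thesis using c by linarith
    qed
    then have q: "1 - (c * ?x)^2 > 0" by (simp add: abs_square_less_1)
    have d1: "((\<lambda>\<phi>. artanh (c * sin \<phi>)) has_real_derivative (1 / (1 - (c * ?x)^2) * (c * ?y))) (at \<phi>)"
      by (rule DERIV_chain2[where f=artanh and g="\<lambda>\<phi>. c * sin \<phi>", OF artanh_real_has_field_derivative[OF ab]]) (auto intro!: derivative_eq_intros)
    have dD: "(D has_real_derivative (- 2 * (1 - s) * ?x * ?y)) (at \<phi>)"
      unfolding D_def by (auto intro!: derivative_eq_intros simp: algebra_simps)
    have dn: "((\<lambda>\<phi>. (1 - s) * sin \<phi> * cos \<phi>) has_real_derivative ((1 - s) * (?y^2 - ?x^2))) (at \<phi>)"
      by (auto intro!: derivative_eq_intros simp: algebra_simps power2_eq_square)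
    define R where "R = (1 - s) * ?x * ?y / D \<phi>"
    have dR: "((\<lambda>\<phi>. (1 - s) * sin \<phi> * cos \<phi> / D \<phi>) has_real_derivative
       (((1 - s) * (?y^2 - ?x^2)) * D \<phi> - ((1 - s) * ?x * ?y) * (- 2 * (1 - s) * ?x * ?y)) / (D \<phi> * D \<phi>)) (at \<phi>)"
      by (rule DERIV_divide[OF dn dD]) (use D[of \<phi>] in simp)
    have dA: "((\<lambda>\<phi>. arctan ((1 - s) * sin \<phi> * cos \<phi> / D \<phi>)) has_real_derivative (1 - s / (1 - (c * ?x)^2))) (at \<phi>)"
    proof -
      have 1: "((\<lambda>\<phi>. arctan ((1 - s) * sin \<phi> * cos \<phi> / D \<phi>)) has_real_derivative
        (inverse (1 + R^2) * ((((1 - s) * (?y^2 - ?x^2)) * D \<phi> - ((1 - s) * ?x * ?y) * (- 2 * (1 - s) * ?x * ?y)) / (D \<phi> * D \<phi>)))) (at \<phi>)"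
        unfolding R_def by (rule DERIV_chain2[where f=arctan, OF DERIV_arctan dR])
      have a: "(D \<phi>)^2 + ((1 - s) * ?x * ?y)^2 = 1 - (c * ?x)^2"
      proof -
        have "(D \<phi>)^2 + ((1 - s) * ?x * ?y)^2 = (?y^2)^2 + (1 + s^2) * (?x^2 * ?y^2) + s^2 * (?x^2)^2"
          unfolding D_def by (simp add: algebra_simps power2_eq_square)
        also have "\<dots> = 1 - (1 - s^2) * ?x^2" unfolding xy by (simp add: algebra_simps power2_eq_square)
        also have "\<dots> = 1 - (c * ?x)^2" unfolding s(2) by (simp add: power_mult_distrib)
        finally show ?thesis .
      qed
      have b: "((1 - s) * (?y^2 - ?x^2)) * D \<phi> - ((1 - s) * ?x * ?y) * (- 2 * (1 - s) * ?x * ?y) = (1 - (c * ?x)^2) - s"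
      proof -
        have "((1 - s) * (?y^2 - ?x^2)) * D \<phi> - ((1 - s) * ?x * ?y) * (- 2 * (1 - s) * ?x * ?y)
          = (1 - s) * ((?y^2 - ?x^2) * (?y^2 + s * ?x^2) + 2 * (1 - s) * ?x^2 * ?y^2)"
          unfolding D_def by (simp add: algebra_simps power2_eq_square)
        also have "\<dots> = (1 - s) * (1 - (1 + s) * ?x^2)" unfolding xy by (simp add: algebra_simps power2_eq_square)
        also have "\<dots> = 1 - s - (1 - s^2) * ?x^2" by (simp add: algebra_simps power2_eq_square)
        finally show ?thesis unfolding s(2) by (simp add: power_mult_distrib)
      qed
      have "1 + R^2 = (1 - (c * ?x)^2) / (D \<phi>)^2"
        unfolding R_def a[symmetric] using D[of \<phi>] by (simp add: power_divide add_divide_distrib)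
      moreover have gen: "inverse (Q / d) * ((Q - s) / d) = 1 - s / Q" if "Q > 0" "d > 0" for Q d
        using that by (simp add: field_simps)
      ultimately have 2: "inverse (1 + R^2) * (((1 - (c * ?x)^2) - s) / (D \<phi> * D \<phi>)) = 1 - s / (1 - (c * ?x)^2)"
        using gen[OF q, of "(D \<phi>)^2"] D[of \<phi>] by (simp only: power2_eq_square zero_less_mult_iff) auto
      from 1 show ?thesis unfolding b 2 .
    qed
    have "(F has_real_derivative ((- ?y) * (1 / (1 - (c * ?x)^2) * (c * ?y)) + ?x * artanh (c * ?x)
       + (1 / c) * (1 - s + s * (1 - s / (1 - (c * ?x)^2))))) (at \<phi>)"
    proof -
      define A1 where "A1 \<phi> = artanh (c * sin \<phi>)" for \<phi>
      define B1 where "B1 \<phi> = arctan ((1 - s) * sin \<phi> * cos \<phi> / D \<phi>)" for \<phi>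
      have F: "F = (\<lambda>\<phi>. - cos \<phi> * A1 \<phi> + (1 / c) * (\<phi> - s * \<phi> + s * B1 \<phi>))"
        by (simp add: F_def A1_def B1_def fun_eq_iff)
      note d = d1[folded A1_def] dA[folded B1_def]
      have "((\<lambda>\<phi>. - cos \<phi>) has_real_derivative ?x) (at \<phi>)" by (auto intro!: derivative_eq_intros)
      from DERIV_mult[OF this d(1)]
      have 1: "((\<lambda>\<phi>. - cos \<phi> * A1 \<phi>) has_real_derivative ((- ?y) * (1 / (1 - (c * ?x)^2) * (c * ?y)) + ?x * artanh (c * ?x))) (at \<phi>)"
        by (simp add: A1_def mult.commute add.commute)
      have "((\<lambda>\<phi>. \<phi> - s * \<phi>) has_real_derivative (1 - s)) (at \<phi>)" by (auto intro!: derivative_eq_intros)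
      from DERIV_cmult[OF DERIV_add[OF this DERIV_cmult[OF d(2), of s]], of "1 / c"]
      show ?thesis unfolding F by (rule DERIV_add[OF 1])
    qed
    moreover have "(- ?y) * (1 / (1 - (c * ?x)^2) * (c * ?y)) + (1 / c) * (1 - s + s * (1 - s / (1 - (c * ?x)^2))) = 0"
    proof -
      define Q where "Q = 1 - (c * ?x)^2"
      have Q: "Q > 0" "c^2 * ?y^2 = c^2 - 1 + Q" using q unfolding Q_def xy by (auto simp: algebra_simps power_mult_distrib)
      have "c * ((- ?y) * (1 / Q * (c * ?y)) + (1 / c) * (1 - s + s * (1 - s / Q))) = - (c^2 * ?y^2) / Q + (1 - s^2 / Q)"
        using c Q by (simp add: field_simps power2_eq_square)
      also have "\<dots> = 0" unfolding Q(2) s(2) using Q(1) by (simp add: field_simps)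
      finally show ?thesis using c unfolding Q_def by simp
    qed
    ultimately have "(F has_real_derivative (artanh (c * ?x) * ?x)) (at \<phi>)"
      by (simp add: algebra_simps)
    then show "(F has_vector_derivative artanh (c * ?x) * ?x) (at \<phi> within {0..pi})"
      by (simp add: has_real_derivative_iff_has_vector_derivative has_vector_derivative_at_within)
  qed simp
  moreover have "F pi - F 0 = pi * (1 - s) / c" by (simp add: F_def algebra_simps diff_divide_distrib)
  ultimately show ?thesis by (simp add: s_def)
qed

section \<open>The second variation of length\<close>

text \<open>Total differentiability reduces the derivative along a line to the two partial
  derivatives, which the one-endpoint formulas supply.\<close>

lemma line_deriv:
  fixes F :: "real \<times> real \<Rightarrow> 'b::real_normed_vector"
  assumes F: "F differentiable (at (x0 + t * a, y0 + t * b))"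
    and d1: "((\<lambda>r. F (r, y0 + t * b)) has_vector_derivative D1) (at (x0 + t * a))"
    and d2: "((\<lambda>r. F (x0 + t * a, r)) has_vector_derivative D2) (at (y0 + t * b))"
  shows "((\<lambda>t. F (x0 + t * a, y0 + t * b)) has_vector_derivative (a *\<^sub>R D1 + b *\<^sub>R D2)) (at t)"
proof -
  define x where "x = x0 + t * a"
  define y where "y = y0 + t * b"
  obtain F' where F': "(F has_derivative F') (at (x, y))" using F unfolding differentiable_def x_def y_def by blast
  then have lin: "linear F'" by (rule has_derivative_linear)
  have "((\<lambda>r. (r, y)) has_derivative (\<lambda>h. (h, 0))) (at x)" by (auto intro!: derivative_eq_intros)
  from has_derivative_compose[OF this F'] have "((\<lambda>r. F (r, y)) has_derivative (\<lambda>h. F' (h, 0))) (at x)" .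
  moreover have "(\<lambda>h. F' (h, 0)) = (\<lambda>h. h *\<^sub>R F' (1, 0))"
  proof (rule ext)
    fix h show "F' (h, 0) = h *\<^sub>R F' (1, 0)" using linear_scale[OF lin, of h "(1, 0)"] by simp
  qed
  ultimately have "((\<lambda>r. F (r, y)) has_vector_derivative F' (1, 0)) (at x)" unfolding has_vector_derivative_def by (simp only:)
  then have D1: "D1 = F' (1, 0)" using d1 unfolding x_def[symmetric] y_def[symmetric] by (rule vector_derivative_unique_at[rotated])
  have "((\<lambda>r. (x, r)) has_derivative (\<lambda>h. (0, h))) (at y)" by (auto intro!: derivative_eq_intros)
  from has_derivative_compose[OF this F'] have "((\<lambda>r. F (x, r)) has_derivative (\<lambda>h. F' (0, h))) (at y)" .
  moreover have "(\<lambda>h. F' (0, h)) = (\<lambda>h. h *\<^sub>R F' (0, 1))"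
  proof (rule ext)
    fix h show "F' (0, h) = h *\<^sub>R F' (0, 1)" using linear_scale[OF lin, of h "(0, 1)"] by simp
  qed
  ultimately have "((\<lambda>r. F (x, r)) has_vector_derivative F' (0, 1)) (at y)" unfolding has_vector_derivative_def by (simp only:)
  then have D2: "D2 = F' (0, 1)" using d2 unfolding x_def[symmetric] y_def[symmetric] by (rule vector_derivative_unique_at[rotated])
  have "((\<lambda>t. (x0 + t * a, y0 + t * b)) has_derivative (\<lambda>h. (h * a, h * b))) (at t)" by (auto intro!: derivative_eq_intros)
  from has_derivative_compose[OF this F'[unfolded x_def y_def]]
  have "((\<lambda>t. F (x0 + t * a, y0 + t * b)) has_derivative (\<lambda>h. F' (h * a, h * b))) (at t)" .
  moreover have "F' (h * a, h * b) = h *\<^sub>R (a *\<^sub>R D1 + b *\<^sub>R D2)" for h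
  proof -
    have "(h * a, h * b) = (h * a) *\<^sub>R (1, 0) + (h * b) *\<^sub>R (0, 1 :: real)" by simp
    then show ?thesis unfolding D1 D2 by (simp only: linear_add[OF lin] linear_scale[OF lin] scaleR_add_right scaleR_scaleR)
  qed
  ultimately show ?thesis by (simp add: has_vector_derivative_def)
qed

text \<open>For \<open>C = cosh L\<close> the argument of \<open>artanh\<close> is
  \<open>tanh L\<close>. This recovers the chord length from its hyperbolic cotangent.\<close>

lemma artanh_eq_arcosh:
  fixes C :: real
  assumes "C > 1"
  shows "artanh (sqrt (C^2 - 1) / C) = arcosh C"
proof -
  define S where "S = sqrt (C^2 - 1)"
  have "C^2 > 1" using assms by simp
  then have S: "S > 0" "S^2 = C^2 - 1" by (auto simp: S_def)
  have p: "(C + S) * (C - S) = 1" using S(2) by (simp add: algebra_simps power2_eq_square)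
  then have cs: "C - S > 0" using assms S(1) by (metis add_pos_pos less_trans zero_less_mult_pos zero_less_one)
  have "(1 + S / C) / (1 - S / C) = (C + S) / (C - S)" using assms cs by (simp add: field_simps)
  also have "\<dots> = (C + S) * ((C + S) * (C - S)) / (C - S)" unfolding p by simp
  also have "\<dots> = (C + S)^2" using cs by (simp add: power2_eq_square)
  finally have "artanh (S / C) = ln ((C + S)^2) / 2" by (simp add: artanh_def)
  also have "\<dots> = ln (C + S)" using assms S by (simp add: ln_realpow)
  finally show ?thesis using assms by (simp add: S_def arcosh_real_def)
qed

context hyp_curve
begin

lemma g_differentiable: "g differentiable (at t)" and u_differentiable: "u differentiable (at t)"
  using smooth[of 0 t] u_deriv[of t] by (auto intro: differentiableI_vector)

lemma cnj_differentiable: "f differentiable (at x) \<Longrightarrow> (\<lambda>x. cnj (f x)) differentiable (at x)"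
  by (rule differentiable_compose[of cnj]) (auto intro: bounded_linear_imp_differentiable bounded_linear_cnj)

lemma fst_snd_differentiable: "(fst :: real \<times> real \<Rightarrow> real) differentiable (at p)" "(snd :: real \<times> real \<Rightarrow> real) differentiable (at p)"
  by (auto intro: bounded_linear_imp_differentiable bounded_linear_fst bounded_linear_snd)

lemma dir_differentiable: "(\<lambda>p. dir (fst p) (snd p)) differentiable (at p)"
proof -
  note c = differentiable_compose[OF g_differentiable fst_snd_differentiable(1)] differentiable_compose[OF g_differentiable fst_snd_differentiable(2)]
    differentiable_compose[OF u_differentiable fst_snd_differentiable(1)]
  have nz: "(1 - g (snd p) * cnj (g (snd p))) * (1 - g (fst p) * cnj (g (fst p))) \<noteq> 0" using den_nz by (simp only: mult_eq_0_iff) blast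
  show ?thesis unfolding polar_dir_def
    by (intro differentiable_divide differentiable_mult differentiable_diff differentiable_const cnj_differentiable c nz)
qed

lemma cosh_dist_differentiable: "(\<lambda>p. complex_of_real (cosh_dist (g (fst p)) (g (snd p)))) differentiable (at p)"
proof -
  note c = differentiable_compose[OF g_differentiable fst_snd_differentiable(1)] differentiable_compose[OF g_differentiable fst_snd_differentiable(2)]
  have nz: "(1 - g (fst p) * cnj (g (fst p))) * (1 - g (snd p) * cnj (g (snd p))) \<noteq> 0" using den_nz by (simp only: mult_eq_0_iff) blast
  show ?thesis unfolding of_real_cosh_dist
    by (intro differentiable_add differentiable_divide differentiable_mult differentiable_diff differentiable_const cnj_differentiable c nz)
qed

lemma cosh_dist_line:
  "((\<lambda>t. cosh_dist (g (x + t * a)) (g (y + t * b))) has_real_derivative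
     (- a * Re (dir (x + t * a) (y + t * b)) - b * Re (dir (y + t * b) (x + t * a)))) (at t)"
proof -
  have 1: "((\<lambda>r. complex_of_real (cosh_dist (g (fst (r, y + t * b))) (g (snd (r, y + t * b))))) has_vector_derivative of_real (- Re (dir (x + t * a) (y + t * b)))) (at (x + t * a))"
    using cosh_dist_deriv_complex[OF in_disc[of "y + t * b"], of "x + t * a"] by (simp add: cosh_dist_commute)
  have 2: "((\<lambda>r. complex_of_real (cosh_dist (g (fst (x + t * a, r))) (g (snd (x + t * a, r))))) has_vector_derivative of_real (- Re (dir (y + t * b) (x + t * a)))) (at (y + t * b))"
    using cosh_dist_deriv_complex[OF in_disc[of "x + t * a"], of "y + t * b"] by simp
  from has_vector_derivative_Re[OF line_deriv[OF cosh_dist_differentiable 1 2]]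
  show ?thesis by (simp add: has_real_derivative_iff_has_vector_derivative)
qed

text \<open>First variation of length: the rate of \<open>cosh L\<close> divided by
  \<open>sinh L\<close>. Both angles are measured from the forward tangent, hence the equal signs at
  the two ends.\<close>

lemma Lgen_line:
  assumes ne: "g (y + t * b) \<noteq> g (x + t * a)"
  shows "((\<lambda>t. Lgen g (x + t * a) (y + t * b)) has_real_derivative
     (- a * cos (chord_angle g (x + t * a) (y + t * b)) - b * cos (chord_angle g (y + t * b) (x + t * a)))) (at t)"
proof -
  let ?X = "x + t * a" and ?Y = "y + t * b"
  have C: "cosh_dist (g ?X) (g ?Y) > 1" using cosh_dist_gt_1[OF in_disc in_disc] ne by metis
  have s: "sqrt ((cosh_dist (g ?X) (g ?Y))^2 - 1) = cmod (dir ?X ?Y)"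
    using polar_dir_norm2[OF in_disc[of ?Y], of ?X] by (metis cosh_dist_commute norm_ge_zero real_sqrt_unique)
  have "((\<lambda>t. arcosh (cosh_dist (g (x + t * a)) (g (y + t * b)))) has_real_derivative
     (1 / sqrt ((cosh_dist (g ?X) (g ?Y))^2 - 1) * (- a * Re (dir ?X ?Y) - b * Re (dir ?Y ?X)))) (at t)"
    by (rule DERIV_chain2[where f=arcosh, OF arcosh_real_has_field_derivative[OF C] cosh_dist_line])
  moreover have "1 / sqrt ((cosh_dist (g ?X) (g ?Y))^2 - 1) * (- a * Re (dir ?X ?Y) - b * Re (dir ?Y ?X))
     = - a * cos (chord_angle g ?X ?Y) - b * cos (chord_angle g ?Y ?X)"
    unfolding s cos_chord_angle[OF ne] cos_chord_angle[OF ne[symmetric]] norm_dir_commute[where x="?Y" and y="?X"]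
    by (simp add: diff_divide_distrib)
  ultimately show ?thesis by (simp only: Lgen_def hdist_eq)
qed

lemma chord_angle_line:
  assumes ne: "g y \<noteq> g x"
  shows "((\<lambda>t. chord_angle g (x + t * a) (y + t * b)) has_real_derivative
     (a * (cosh_dist (g x) (g y) * Im (dir x y) / (cmod (dir x y))^2 - \<kappa> x) + b * (Im (dir y x) / (cmod (dir y x))^2))) (at 0)"
proof -
  obtain F' where F': "((\<lambda>p. dir (fst p) (snd p)) has_derivative F') (at (x, y))"
    using dir_differentiable[of "(x, y)"] unfolding differentiable_def by blast
  have "((\<lambda>r. (x, r)) has_derivative (\<lambda>h. (0, h))) (at y)" by (auto intro!: derivative_eq_intros)
  from has_derivative_compose[OF this F'] have "((\<lambda>r. dir x r) has_derivative (\<lambda>h. F' (0, h))) (at y)" by simp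
  moreover have "(\<lambda>h. F' (0, h)) = (\<lambda>h. h *\<^sub>R F' (0, 1))"
  proof (rule ext)
    fix h show "F' (0, h) = h *\<^sub>R F' (0, 1)" using linear_scale[OF has_derivative_linear[OF F'], of h "(0, 1)"] by simp
  qed
  ultimately have d2: "((\<lambda>r. dir x r) has_vector_derivative F' (0, 1)) (at y)" unfolding has_vector_derivative_def by (simp only:)
  define D1 where "D1 = - of_real (cosh_dist (g y) (g x)) - \<i> * \<kappa> x * dir x y"
  have d1: "((\<lambda>r. dir r y) has_vector_derivative D1) (at x)"
    unfolding D1_def by (rule polar_dir_deriv[OF in_disc])
  have pos: "Im (dir x y) > 0" using dir_pos[OF ne] .
  have a1: "Im (D1 / dir x y) = cosh_dist (g x) (g y) * Im (dir x y) / (cmod (dir x y))^2 - \<kappa> x"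
    using DERIV_unique[OF has_real_derivative_Arg[OF d1 pos]] chord_angle_deriv1[OF ne] by (simp add: chord_angle_eq[abs_def])
  \<comment> \<open>The partial derivative of \<open>dir\<close> in the far endpoint enters only
    through this imaginary part, which uniqueness of derivatives identifies with the rate of the
    chord angle found earlier.\<close>
  have a2: "Im (F' (0, 1) / dir x y) = Im (dir y x) / (cmod (dir y x))^2"
    using DERIV_unique[OF has_real_derivative_Arg[OF d2 pos]] chord_angle_deriv2[OF ne] by (simp add: chord_angle_eq[abs_def])
  have "((\<lambda>t. (\<lambda>p. dir (fst p) (snd p)) (x + t * a, y + t * b)) has_vector_derivative (a *\<^sub>R D1 + b *\<^sub>R F' (0, 1))) (at 0)"
    by (rule line_deriv) (use d1 d2 dir_differentiable in auto)
  from has_real_derivative_Arg[OF this] pos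
  have "((\<lambda>t. Arg (dir (x + t * a) (y + t * b))) has_real_derivative Im ((a *\<^sub>R D1 + b *\<^sub>R F' (0, 1)) / dir x y)) (at 0)" by simp
  moreover have "Im ((a *\<^sub>R D1 + b *\<^sub>R F' (0, 1)) / dir x y) = a * Im (D1 / dir x y) + b * Im (F' (0, 1) / dir x y)"
  proof -
    have "(a *\<^sub>R D1 + b *\<^sub>R F' (0, 1)) / dir x y = of_real a * (D1 / dir x y) + of_real b * (F' (0, 1) / dir x y)"
      by (simp add: scaleR_conv_of_real add_divide_distrib)
    then show ?thesis by (simp only: plus_complex.sel times_complex.sel Re_complex_of_real Im_complex_of_real mult_zero_left add_0_right)
  qed
  ultimately show ?thesis unfolding a1 a2 by (simp only: chord_angle_eq)
qed

text \<open>The second variation of one chord in the transversal displacements \<open>a * s1\<close>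
  and \<open>b * s2\<close>. The coefficients are \<open>coth L\<close>, \<open>1 / sinh L\<close>
  and the curvature divided by the sine of the angle, as in the quadratic form of
  \<open>focal_pivots\<close>.\<close>

definition chord_hessian :: "real \<Rightarrow> real \<Rightarrow> real \<Rightarrow> real \<Rightarrow> real" where
  "chord_hessian x y a b = (let s1 = sin (chord_angle g x y); s2 = sin (chord_angle g y x); S = cmod (dir x y); c = cosh_dist (g x) (g y) / S in
     c * ((a * s1)^2 + (b * s2)^2) + 2 * (1 / S) * (a * s1) * (b * s2) - \<kappa> x / s1 * (a * s1)^2 - \<kappa> y / s2 * (b * s2)^2)"

lemma Lgen_line2:
  assumes ne: "g y \<noteq> g x"
  shows "((\<lambda>t. - a * cos (chord_angle g (x + t * a) (y + t * b)) - b * cos (chord_angle g (y + t * b) (x + t * a))) has_real_derivative chord_hessian x y a b) (at 0)"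
proof -
  define S where "S = cmod (dir x y)"
  define s1 where "s1 = sin (chord_angle g x y)"
  define s2 where "s2 = sin (chord_angle g y x)"
  define C where "C = cosh_dist (g x) (g y)"
  have S: "S > 0" unfolding S_def using norm_dir_pos[OF ne] .
  have s: "s1 > 0" "s2 > 0" unfolding s1_def s2_def
    using chord_angle_bounds[OF ne] chord_angle_bounds[OF ne[symmetric]] by (auto intro: sin_gt_zero)
  have S': "cmod (dir y x) = S" unfolding S_def using norm_dir_commute[where x=y and y=x] .
  have i1: "Im (dir x y) = S * s1" unfolding s1_def sin_chord_angle[OF ne] S_def using S S_def by simp
  have i2: "Im (dir y x) = S * s2" unfolding s2_def sin_chord_angle[OF ne[symmetric]] S' using S by simp
  have d1: "((\<lambda>t. chord_angle g (x + t * a) (y + t * b)) has_real_derivative (a * (C * s1 / S - \<kappa> x) + b * (s2 / S))) (at 0)"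
    using chord_angle_line[OF ne, of a b] S unfolding i1 i2 S' C_def[symmetric] unfolding S_def[symmetric] by (simp add: power2_eq_square)
  have d2: "((\<lambda>t. chord_angle g (y + t * b) (x + t * a)) has_real_derivative (b * (C * s2 / S - \<kappa> y) + a * (s1 / S))) (at 0)"
    using chord_angle_line[OF ne[symmetric], of b a] S unfolding i1 i2 S' cosh_dist_commute[of "g y"] C_def[symmetric] unfolding S_def[symmetric] by (simp add: power2_eq_square)
  have c1: "((\<lambda>t. cos (chord_angle g (x + t * a) (y + t * b))) has_real_derivative (- s1 * (a * (C * s1 / S - \<kappa> x) + b * (s2 / S)))) (at 0)"
    using DERIV_chain2[where f=cos, OF DERIV_cos d1] by (simp add: s1_def)
  have c2: "((\<lambda>t. cos (chord_angle g (y + t * b) (x + t * a))) has_real_derivative (- s2 * (b * (C * s2 / S - \<kappa> y) + a * (s1 / S)))) (at 0)"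
    using DERIV_chain2[where f=cos, OF DERIV_cos d2] by (simp add: s2_def)
  have "(- a) * (- s1 * (a * (C * s1 / S - \<kappa> x) + b * (s2 / S))) - b * (- s2 * (b * (C * s2 / S - \<kappa> y) + a * (s1 / S))) = chord_hessian x y a b"
    unfolding chord_hessian_def Let_def s1_def[symmetric] s2_def[symmetric] S_def[symmetric] C_def[symmetric] using S s by (simp add: field_simps power2_eq_square)
  with DERIV_diff[OF DERIV_cmult[OF c1, of "- a"] DERIV_cmult[OF c2, of b]] show ?thesis by (simp only:)
qed

text \<open>To differentiate twice, the first derivative must be known in a neighbourhood of 0; it
  is, because finitely many pairs of consecutive bounces stay distinct for small
  \<open>t\<close>.\<close>

lemma action_second_variation:
  assumes ne: "\<And>n. g (xs (n + 1)) \<noteq> g (xs n)"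
  shows "deriv (deriv (\<lambda>t. action g (\<lambda>n. xs n + t * v n) M N)) 0 = (\<Sum>n\<in>{M..<N}. chord_hessian (xs n) (xs (n + 1)) (v n) (v (n + 1)))"
proof -
  define f1 where "f1 n t = - v n * cos (chord_angle g (xs n + t * v n) (xs (n + 1) + t * v (n + 1)))
     - v (n + 1) * cos (chord_angle g (xs (n + 1) + t * v (n + 1)) (xs n + t * v n))" for n :: int and t :: real
  have ev1: "eventually (\<lambda>t. g (xs (n + 1) + t * v (n + 1)) \<noteq> g (xs n + t * v n)) (nhds 0)" for n
  proof -
    have c: "continuous_on UNIV (\<lambda>t. g (xs (n + 1) + t * v (n + 1)) - g (xs n + t * v n))"
      by (intro continuous_intros continuous_on_compose2[OF g_cont[of UNIV]]) auto
    have "open {t. g (xs (n + 1) + t * v (n + 1)) - g (xs n + t * v n) \<noteq> 0}"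
      by (rule open_Collect_neq[OF c]) (intro continuous_intros)
    then have "eventually (\<lambda>t. t \<in> {t. g (xs (n + 1) + t * v (n + 1)) - g (xs n + t * v n) \<noteq> 0}) (nhds 0)"
      by (rule eventually_nhds_in_open) (use ne in simp)
    then show ?thesis by eventually_elim simp
  qed
  have ev: "eventually (\<lambda>t. \<forall>n\<in>{M..<N}. g (xs (n + 1) + t * v (n + 1)) \<noteq> g (xs n + t * v n)) (nhds 0)"
    by (rule eventually_ball_finite) (use ev1 in auto)
  have d: "eventually (\<lambda>t. deriv (\<lambda>t. action g (\<lambda>n. xs n + t * v n) M N) t = (\<Sum>n\<in>{M..<N}. f1 n t)) (nhds 0)"
    using ev
  proof eventually_elim
    case (elim t)
    have "((\<lambda>t. action g (\<lambda>n. xs n + t * v n) M N) has_real_derivative (\<Sum>n\<in>{M..<N}. f1 n t)) (at t)"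
      unfolding action_def f1_def by (rule DERIV_sum) (use Lgen_line elim in blast)
    then show ?case by (rule DERIV_imp_deriv)
  qed
  have "((\<lambda>t. \<Sum>n\<in>{M..<N}. f1 n t) has_real_derivative (\<Sum>n\<in>{M..<N}. chord_hessian (xs n) (xs (n + 1)) (v n) (v (n + 1)))) (at 0)"
    unfolding f1_def by (rule DERIV_sum) (rule Lgen_line2[OF ne])
  then have "(deriv (\<lambda>t. action g (\<lambda>n. xs n + t * v n) M N) has_real_derivative (\<Sum>n\<in>{M..<N}. chord_hessian (xs n) (xs (n + 1)) (v n) (v (n + 1)))) (at 0)"
    by (rule iffD2[OF DERIV_cong_ev[OF refl d refl]])
  then show ?thesis by (rule DERIV_imp_deriv)
qed

text \<open>The reflection law makes the two sines at a bounce equal, so displacements rescaled by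
  the sine turn the second variation into the form of \<open>focal_pivots\<close>. There is one
  bounce fewer than there are chords, since the beam starts at bounce \<open>j\<close>
  itself.\<close>

lemma m_conf_sum_le:
  assumes m: "m_conf g P xs" and N: "N \<ge> 1"
  shows "(\<Sum>n=1..<N. 2 * artanh (sin (chord_angle g (xs (j + int n)) (xs (j + int n + 1))) / \<kappa> (xs (j + int n))))
     \<le> (\<Sum>n<N. Lgen g (xs (j + int n)) (xs (j + int n + 1)))"
proof -
  have ne: "g (xs (n + 1)) \<noteq> g (xs n)" and refl: "chord_angle g (xs n) (xs (n + 1)) = pi - chord_angle g (xs n) (xs (n - 1))" for n
    using m by (auto simp: m_conf_def billiard_conf_def)
  define S where "S n = sin (chord_angle g (xs n) (xs (n + 1)))" for n :: int
  define D where "D n = cmod (dir (xs n) (xs (n + 1)))" for n :: int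
  define C where "C n = cosh_dist (g (xs n)) (g (xs (n + 1)))" for n :: int
  have S: "S n > 0" for n unfolding S_def using chord_angle_bounds[OF ne] by (intro sin_gt_zero) auto
  have S2: "sin (chord_angle g (xs (n + 1)) (xs n)) = S (n + 1)" for n
    using refl[of "n + 1"] by (simp add: S_def)
  have C: "C n > 1" for n unfolding C_def using cosh_dist_gt_1[OF in_disc in_disc] ne by metis
  have D: "D n > 0" "(D n)^2 = (C n)^2 - 1" for n
    unfolding D_def C_def using norm_dir_pos[OF ne] polar_dir_norm2[OF in_disc] by (auto simp: cosh_dist_commute)
  have sD: "sqrt ((C n)^2 - 1) = D n" for n using D[of n] by (metis less_imp_le real_sqrt_unique)
  define c where "c n = C (j + int n) / D (j + int n)" for n
  define e where "e n = 1 / D (j + int n)" for n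
  define k where "k n = \<kappa> (xs (j + int n)) / S (j + int n)" for n
  have e2: "(c n)^2 - 1 = (e n)^2" for n
  proof -
    have "(C (j + int n))^2 = (D (j + int n))^2 + 1" using D(2)[of "j + int n"] by simp
    then show ?thesis unfolding c_def e_def using D(1)[of "j + int n"] by (simp add: power_divide add_divide_distrib)
  qed
  have c1: "c n > 1" for n
  proof -
    have "(c n)^2 > 1" using e2[of n] D(1)[of "j + int n"] by (smt (verit) e_def zero_less_divide_1_iff zero_less_power)
    moreover have "c n > 0" unfolding c_def using C[of "j + int n"] D(1)[of "j + int n"] by simp
    ultimately show ?thesis by (metis less_imp_le one_less_power order_less_irrefl power_le_one linorder_not_less)
  qed
  have "(\<Sum>n=1..<N. 2 * artanh (1 / k n)) \<le> (\<Sum>n<N. artanh (1 / c n))"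
  proof (rule focal_sum_le[OF e2 c1 _ N])
    fix m :: nat and \<eta> :: "nat \<Rightarrow> real"
    assume m1: "m \<ge> 1" and \<eta>0: "\<And>i. i = 0 \<or> i > m \<Longrightarrow> \<eta> i = 0" and \<eta>m: "\<eta> m = 1"
    \<comment> \<open>Division by the sine undoes the rescaling. The support \<open>j + 1\<close> to
      \<open>j + m\<close> lies strictly between the fixed endpoints \<open>j\<close> and
      \<open>j + m + 1\<close>.\<close>
    define v where "v n = (if n \<ge> j then \<eta> (nat (n - j)) / S n else 0)" for n :: int
    have v0: "\<forall>n. n \<notin> {j + 1..(j + int (Suc m)) - 1} \<longrightarrow> v n = 0"
      using \<eta>0 by (auto simp: v_def)
    have "v (j + int m) \<noteq> 0" using \<eta>m S[of "j + int m"] by (simp add: v_def)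
    then have "deriv (deriv (\<lambda>t. action g (\<lambda>n. xs n + t * v n) j (j + int (Suc m)))) 0 < 0"
    proof -
      assume "v (j + int m) \<noteq> 0"
      then have "(\<forall>n. n \<notin> {j + 1..(j + int (Suc m)) - 1} \<longrightarrow> v n = 0) \<and> (\<exists>n. v n \<noteq> 0)" using v0 by blast
      moreover have "j < j + int (Suc m)" by simp
      ultimately show ?thesis using conjunct2[OF m[unfolded m_conf_def]] by blast
    qed
    then have "(\<Sum>n\<in>{j..<j + int (Suc m)}. chord_hessian (xs n) (xs (n + 1)) (v n) (v (n + 1))) < 0"
      unfolding action_second_variation[where xs=xs, OF ne] .
    also have "(\<Sum>n\<in>{j..<j + int (Suc m)}. chord_hessian (xs n) (xs (n + 1)) (v n) (v (n + 1)))
      = (\<Sum>n<Suc m. chord_hessian (xs (j + int n)) (xs (j + int n + 1)) (v (j + int n)) (v (j + int n + 1)))"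
      by (rule sum.reindex_bij_witness[of _ "\<lambda>n. j + int n" "\<lambda>n. nat (n - j)"]) auto
    also have "\<dots> = (\<Sum>n<Suc m. c n * ((\<eta> n)^2 + (\<eta> (Suc n))^2) + 2 * e n * \<eta> n * \<eta> (Suc n) - k n * (\<eta> n)^2 - k (Suc n) * (\<eta> (Suc n))^2)"
    proof (rule sum.cong)
      fix n assume "n \<in> {..<Suc m}"
      have v1: "v (j + int n) * S (j + int n) = \<eta> n" using S[of "j + int n"] by (simp add: v_def)
      have "nat (int n + 1) = Suc n" by simp
      then have v2: "v (j + int n + 1) * S (j + int n + 1) = \<eta> (Suc n)" using S[of "j + int n + 1"] by (simp add: v_def algebra_simps)
      show "chord_hessian (xs (j + int n)) (xs (j + int n + 1)) (v (j + int n)) (v (j + int n + 1))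
        = c n * ((\<eta> n)^2 + (\<eta> (Suc n))^2) + 2 * e n * \<eta> n * \<eta> (Suc n) - k n * (\<eta> n)^2 - k (Suc n) * (\<eta> (Suc n))^2"
        unfolding chord_hessian_def Let_def S2 S_def[symmetric] D_def[symmetric] C_def[symmetric] v1 v2
        by (simp add: c_def e_def k_def algebra_simps)
    qed simp
    finally show "(\<Sum>n<Suc m. c n * ((\<eta> n)^2 + (\<eta> (Suc n))^2) + 2 * e n * \<eta> n * \<eta> (Suc n) - k n * (\<eta> n)^2 - k (Suc n) * (\<eta> (Suc n))^2) < 0" .
  qed
  moreover have "artanh (1 / c n) = Lgen g (xs (j + int n)) (xs (j + int n + 1))" for n
    using artanh_eq_arcosh[OF C[of "j + int n"]] unfolding sD by (simp add: c_def Lgen_def hdist_eq C_def)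
  moreover have "1 / k n = S (j + int n) / \<kappa> (xs (j + int n))" for n by (simp add: k_def)
  ultimately show ?thesis by (simp add: S_def)
qed

end

section \<open>The defect\<close>

text \<open>The convex function \<open>k - sqrt (k^2 - 1)\<close> lies above its tangent at
  \<open>m\<close>. The inequality comes from
  \<open>(m * k - 1)^2 - (k^2 - 1) * (m^2 - 1) = (k - m)^2\<close>.\<close>

lemma sqrt_excess_tangent:
  fixes k m :: real
  assumes "k > 1" "m > 1"
  shows "m - sqrt (m^2 - 1) + (1 - m / sqrt (m^2 - 1)) * (k - m) \<le> k - sqrt (k^2 - 1)"
proof -
  have "k^2 > 1" "m^2 > 1" using assms by auto
  then have r: "sqrt (m^2 - 1) > 0" "(sqrt (m^2 - 1))^2 = m^2 - 1" "sqrt (k^2 - 1) > 0" "(sqrt (k^2 - 1))^2 = k^2 - 1" by auto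
  have mk: "m * k - 1 \<ge> 0" using assms mult_mono[of 1 m 1 k] by auto
  have "(sqrt (k^2 - 1) * sqrt (m^2 - 1))^2 \<le> (m * k - 1)^2"
  proof -
    have "(m * k - 1)^2 - (k^2 - 1) * (m^2 - 1) = (k - m)^2" by (simp add: algebra_simps power2_eq_square)
    then show ?thesis unfolding power_mult_distrib r(2,4) using zero_le_power2[of "k - m"] by linarith
  qed
  then have le: "sqrt (k^2 - 1) * sqrt (m^2 - 1) \<le> m * k - 1" using mk by (rule power2_le_imp_le)
  define S where "S = sqrt (m^2 - 1)"
  have S: "S > 0" "S^2 = m^2 - 1" using r by (auto simp: S_def)
  have "sqrt (k^2 - 1) \<le> (m * k - 1) / S" using le S by (simp add: S_def field_simps)
  also have "(m * k - 1) / S = S + m / S * (k - m)"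
  proof -
    have "S + m / S * (k - m) = (S^2 + m * (k - m)) / S" using S(1) by (simp add: field_simps power2_eq_square)
    also have "S^2 + m * (k - m) = m * k - 1" unfolding S(2) by (simp add: algebra_simps power2_eq_square)
    finally show ?thesis by simp
  qed
  finally show ?thesis unfolding S_def[symmetric] by (simp add: algebra_simps)
qed

context hyp_curve
begin

lemma reduce_mod: "reduce (x + of_int m * P) = reduce x"
proof -
  have "(x + of_int m * P) / P = x / P + of_int m" using P_pos by (simp add: field_simps)
  then show ?thesis unfolding reduce_def by (simp add: algebra_simps)
qed

lemma reduce_cong: "g x = g y \<Longrightarrow> reduce x = reduce y"
  unfolding g_eq_iff using reduce_mod by auto

lemma g_reduce: "g (reduce x) = g x" unfolding reduce_shift by (rule g_shift)

text \<open>The link between configurations, whose bounce parameters are arbitrary reals, and orbits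
  of \<open>billiard\<close>, whose parameters are reduced to one period.\<close>

lemma billiard_chord:
  assumes ne: "g Y \<noteq> g X"
  defines "p \<equiv> (reduce X, chord_angle g X Y)"
  shows "p \<in> \<Omega>" "billiard p = (reduce Y, pi - chord_angle g Y X)" "chord_len (fst p) (next_param p) = Lgen g X Y"
proof -
  show "p \<in> \<Omega>" using reduce_bounds[of X] chord_angle_bounds[OF ne] by (simp add: p_def phase_space_def)
  obtain s where s: "0 < s" "s < P" "g Y = g (X + s)" using param_shift[OF ne] .
  define m where "m = - \<lfloor>X / P\<rfloor>"
  have X: "reduce X = X + of_int m * P" unfolding m_def by (rule reduce_shift)
  have gs: "g (reduce X + s) = g Y"
    using g_shift[of "X + s" m] s(3) by (simp add: X algebra_simps)
  have "chord_angle g X Y = ang (reduce X) s"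
  proof -
    have "ang (reduce X) s = ang X s" unfolding X by (rule ang_shift)
    also have "\<dots> = chord_angle g X (X + s)" by (rule ang_eq[OF s(1,2)])
    also have "\<dots> = chord_angle g X Y" by (rule chord_angle_cong2[OF s(3)[symmetric]])
    finally show ?thesis ..
  qed
  then have next_param: "next_param p = s" unfolding p_def using next_param_ang[OF s(1,2)] by simp
  obtain k :: int where k: "reduce X + s = Y + of_int k * P" using gs unfolding g_eq_iff by blast
  have "ang (reduce X + s) (P - s) = chord_angle g (reduce X + s) (reduce X)" using ang_reverse[of s "reduce X"] s by simp
  also have "\<dots> = chord_angle g Y X" unfolding k chord_angle_shift by (rule chord_angle_cong2[OF g_reduce])
  finally show "billiard p = (reduce Y, pi - chord_angle g Y X)"
    using reduce_cong[OF gs] by (simp add: billiard_def next_param) (simp add: p_def)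
  show "chord_len (fst p) (next_param p) = Lgen g X Y"
    unfolding next_param chord_len_def Lgen_def by (simp add: p_def gs g_reduce)
qed

text \<open>The lower bound that the mirror equation gives for the sum of the two focal distances at
  a bounce.\<close>

definition focal_excess :: "real \<times> real \<Rightarrow> real" where
  "focal_excess p = 2 * artanh (sin (snd p) / \<kappa> (fst p))"

definition mean_gap :: "real \<times> real \<Rightarrow> real" where
  "mean_gap p = focal_excess p - chord_len (fst p) (next_param p)"

lemma curv_reduce: "\<kappa> (reduce x) = \<kappa> x" unfolding reduce_shift by (rule curv_shift)

lemma cosh_dist_ge_1: "cosh_dist (g x) (g y) \<ge> 1"
  using cosh_dist_gt_1[OF in_disc in_disc, of x y] by (cases "g x = g y") (auto simp: cosh_dist_def)

lemma chord_len_eq_ln: "chord_len x s = ln (cosh_dist (g x) (g (x + s)) + sqrt ((cosh_dist (g x) (g (x + s)))^2 - 1))"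
  unfolding chord_len_def hdist_eq by (rule arcosh_real_def[OF cosh_dist_ge_1])

lemma chord_len_nonneg: "chord_len x s \<ge> 0"
proof -
  have "(cosh_dist (g x) (g (x + s)))^2 \<ge> 1" using cosh_dist_ge_1 by (simp add: one_le_power)
  then have "sqrt ((cosh_dist (g x) (g (x + s)))^2 - 1) \<ge> 0" by simp
  then have "cosh_dist (g x) (g (x + s)) + sqrt ((cosh_dist (g x) (g (x + s)))^2 - 1) \<ge> 1"
    using cosh_dist_ge_1[of x "x + s"] by linarith
  then show ?thesis unfolding chord_len_eq_ln by (rule ln_ge_zero)
qed

lemma chord_len_bounded: obtains B where "\<And>x s. x \<in> {0..P} \<Longrightarrow> s \<in> {0..P} \<Longrightarrow> chord_len x s \<le> B"
proof -
  let ?C = "\<lambda>p. cosh_dist (g (fst p)) (g (fst p + snd p))"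
  have "continuous_on ({0..P} \<times> {0..P}) ?C"
    by (intro cont_cosh_dist continuous_on_compose2[OF g_cont[of UNIV]] continuous_intros) (auto simp: in_disc)
  then have "compact (?C ` ({0..P} \<times> {0..P}))" by (intro compact_continuous_image compact_Times) auto
  from compact_imp_bounded[OF this] obtain B where B: "\<forall>c\<in>?C ` ({0..P} \<times> {0..P}). norm c \<le> B"
    unfolding bounded_iff by blast
  have "chord_len x s \<le> 2 * B" if "x \<in> {0..P}" "s \<in> {0..P}" for x s
  proof -
    let ?c = "cosh_dist (g x) (g (x + s))"
    have c1: "?c \<ge> 1" by (rule cosh_dist_ge_1)
    have "?C (x, s) \<in> ?C ` ({0..P} \<times> {0..P})" by (rule imageI) (use that in simp)
    from bspec[OF B this] have cB: "?c \<le> B" by simp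
    have "sqrt (?c^2 - 1) \<le> sqrt (?c^2)" by (rule real_sqrt_le_mono) simp
    then have le2: "?c + sqrt (?c^2 - 1) \<le> 2 * ?c" using c1 by simp
    have "sqrt (?c^2 - 1) \<ge> 0" using c1 by (simp add: one_le_power)
    then have "?c + sqrt (?c^2 - 1) > 0" using c1 by linarith
    then have "chord_len x s \<le> ?c + sqrt (?c^2 - 1)" unfolding chord_len_eq_ln by (rule ln_bound)
    then show ?thesis using le2 cB by linarith
  qed
  then show ?thesis using that by blast
qed

lemma curv_measurable [measurable]: "\<kappa> \<in> borel_measurable borel"
  by (rule borel_measurable_continuous_onI[OF curv_cont])

lemma chord_len_measurable [measurable (raw)]:
  assumes "f \<in> borel_measurable M" "h \<in> borel_measurable M"
  shows "(\<lambda>x. chord_len (f x) (h x)) \<in> borel_measurable M"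
proof -
  have "(\<lambda>p. cosh_dist (g (fst p)) (g (fst p + snd p))) \<in> borel_measurable borel"
    by (intro borel_measurable_continuous_onI cont_cosh_dist continuous_on_compose2[OF g_cont[of UNIV]] continuous_intros) (auto simp: in_disc)
  then have "(\<lambda>p. chord_len (fst p) (snd p)) \<in> borel_measurable borel" unfolding chord_len_eq_ln by measurable
  moreover have "(\<lambda>x. (f x, h x)) \<in> borel_measurable M" using assms by simp
  ultimately show ?thesis by (auto dest: measurable_compose[rotated])
qed

lemma focal_excess_measurable [measurable]: "focal_excess \<in> borel_measurable borel"
proof -
  have "(\<lambda>p::real\<times>real. fst p) \<in> borel_measurable borel" "(\<lambda>p::real\<times>real. sin (snd p)) \<in> borel_measurable borel"
    by (auto intro!: borel_measurable_continuous_onI continuous_intros)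
  then show ?thesis unfolding focal_excess_def[abs_def] artanh_def by measurable
qed

lemma phase_emeasure: "emeasure phase_measure (space phase_measure) = ennreal (2 * P)"
proof -
  have s: "(\<integral>\<^sup>+\<phi>. 1 * (ennreal (sin \<phi>) * indicator {0<..<pi} \<phi>) \<partial>lborel) = ennreal 2"
  proof -
    have "(\<integral>\<^sup>+\<phi>. ennreal (sin \<phi>) * indicator {0<..<pi} \<phi> \<partial>lborel) = ennreal (- cos pi - (- cos 0))"
    proof (rule nn_integral_FTC_interior[where F="\<lambda>x. - cos x" and f=sin])
      show "continuous_on {0..pi} (\<lambda>x. - cos x)" by (intro continuous_intros)
      fix x :: real assume "x \<in> {0<..<pi}"
      then show "0 \<le> sin x" by (auto intro!: sin_ge_zero)
      show "((\<lambda>x. - cos x) has_real_derivative sin x) (at x)" by (auto intro!: derivative_eq_intros)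
    qed simp
    then show ?thesis by simp
  qed
  have "emeasure phase_measure (space phase_measure) = (\<integral>\<^sup>+p. 1 \<partial>phase_measure)" by simp
  also have "\<dots> = (\<integral>\<^sup>+x. (\<integral>\<^sup>+\<phi>. 1 * (ennreal (sin \<phi>) * indicator {0<..<pi} \<phi>) \<partial>lborel) * indicator {0..<P} x \<partial>lborel)"
    by (rule phase_integral) simp
  also have "\<dots> = ennreal 2 * emeasure lborel {0..<P}" unfolding s by (rule nn_integral_cmult_indicator) simp
  also have "\<dots> = ennreal (2 * P)" using P_pos by (simp add: ennreal_mult)
  finally show ?thesis .
qed

lemma phase_finite: "finite_measure phase_measure"
  by (rule finite_measureI) (simp add: phase_emeasure)

lemma emeasure_phase: "A \<in> sets phase_measure \<Longrightarrow> emeasure phase_measure A = emeasure bmeasure A"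
  unfolding phase_measure_def using Omega_borel
  by (subst emeasure_restrict_space) (auto simp: bmeasure_sets bmeasure_space sets_restrict_space)

lemma chord_len_integral: "(\<integral>\<^sup>+p. ennreal (chord_len (fst p) (next_param p)) \<partial>phase_measure) \<le> ennreal (2 * pi * area)"
proof -
  note next_param_measurable[measurable]
  define F where "F p = ennreal (chord_len (fst p) (next_param p)) * indicator \<Omega> p" for p
  have "(\<lambda>p. ennreal (chord_len (fst p) (next_param p))) \<in> borel_measurable phase_measure" by measurable
  then have "F \<in> borel_measurable bmeasure"
    unfolding phase_measure_def F_def using Omega_borel
    by (subst (asm) borel_measurable_restrict_space_iff_ennreal) (auto simp: bmeasure_sets bmeasure_space)
  then have F: "F \<in> borel_measurable borel" by (simp add: bmeasure_def)
  have "(\<integral>\<^sup>+p. ennreal (chord_len (fst p) (next_param p)) \<partial>phase_measure) = (\<integral>\<^sup>+p. F p \<partial>phase_measure)"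
    by (intro nn_integral_cong) (simp add: F_def phase_space_space)
  also have "\<dots> = (\<integral>\<^sup>+x. (\<integral>\<^sup>+s. F (x, ang x s) * chord_wt0 x s \<partial>lborel) * indicator {0..<P} x \<partial>lborel)"
    by (rule phase_integral_chord[OF F])
  also have "\<dots> \<le> (\<integral>\<^sup>+x. (\<integral>\<^sup>+s. ennreal (chord_len x s * chord_wt x s) * indicator {0<..<P} s \<partial>lborel) * indicator {0..P} x \<partial>lborel)"
  proof (rule nn_integral_mono)
    fix x
    show "(\<integral>\<^sup>+s. F (x, ang x s) * chord_wt0 x s \<partial>lborel) * indicator {0..<P} x \<le> (\<integral>\<^sup>+s. ennreal (chord_len x s * chord_wt x s) * indicator {0<..<P} s \<partial>lborel) * indicator {0..P} x"
    proof (rule mult_mono)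
      show "(\<integral>\<^sup>+s. F (x, ang x s) * chord_wt0 x s \<partial>lborel) \<le> (\<integral>\<^sup>+s. ennreal (chord_len x s * chord_wt x s) * indicator {0<..<P} s \<partial>lborel)"
      proof (rule nn_integral_mono)
        fix s
        show "F (x, ang x s) * chord_wt0 x s \<le> ennreal (chord_len x s * chord_wt x s) * indicator {0<..<P} s"
      proof (cases "s \<in> {0<..<P}")
        case True
        then have "F (x, ang x s) \<le> ennreal (chord_len x s)" using next_param_ang[of s x] by (simp add: F_def indicator_def)
        then have "F (x, ang x s) * ennreal (chord_wt x s) \<le> ennreal (chord_len x s) * ennreal (chord_wt x s)" by (rule mult_right_mono) simp
        also have "\<dots> = ennreal (chord_len x s * chord_wt x s)" using chord_len_nonneg chord_wt_nonneg[of s x] True by (simp add: ennreal_mult)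
        finally show ?thesis using True by (simp add: chord_wt0_def)
      qed (simp add: chord_wt0_def)
      qed
    qed (auto simp: indicator_def)
  qed
  also have "\<dots> \<le> ennreal (2 * pi * area)" by (rule santalo_le)
  finally show ?thesis .
qed

section \<open>The estimate under a lower curvature bound \<open>k0\<close>\<close>

context
  fixes k0 :: real
  assumes k0: "k0 > 1" and curv_ge: "\<And>t. \<kappa> t \<ge> k0"
begin

lemma sin_div_bounds: "0 \<le> y \<Longrightarrow> y \<le> 1 \<Longrightarrow> 0 \<le> y / \<kappa> x \<and> y / \<kappa> x \<le> 1 / k0 \<and> 1 / k0 < 1"
  using k0 curv_ge[of x] by (auto intro!: frac_le)

lemma focal_excess_bounds:
  assumes "0 \<le> sin (snd p)"
  shows "0 \<le> focal_excess p" "focal_excess p \<le> 2 * artanh (1 / k0)"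
  using sin_div_bounds[OF assms, of "fst p"] unfolding focal_excess_def
  by (auto intro!: artanh_nonneg artanh_mono)

lemma mean_gap_measurable [measurable]: "mean_gap \<in> borel_measurable phase_measure"
proof -
  note next_param_measurable[measurable]
  have [measurable]: "focal_excess \<in> borel_measurable phase_measure" by (rule phase_measurable_borel) auto
  show ?thesis unfolding mean_gap_def[abs_def] by measurable
qed

text \<open>A measurable set containing the m-orbits. Testing every window of the forward orbit, not
  only those starting at time 0, puts it in the form required by
  \<open>bounded_birkhoff_integral_le\<close>.\<close>

definition small_gap_set :: "(real \<times> real) set" where
  "small_gap_set = {p \<in> space phase_measure. \<forall>j N. (\<Sum>i<N. mean_gap ((billiard ^^ (j + i)) p)) \<le> 2 * artanh (1 / k0)}"

lemma m_set_subset: "m_set g P \<subseteq> small_gap_set"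
proof
  fix p assume "p \<in> m_set g P"
  then obtain x \<phi> xs where p: "p = (x, \<phi>)" "p \<in> \<Omega>" "m_conf g P xs" "xs 0 = x" "chord_angle g (xs 0) (xs 1) = \<phi>"
    unfolding m_set_def by auto
  have ne: "g (xs (n + 1)) \<noteq> g (xs n)" and refl: "chord_angle g (xs n) (xs (n + 1)) = pi - chord_angle g (xs n) (xs (n - 1))" for n
    using p(3) by (auto simp: m_conf_def billiard_conf_def)
  define P' where "P' n = (reduce (xs n), chord_angle g (xs n) (xs (n + 1)))" for n :: int
  have orbit: "(billiard ^^ n) p = P' (int n)" for n
  proof (induction n)
    case 0
    then show ?case using p by (auto simp: P'_def phase_space_def reduce_id)
  next
    case (Suc n)
    have "billiard (P' (int n)) = P' (int n + 1)"
      unfolding P'_def using billiard_chord(2)[OF ne, of "int n"] refl[of "int n + 1"] by simp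
    then show ?case using Suc by (simp add: add.commute)
  qed
  define h where "h n = 2 * artanh (sin (chord_angle g (xs n) (xs (n + 1))) / \<kappa> (xs n))" for n :: int
  have gap: "mean_gap (P' n) = h n - Lgen g (xs n) (xs (n + 1))" for n
    unfolding mean_gap_def focal_excess_def using billiard_chord(3)[OF ne, of n] by (simp add: P'_def h_def curv_reduce)
  have h0: "h n \<le> 2 * artanh (1 / k0)" for n
  proof -
    have "0 \<le> sin (chord_angle g (xs n) (xs (n + 1)))" using chord_angle_bounds[OF ne, of n] by (intro sin_ge_zero) auto
    then show ?thesis using focal_excess_bounds(2)[of "(xs n, chord_angle g (xs n) (xs (n + 1)))"] by (simp add: focal_excess_def h_def)
  qed
  have "(\<Sum>i<N. mean_gap ((billiard ^^ (j + i)) p)) \<le> 2 * artanh (1 / k0)" for j N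
  proof (cases "N = 0")
    case True
    then show ?thesis using k0 by (auto intro!: artanh_nonneg)
  next
    case False
    then have N: "N \<ge> 1" by simp
    have "(\<Sum>i<N. mean_gap ((billiard ^^ (j + i)) p)) = (\<Sum>i<N. h (int j + int i)) - (\<Sum>i<N. Lgen g (xs (int j + int i)) (xs (int j + int i + 1)))"
      unfolding orbit gap by (simp add: sum_subtractf)
    \<comment> \<open>The first bounce of the window is split off because
      \<open>m_conf_sum_le\<close> starts with the second; its contribution is what the constant in
      \<open>small_gap_set\<close> allows for.\<close>
    also have "(\<Sum>i<N. h (int j + int i)) = h (int j) + (\<Sum>i=1..<N. h (int j + int i))"
      using N by (simp add: lessThan_atLeast0 sum.atLeast_Suc_lessThan)
    finally have "(\<Sum>i<N. mean_gap ((billiard ^^ (j + i)) p)) = h (int j) + (\<Sum>i=1..<N. h (int j + int i)) - (\<Sum>i<N. Lgen g (xs (int j + int i)) (xs (int j + int i + 1)))" .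
    moreover have "(\<Sum>i=1..<N. h (int j + int i)) \<le> (\<Sum>i<N. Lgen g (xs (int j + int i)) (xs (int j + int i + 1)))"
      unfolding h_def by (rule m_conf_sum_le[OF p(3) N])
    ultimately show ?thesis using h0[of "int j"] by linarith
  qed
  then show "p \<in> small_gap_set" using p(2) by (simp add: small_gap_set_def phase_space_space)
qed

lemma mean_gap_bounded: obtains C where "\<And>p. p \<in> space phase_measure \<Longrightarrow> \<bar>mean_gap p\<bar> \<le> C"
proof -
  obtain B where B: "\<And>x s. x \<in> {0..P} \<Longrightarrow> s \<in> {0..P} \<Longrightarrow> chord_len x s \<le> B" using chord_len_bounded by blast
  have "\<bar>mean_gap p\<bar> \<le> 2 * artanh (1 / k0) + B" if "p \<in> space phase_measure" for p
  proof -
    have p: "p \<in> \<Omega>" using that by (simp add: phase_space_space)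
    then have "0 \<le> sin (snd p)" "fst p \<in> {0..P}" by (auto simp: phase_space_def intro!: sin_ge_zero)
    then have "chord_len (fst p) (next_param p) \<le> B" using B[of "fst p" "next_param p"] next_param[OF p] by auto
    then show ?thesis unfolding mean_gap_def using focal_excess_bounds[OF \<open>0 \<le> sin (snd p)\<close>] chord_len_nonneg[of "fst p" "next_param p"] by linarith
  qed
  then show ?thesis using that by blast
qed

lemma small_gap_set_measurable: "small_gap_set \<in> sets phase_measure" and small_gap_set_integral: "(\<integral>p. indicator small_gap_set p * mean_gap p \<partial>phase_measure) \<le> 0"
proof -
  obtain C where C: "\<And>p. p \<in> space phase_measure \<Longrightarrow> \<bar>mean_gap p\<bar> \<le> C" using mean_gap_bounded by blast
  note b = bounded_birkhoff_integral_le[OF phase_finite billiard_measurable billiard_preserves mean_gap_measurable C, of "2 * artanh (1 / k0)", folded small_gap_set_def]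
  show "small_gap_set \<in> sets phase_measure" "(\<integral>p. indicator small_gap_set p * mean_gap p \<partial>phase_measure) \<le> 0" using b by auto
qed

text \<open>The total curvature is at least \<open>k0 * P > P\<close>, and Gauss--Bonnet bounds it
  by \<open>2 * pi + area\<close>. This makes the radicand in the final bound positive.\<close>

lemma two_pi_area_gt: "2 * pi + area > P"
proof -
  obtain K where K: "(\<kappa> has_integral K) {0..P}" "K \<le> 2 * pi + area" using gauss_bonnet_le .
  have "((\<lambda>t. k0) has_integral (k0 * P)) {0..P}" using has_integral_const_real[of k0 0 P] P_pos by (simp add: mult.commute)
  from has_integral_le[OF this K(1)] have "k0 * P \<le> K" using curv_ge by auto
  moreover have "P < k0 * P" using k0 P_pos by simp
  ultimately show ?thesis using K(2) by linarith
qed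

text \<open>The inner integral is \<open>artanh_sin_integral\<close> with
  \<open>c = 1 / \<kappa> x\<close>. Jensen's inequality is carried out by the tangent at
  \<open>m = (2 * pi + area) / P\<close>, the largest mean curvature that
  \<open>gauss_bonnet_le\<close> permits. The slope \<open>d\<close> is nonpositive, so a smaller
  total curvature only raises the lower bound.\<close>

lemma focal_excess_integral:
  "ennreal (2 * pi * (2 * pi + area - sqrt ((2 * pi + area)^2 - P^2))) \<le> (\<integral>\<^sup>+p. ennreal (focal_excess p) \<partial>phase_measure)"
proof -
  define H where "H x = 2 * pi * (\<kappa> x - sqrt ((\<kappa> x)^2 - 1))" for x
  have inner: "(\<integral>\<^sup>+\<phi>. ennreal (focal_excess (x, \<phi>)) * (ennreal (sin \<phi>) * indicator {0<..<pi} \<phi>) \<partial>lborel) = ennreal (H x)" for x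
  proof -
    define c where "c = 1 / \<kappa> x"
    have kx: "\<kappa> x > 1" using curv_gt_1 .
    have c: "0 < c" "c < 1" using kx by (auto simp: c_def)
    have "((\<lambda>\<phi>. 2 * (artanh (c * sin \<phi>) * sin \<phi>)) has_integral 2 * (pi * (1 - sqrt (1 - c^2)) / c)) {0..pi}"
      by (rule has_integral_mult_right[OF artanh_sin_integral[OF c]])
    moreover have "2 * (pi * (1 - sqrt (1 - c^2)) / c) = H x"
    proof -
      have "1 - c^2 = ((\<kappa> x)^2 - 1) / (\<kappa> x)^2" using kx by (simp add: c_def field_simps power_divide)
      then have "sqrt (1 - c^2) = sqrt ((\<kappa> x)^2 - 1) / \<kappa> x" using kx by (simp add: real_sqrt_divide)
      then show ?thesis using kx by (simp add: H_def c_def field_simps)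
    qed
    ultimately have i: "((\<lambda>\<phi>. 2 * (artanh (c * sin \<phi>) * sin \<phi>)) has_integral H x) {0<..<pi}"
      by (simp add: has_integral_Icc_iff_Ioo)
    have nn: "0 \<le> artanh (c * sin \<phi>)" "0 \<le> sin \<phi>" if "\<phi> \<in> {0<..<pi}" for \<phi>
    proof -
      show s: "0 \<le> sin \<phi>" using that by (intro sin_ge_zero) auto
      have "c * sin \<phi> \<le> c * 1" using c by (intro mult_left_mono) auto
      then have "c * sin \<phi> < 1" using c by linarith
      then show "0 \<le> artanh (c * sin \<phi>)" using c s by (intro artanh_nonneg) auto
    qed
    have "(\<integral>\<^sup>+\<phi>. ennreal (focal_excess (x, \<phi>)) * (ennreal (sin \<phi>) * indicator {0<..<pi} \<phi>) \<partial>lborel) = (\<integral>\<^sup>+\<phi>. ennreal (2 * (artanh (c * sin \<phi>) * sin \<phi>)) * indicator {0<..<pi} \<phi> \<partial>lborel)"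
    proof (rule nn_integral_cong)
      fix \<phi> :: real
      show "ennreal (focal_excess (x, \<phi>)) * (ennreal (sin \<phi>) * indicator {0<..<pi} \<phi>) = ennreal (2 * (artanh (c * sin \<phi>) * sin \<phi>)) * indicator {0<..<pi} \<phi>"
      proof (cases "\<phi> \<in> {0<..<pi}")
        case True
        have "focal_excess (x, \<phi>) = 2 * artanh (c * sin \<phi>)" by (simp add: focal_excess_def c_def)
        then show ?thesis using True nn[OF True] by (simp add: ennreal_mult[symmetric] mult.assoc)
      qed simp
    qed
    also have "\<dots> = ennreal (H x)" by (rule nn_integral_has_integral_lebesgue'[OF _ i]) (use nn in auto)
    finally show ?thesis .
  qed
  define Y where "Y = 2 * pi + area"
  define m where "m = Y / P"
  have YP: "Y > P" unfolding Y_def by (rule two_pi_area_gt)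
  have m: "m > 1" using YP P_pos by (simp add: m_def)
  have Hc: "continuous_on {0..P} H" unfolding H_def by (intro continuous_intros curv_cont)
  have Hnn: "H x \<ge> 0" for x
  proof -
    have "sqrt ((\<kappa> x)^2 - 1) \<le> sqrt ((\<kappa> x)^2)" by (rule real_sqrt_le_mono) simp
    then show ?thesis using curv_gt_1[of x] by (simp add: H_def)
  qed
  have Hi: "(H has_integral integral {0..P} H) {0..P}" using Hc integrable_continuous_real integrable_integral by blast
  obtain K where K: "(\<kappa> has_integral K) {0..P}" "K \<le> Y" using gauss_bonnet_le unfolding Y_def .
  define d where "d = 1 - m / sqrt (m^2 - 1)"
  have d: "d \<le> 0"
  proof -
    have m2: "m^2 > 1" using m by simp
    have "sqrt (m^2 - 1) \<le> sqrt (m^2)" by (rule real_sqrt_le_mono) simp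
    then have "sqrt (m^2 - 1) \<le> m" using m by simp
    then show ?thesis using m2 by (simp add: d_def le_divide_eq)
  qed
  have "((\<lambda>x. 2 * pi * ((m - sqrt (m^2 - 1) - d * m) + d * \<kappa> x)) has_integral 2 * pi * ((m - sqrt (m^2 - 1) - d * m) * P + d * K)) {0..P}"
    using has_integral_const_real[of "m - sqrt (m^2 - 1) - d * m" 0 P] P_pos
    by (intro has_integral_mult_right has_integral_add K(1)) (simp add: mult.commute)
  note lin = this
  have "2 * pi * ((m - sqrt (m^2 - 1) - d * m) * P + d * K) \<le> integral {0..P} H"
  proof -
    have "2 * pi * ((m - sqrt (m^2 - 1) - d * m) + d * \<kappa> x) \<le> H x" for x
      unfolding H_def using sqrt_excess_tangent[OF curv_gt_1[of x] m] by (intro mult_left_mono) (auto simp: d_def[symmetric] algebra_simps)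
    then show ?thesis by (intro has_integral_le[OF lin Hi])
  qed
  moreover have "2 * pi * (Y - sqrt (Y^2 - P^2)) \<le> 2 * pi * ((m - sqrt (m^2 - 1) - d * m) * P + d * K)"
  proof -
    have mP: "m * P = Y" using P_pos by (simp add: m_def)
    have "m^2 - 1 = (Y^2 - P^2) / P^2" using P_pos by (simp add: m_def power_divide diff_divide_distrib)
    then have sP: "sqrt (m^2 - 1) * P = sqrt (Y^2 - P^2)" using P_pos by (simp add: real_sqrt_divide)
    have "(m - sqrt (m^2 - 1) - d * m) * P + d * K = m * P - sqrt (m^2 - 1) * P + d * (K - m * P)" by (simp add: algebra_simps)
    also have "\<dots> = Y - sqrt (Y^2 - P^2) + d * (K - Y)" unfolding mP sP ..
    also have "\<dots> \<ge> Y - sqrt (Y^2 - P^2)" using mult_nonpos_nonpos[OF d, of "K - Y"] K(2) by simp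
    finally show ?thesis by (intro mult_left_mono) auto
  qed
  ultimately have "ennreal (2 * pi * (Y - sqrt (Y^2 - P^2))) \<le> ennreal (integral {0..P} H)" by (intro ennreal_leI) linarith
  also have "\<dots> = (\<integral>\<^sup>+x. ennreal (H x) * indicator {0<..<P} x \<partial>lborel)"
    using Hi by (intro nn_integral_has_integral_lebesgue'[symmetric] Hnn) (simp add: has_integral_Icc_iff_Ioo)
  also have "\<dots> \<le> (\<integral>\<^sup>+x. ennreal (H x) * indicator {0..<P} x \<partial>lborel)"
    by (intro nn_integral_mono mult_left_mono) (auto simp: indicator_def)
  also have "\<dots> = (\<integral>\<^sup>+p. ennreal (focal_excess p) \<partial>phase_measure)"
    by (subst phase_integral) (auto simp: inner)
  finally show ?thesis by (simp add: Y_def)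
qed

text \<open>The term \<open>2 * pi * area\<close> occurs both in the lower bound for the focal
  integral and in the upper bound for the length integral, and it cancels.\<close>

lemma defect_bound:
  "2 * pi * (2 * pi - sqrt ((2 * pi + area)^2 - P^2)) \<le> 2 * artanh (1 / k0) * measure phase_measure (space phase_measure - small_gap_set)"
proof -
  interpret finite_measure phase_measure by (rule phase_finite)
  note next_param_measurable[measurable] small_gap_set_measurable[measurable]
  define l where "l p = chord_len (fst p) (next_param p)" for p
  have fm[measurable]: "focal_excess \<in> borel_measurable phase_measure" by (rule phase_measurable_borel) auto
  have lm[measurable]: "l \<in> borel_measurable phase_measure" unfolding l_def by measurable
  obtain B where B: "\<And>x s. x \<in> {0..P} \<Longrightarrow> s \<in> {0..P} \<Longrightarrow> chord_len x s \<le> B" using chord_len_bounded by blast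
  let ?A = "artanh (1 / k0)"
  have sn: "0 \<le> sin (snd p)" if "p \<in> space phase_measure" for p
    using that by (auto simp: phase_space_space phase_space_def intro!: sin_ge_zero)
  have fb: "0 \<le> focal_excess p" "focal_excess p \<le> 2 * ?A" if "p \<in> space phase_measure" for p
    using focal_excess_bounds[OF sn[OF that]] by auto
  have lb: "0 \<le> l p" "l p \<le> B" if "p \<in> space phase_measure" for p
  proof -
    have "p \<in> \<Omega>" using that by (simp add: phase_space_space)
    then show "l p \<le> B" using B[of "fst p" "next_param p"] next_param[of p] by (auto simp: l_def phase_space_def)
    show "0 \<le> l p" unfolding l_def by (rule chord_len_nonneg)
  qed
  have bI: "integrable phase_measure f" if "f \<in> borel_measurable phase_measure" "\<And>p. p \<in> space phase_measure \<Longrightarrow> \<bar>f p\<bar> \<le> D" for f :: "_ \<Rightarrow> real" and D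
    using that by (intro integrable_const_bound[of _ D]) (auto intro: AE_I2)
  have fi: "integrable phase_measure focal_excess"
  proof (rule bI[OF fm])
    show "\<bar>focal_excess p\<bar> \<le> 2 * ?A" if "p \<in> space phase_measure" for p using fb[OF that] by linarith
  qed
  have li: "integrable phase_measure l"
  proof (rule bI[OF lm])
    show "\<bar>l p\<bar> \<le> B" if "p \<in> space phase_measure" for p using lb[OF that] by linarith
  qed
  define N where "N = space phase_measure - small_gap_set"
  have Nm[measurable]: "N \<in> sets phase_measure" unfolding N_def by measurable
  have ifi: "integrable phase_measure (\<lambda>p. indicator small_gap_set p * focal_excess p)"
    using integrable_mult_indicator[OF small_gap_set_measurable fi] by simp
  have ili: "integrable phase_measure (\<lambda>p. indicator small_gap_set p * l p)"
    using integrable_mult_indicator[OF small_gap_set_measurable li] by simp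
  have iN: "integrable phase_measure (\<lambda>p. 2 * ?A * indicator N p)"
    by (intro integrable_mult_right) (simp add: integrable_indicator_iff emeasure_finite less_top[symmetric])
  have "2 * pi * (2 * pi + area - sqrt ((2 * pi + area)^2 - P^2)) \<le> (\<integral>p. focal_excess p \<partial>phase_measure)"
  proof -
    have "(\<integral>\<^sup>+p. ennreal (focal_excess p) \<partial>phase_measure) = ennreal (\<integral>p. focal_excess p \<partial>phase_measure)"
      by (rule nn_integral_eq_integral[OF fi]) (use fb in \<open>auto intro: AE_I2\<close>)
    then have "ennreal (2 * pi * (2 * pi + area - sqrt ((2 * pi + area)^2 - P^2))) \<le> ennreal (\<integral>p. focal_excess p \<partial>phase_measure)"
      using focal_excess_integral by simp
    moreover have "0 \<le> (\<integral>p. focal_excess p \<partial>phase_measure)" using fb by (intro Bochner_Integration.integral_nonneg) auto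
    ultimately show ?thesis by (simp add: ennreal_le_iff)
  qed
  also have "\<dots> \<le> (\<integral>p. indicator small_gap_set p * focal_excess p + 2 * ?A * indicator N p \<partial>phase_measure)"
  proof (rule integral_mono[OF fi Bochner_Integration.integrable_add[OF ifi iN]])
    fix p assume "p \<in> space phase_measure"
    then show "focal_excess p \<le> indicator small_gap_set p * focal_excess p + 2 * ?A * indicator N p"
      using fb[of p] by (auto simp: N_def indicator_def)
  qed
  also have "\<dots> = (\<integral>p. indicator small_gap_set p * focal_excess p \<partial>phase_measure) + 2 * ?A * measure phase_measure N"
    using Bochner_Integration.integral_add[OF ifi iN] by simp
  also have "(\<integral>p. indicator small_gap_set p * focal_excess p \<partial>phase_measure) \<le> (\<integral>p. indicator small_gap_set p * l p \<partial>phase_measure)"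
  proof -
    have "(\<integral>p. indicator small_gap_set p * mean_gap p \<partial>phase_measure) = (\<integral>p. indicator small_gap_set p * focal_excess p - indicator small_gap_set p * l p \<partial>phase_measure)"
      by (intro Bochner_Integration.integral_cong) (auto simp: mean_gap_def l_def algebra_simps)
    also have "\<dots> = (\<integral>p. indicator small_gap_set p * focal_excess p \<partial>phase_measure) - (\<integral>p. indicator small_gap_set p * l p \<partial>phase_measure)"
      by (rule Bochner_Integration.integral_diff[OF ifi ili])
    finally show ?thesis using small_gap_set_integral by linarith
  qed
  also have "(\<integral>p. indicator small_gap_set p * l p \<partial>phase_measure) \<le> (\<integral>p. l p \<partial>phase_measure)"
    by (rule integral_mono[OF ili li]) (use lb in \<open>auto simp: indicator_def\<close>)
  also have "(\<integral>p. l p \<partial>phase_measure) \<le> 2 * pi * area"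
  proof -
    have "(\<integral>\<^sup>+p. ennreal (l p) \<partial>phase_measure) = ennreal (\<integral>p. l p \<partial>phase_measure)"
      by (rule nn_integral_eq_integral[OF li]) (use lb in \<open>auto intro: AE_I2\<close>)
    then have "ennreal (\<integral>p. l p \<partial>phase_measure) \<le> ennreal (2 * pi * area)" using chord_len_integral by (simp add: l_def)
    then show ?thesis using area_nonneg by (simp add: ennreal_le_iff)
  qed
  finally show ?thesis unfolding N_def by (simp add: algebra_simps)
qed

text \<open>Outer measure is monotone and agrees with the measure on the complement of
  \<open>small_gap_set\<close>, which therefore bounds the outer measure of the complement of the
  m-orbits from below.\<close>

lemma delta_bound:
  "delta_prop g P \<ge> pi / (2 * artanh (1 / k0)) * ((P^2 - area^2 - 4 * pi * area) / (P * (2 * pi + sqrt ((2 * pi + area)^2 - P^2))))"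
proof -
  interpret finite_measure phase_measure by (rule phase_finite)
  define N where "N = space phase_measure - small_gap_set"
  define A where "A = artanh (1 / k0)"
  define R where "R = sqrt ((2 * pi + area)^2 - P^2)"
  have N: "N \<in> sets phase_measure" unfolding N_def using small_gap_set_measurable by simp
  have A: "A > 0"
  proof -
    have "(k0 + 1) / (k0 - 1) > 1" using k0 by simp
    then show ?thesis unfolding A_def artanh_inverse[OF k0] by (simp add: ln_gt_zero)
  qed
  have tot: "emeasure bmeasure \<Omega> = ennreal (2 * P)"
    using phase_emeasure emeasure_phase[OF sets.top] by (simp add: phase_space_space)
  have le: "outer_measure_of bmeasure N \<le> outer_measure_of bmeasure (\<Omega> - m_set g P)"
    by (rule outer_measure_of_mono) (use m_set_subset in \<open>auto simp: N_def phase_space_space\<close>)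
  have "outer_measure_of bmeasure N = ennreal (measure phase_measure N)"
    using N emeasure_phase[OF N] by (simp add: outer_measure_of_eq bmeasure_sets phase_sets emeasure_eq_measure)
  with le have "ennreal (measure phase_measure N) \<le> outer_measure_of bmeasure (\<Omega> - m_set g P)" by simp
  \<comment> \<open>\<open>enn2real\<close> sends infinity to 0, so finiteness is established before
    the two measures are compared as reals.\<close>
  moreover have "outer_measure_of bmeasure (\<Omega> - m_set g P) < \<infinity>"
  proof -
    have "outer_measure_of bmeasure (\<Omega> - m_set g P) \<le> outer_measure_of bmeasure \<Omega>" by (rule outer_measure_of_mono) auto
    also have "\<dots> = ennreal (2 * P)" using tot Omega_borel by (simp add: outer_measure_of_eq bmeasure_sets)
    finally show ?thesis by (simp add: le_less_trans)
  qed
  ultimately have m: "measure phase_measure N \<le> enn2real (outer_measure_of bmeasure (\<Omega> - m_set g P))"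
    by (metis enn2real_ennreal enn2real_mono infinity_ennreal_def measure_nonneg)
  then have dp: "delta_prop g P \<ge> measure phase_measure N / (2 * P)"
    unfolding delta_prop_def tot using P_pos by (simp add: divide_right_mono)
  have "(2 * pi + area)^2 > P^2" using two_pi_area_gt P_pos by (intro power_strict_mono) auto
  then have R: "R > 0" "R^2 = (2 * pi + area)^2 - P^2" by (auto simp: R_def)
  have num: "P^2 - area^2 - 4 * pi * area = (2 * pi - R) * (2 * pi + R)"
  proof -
    have "(2 * pi - R) * (2 * pi + R) = 4 * pi^2 - R^2" by (simp add: algebra_simps power2_eq_square)
    then show ?thesis unfolding R(2) by (simp add: algebra_simps power2_eq_square)
  qed
  have "pi / (2 * A) * ((P^2 - area^2 - 4 * pi * area) / (P * (2 * pi + R))) = pi * (2 * pi - R) / (2 * A * P)"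
  proof -
    have "2 * pi + R \<noteq> 0" using R pi_gt_zero by linarith
    then show ?thesis unfolding num using A P_pos by simp
  qed
  also have "\<dots> \<le> measure phase_measure N / (2 * P)"
  proof -
    have "2 * pi * (2 * pi - R) \<le> 2 * A * measure phase_measure N"
      using defect_bound unfolding N_def A_def R_def .
    then have "pi * (2 * pi - R) \<le> measure phase_measure N * A" by (simp add: algebra_simps)
    then have "pi * (2 * pi - R) / A \<le> measure phase_measure N" using A by (simp add: pos_divide_le_eq)
    then have "pi * (2 * pi - R) / A / (2 * P) \<le> measure phase_measure N / (2 * P)" using P_pos by (intro divide_right_mono) auto
    then show ?thesis by (simp add: mult.assoc mult.left_commute)
  qed
  finally show ?thesis using dp unfolding A_def R_def by linarith
qed

end

end

theorem theorem1p1: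
  fixes \<gamma> :: "real \<Rightarrow> complex" and P A kmin :: real
  assumes curve: "hyp_arclength_curve \<gamma> P"
    and area: "A = hyp_area (region \<gamma>)"
    and kmin: "kmin = (INF x\<in>{0..P}. geod_curv \<gamma> x)"
    and horoconvex: "kmin > 1"
  shows "delta_prop \<gamma> P \<ge>
           pi / (2 * artanh (1 / kmin))
           * ((P^2 - A^2 - 4 * pi * A) / (P * (2 * pi + sqrt ((2 * pi + A)^2 - P^2))))"
proof -
  interpret arc: hyp_arc \<gamma> P by (rule hyp_arc.intro[OF curve])
  have ge: "geod_curv \<gamma> t \<ge> kmin" for t unfolding kmin by (rule arc.curv_ge_INF)
  have gt: "geod_curv \<gamma> t > 1" for t using ge[of t] horoconvex by linarith
  interpret hyp_curve \<gamma> P by unfold_locales (rule gt)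
  show ?thesis unfolding area by (rule delta_bound[OF horoconvex ge])
qed

end
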